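(* Let $\mathcal{F}$ and $\mathcal{G}$ be regular families on $\omega$. Then the following are equivalent: (i) $\mathcal{F}=\mathcal{G}$; (ii) $\mathcal{F}$ and $\mathcal{G}$ are $\pi$-homeomorphic; (iii) $X_{\mathcal{F}}$ and $X_{\mathcal{G}}$ are isometric; (iv) the dual spaces $X_{\mathcal{F}}^*$ and $X_{\mathcal{G}}^*$ are isometric.
   Context: A family on $\omega$ is a set $\mathcal{F}$ of finite subsets of $\omega$ which contains the empty set and all singletons. $\mathcal{F}$ is hereditary if it is closed under subsets. Identifying sets with characteristic functions, $\mathcal{F}$ is a subspace of $2^\omega$ (product topology); $\mathcal{F}$ is compact if it is closed in $2^\omega$. For finite $s,t\subseteq\omega$, $t$ is a spread of $s$ if there is an injective map $\sigma: s\to\omega$ with $\sigma(i)\geq i$ for every $i\in s$ and $\sigma[s]=t$. $\mathcal{F}$ is spreading if every spread of every element of $\mathcal{F}$ belongs to $\mathcal{F}$. $\mathcal{F}$ is regular if it is compact, hereditary and spreading. $\mathcal{F}$ and $\mathcal{G}$ are $\pi$-homeomorphic if there is a permutation (bijection) $\pi:\omega\to\omega$ such that $\mathcal{G}=\{\pi[s]: s\in\mathcal{F}\}$. The scalar field $\mathbb{K}$ is $\mathbb{R}$ or $\mathbb{C}$ (the same for both spaces). For a hereditary family $\mathcal{F}$ on $\omega$, the combinatorial Banach space $X_{\mathcal{F}}$ is the completion of $c_{00}(\omega)$ (finitely supported scalar sequences) with respect to the norm $\|x\| = \sup\{\sum_{i\in s}|x(i)| : s\in\mathcal{F}\}$.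 $X^*$ denotes the topological dual of $X$. Two Banach spaces are isometric if there is a linear bijective norm-preserving operator between them. *)

theory Defs
  imports "HOL-Analysis.Analysis" "HOL-Library.Function_Algebras"
begin

section \<open>Families of finite subsets of the natural numbers\<close>

definition is_family :: "nat set set \<Rightarrow> bool" where
  "is_family F \<longleftrightarrow> (\<forall>s\<in>F. finite s) \<and> {} \<in> F \<and> (\<forall>i. {i} \<in> F)"

definition hereditary :: "nat set set \<Rightarrow> bool" where
  "hereditary F \<longleftrightarrow> (\<forall>s\<in>F. \<forall>t. t \<subseteq> s \<longrightarrow> t \<in> F)"

(* The type nat => bool carries the product topology of the discrete topology on bool. *)
definition compact_family :: "nat set set \<Rightarrow> bool" where
  "compact_family F \<longleftrightarrow> closed ((\<lambda>s i. i \<in> s) ` F :: (nat \<Rightarrow> bool) set)"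

definition is_spread_of :: "nat set \<Rightarrow> nat set \<Rightarrow> bool" where
  "is_spread_of t s \<longleftrightarrow> (\<exists>\<sigma>. inj_on \<sigma> s \<and> (\<forall>i\<in>s. i \<le> \<sigma> i) \<and> \<sigma> ` s = t)"

definition spreading :: "nat set set \<Rightarrow> bool" where
  "spreading F \<longleftrightarrow> (\<forall>s\<in>F. \<forall>t. is_spread_of t s \<longrightarrow> t \<in> F)"

definition regular_family :: "nat set set \<Rightarrow> bool" where
  "regular_family F \<longleftrightarrow> is_family F \<and> compact_family F \<and> hereditary F \<and> spreading F"

definition pi_homeomorphic :: "nat set set \<Rightarrow> nat set set \<Rightarrow> bool" where
  "pi_homeomorphic F G \<longleftrightarrow> (\<exists>\<pi> :: nat \<Rightarrow> nat. bij \<pi> \<and> G = {\<pi> ` s | s. s \<in> F})"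

section \<open>The scalar field\<close>

(* The scalar field is the field of real or of complex numbers, up to an isometric
   isomorphism of real algebras. *)
class real_or_complex = real_normed_field + banach +
  assumes real_or_complex:
    "(\<exists>\<phi> :: 'a \<Rightarrow> real. bij \<phi> \<and> (\<forall>x y. \<phi> (x + y) = \<phi> x + \<phi> y) \<and> (\<forall>x y. \<phi> (x * y) = \<phi> x * \<phi> y)
        \<and> (\<forall>r x. \<phi> (r *\<^sub>R x) = r *\<^sub>R \<phi> x) \<and> (\<forall>x. norm (\<phi> x) = norm x)) \<or>
     (\<exists>\<phi> :: 'a \<Rightarrow> complex. bij \<phi> \<and> (\<forall>x y. \<phi> (x + y) = \<phi> x + \<phi> y) \<and> (\<forall>x y. \<phi> (x * y) = \<phi> x * \<phi> y)
        \<and> (\<forall>r x. \<phi> (r *\<^sub>R x) = r *\<^sub>R \<phi> x) \<and> (\<forall>x. norm (\<phi> x) = norm x))"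

instance real :: real_or_complex
  by standard (rule disjI1, rule exI[of _ "\<lambda>x. x"], simp add: bij_def)

instance complex :: real_or_complex
  by standard (rule disjI2, rule exI[of _ "\<lambda>x. x"], simp add: bij_def)

section \<open>Normed spaces over the scalar field\<close>

(* A normed space is given by a linear subspace of a type that is a vector space, so that the
   subspace may depend on parameters; the norm is relevant on this subspace only. *)
record ('k, 'v) nspace =
  vset :: "'v set"
  smul :: "'k \<Rightarrow> 'v \<Rightarrow> 'v"
  vnorm :: "'v \<Rightarrow> real"

definition normed_space :: "('k::real_or_complex, 'v::ab_group_add) nspace \<Rightarrow> bool" where
  "normed_space X \<longleftrightarrow>
     vector_space (smul X) \<and> module.subspace (smul X) (vset X) \<and>
     (\<forall>x\<in>vset X. 0 \<le> vnorm X x) \<and>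
     (\<forall>x\<in>vset X. vnorm X x = 0 \<longrightarrow> x = 0) \<and>
     (\<forall>x\<in>vset X. \<forall>a. vnorm X (smul X a x) = norm a * vnorm X x) \<and>
     (\<forall>x\<in>vset X. \<forall>y\<in>vset X. vnorm X (x + y) \<le> vnorm X x + vnorm X y)"

definition banach_space :: "('k::real_or_complex, 'v::ab_group_add) nspace \<Rightarrow> bool" where
  "banach_space X \<longleftrightarrow> normed_space X \<and>
     (\<forall>u :: nat \<Rightarrow> 'v. (\<forall>n. u n \<in> vset X) \<and>
        (\<forall>e>0. \<exists>M. \<forall>m\<ge>M. \<forall>n\<ge>M. vnorm X (u m - u n) < e) \<longrightarrow>
        (\<exists>x\<in>vset X. (\<lambda>n. vnorm X (u n - x)) \<longlonglongrightarrow> 0))"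

definition linear_map ::
    "('k, 'v::ab_group_add) nspace \<Rightarrow> ('k, 'w::ab_group_add) nspace \<Rightarrow> ('v \<Rightarrow> 'w) \<Rightarrow> bool" where
  "linear_map X Y T \<longleftrightarrow> T ` vset X \<subseteq> vset Y \<and>
     (\<forall>x\<in>vset X. \<forall>y\<in>vset X. T (x + y) = T x + T y) \<and>
     (\<forall>a. \<forall>x\<in>vset X. T (smul X a x) = smul Y a (T x))"

definition norm_preserving ::
    "('k, 'v) nspace \<Rightarrow> ('k, 'w) nspace \<Rightarrow> ('v \<Rightarrow> 'w) \<Rightarrow> bool" where
  "norm_preserving X Y T \<longleftrightarrow> (\<forall>x\<in>vset X. vnorm Y (T x) = vnorm X x)"

definition isometric ::
    "('k, 'v::ab_group_add) nspace \<Rightarrow> ('k, 'w::ab_group_add) nspace \<Rightarrow> bool" where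
  "isometric X Y \<longleftrightarrow> (\<exists>T. linear_map X Y T \<and> bij_betw T (vset X) (vset Y) \<and> norm_preserving X Y T)"

definition scalar_space :: "('k::real_or_complex, 'k) nspace" where
  "scalar_space = \<lparr>vset = UNIV, smul = (*), vnorm = norm\<rparr>"

(* Functionals on the subspace are represented uniquely by their extensions by 0 to the type. *)
definition dual_space ::
    "('k::real_or_complex, 'v::ab_group_add) nspace \<Rightarrow> ('k, 'v \<Rightarrow> 'k) nspace" where
  "dual_space X =
     \<lparr>vset = {f. linear_map X scalar_space f \<and> (\<exists>C. \<forall>x\<in>vset X. norm (f x) \<le> C * vnorm X x) \<and>
                 (\<forall>x. x \<notin> vset X \<longrightarrow> f x = 0)},
      smul = (\<lambda>a f x. a * f x),
      vnorm = (\<lambda>f. Sup {norm (f x) | x. x \<in> vset X \<and> vnorm X x \<le> 1})\<rparr>"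

definition is_completion_of ::
    "('k::real_or_complex, 'v::ab_group_add) nspace \<Rightarrow> ('k, 'w::ab_group_add) nspace \<Rightarrow> bool" where
  "is_completion_of X E \<longleftrightarrow> banach_space X \<and>
     (\<exists>j. linear_map E X j \<and> norm_preserving E X j \<and>
          (\<forall>x\<in>vset X. \<forall>e>0. \<exists>u\<in>vset E. vnorm X (x - j u) < e))"

section \<open>Combinatorial Banach spaces\<close>

definition c00 :: "(nat \<Rightarrow> 'k::real_or_complex) set" where
  "c00 = {x. finite {i. x i \<noteq> 0}}"

definition fam_norm :: "nat set set \<Rightarrow> (nat \<Rightarrow> 'k::real_or_complex) \<Rightarrow> real" where
  "fam_norm F x = Sup {\<Sum>i\<in>s. norm (x i) | s. s \<in> F}"

definition c00_space :: "nat set set \<Rightarrow> ('k::real_or_complex, nat \<Rightarrow> 'k) nspace" where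
  "c00_space F = \<lparr>vset = c00, smul = (\<lambda>a x i. a * x i), vnorm = fam_norm F\<rparr>"

(* X is a copy of the completion, which is unique up to isometry. *)
definition is_combinatorial_space ::
    "nat set set \<Rightarrow> ('k::real_or_complex, 'v::ab_group_add) nspace \<Rightarrow> bool" where
  "is_combinatorial_space F X \<longleftrightarrow> is_completion_of X (c00_space F)"

definition fam_bdd :: "nat set set \<Rightarrow> (nat \<Rightarrow> 'k::real_or_complex) \<Rightarrow> bool" where
  "fam_bdd F x \<longleftrightarrow> bdd_above {\<Sum>i\<in>s. norm (x i) | s. s \<in> F}"

(* The completion can be realised inside the space of all scalar sequences, so spaces satisfying
   is_combinatorial_space exist for every family and over both scalar fields. *)
definition seq_space :: "nat set set \<Rightarrow> ('k::real_or_complex, nat \<Rightarrow> 'k) nspace" where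
  "seq_space F =
     \<lparr>vset = {x. fam_bdd F x \<and> (\<forall>e>0. \<exists>u\<in>c00. fam_norm F (x - u) < e)},
      smul = (\<lambda>a x i. a * x i), vnorm = fam_norm F\<rparr>"

lemma fam_norm_upper: "fam_bdd F x \<Longrightarrow> s \<in> F \<Longrightarrow> (\<Sum>i\<in>s. norm (x i)) \<le> fam_norm F x"
  unfolding fam_bdd_def fam_norm_def by (rule cSup_upper) auto

lemma fam_norm_least:
  assumes "is_family F" and "\<And>s. s \<in> F \<Longrightarrow> (\<Sum>i\<in>s. norm (x i)) \<le> C"
  shows "fam_bdd F x" "fam_norm F x \<le> C"
proof -
  show "fam_bdd F x" unfolding fam_bdd_def by (rule bdd_aboveI[of _ C]) (use assms(2) in auto)
  show "fam_norm F x \<le> C" unfolding fam_norm_def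
    by (rule cSup_least) (use assms in \<open>auto simp: is_family_def\<close>)
qed

lemma fam_norm_nonneg: "is_family F \<Longrightarrow> fam_bdd F x \<Longrightarrow> 0 \<le> fam_norm F x"
  using fam_norm_upper[of F x "{}"] by (simp add: is_family_def)

lemma fam_norm_coord: "is_family F \<Longrightarrow> fam_bdd F x \<Longrightarrow> norm (x i) \<le> fam_norm F x"
  using fam_norm_upper[of F x "{i}"] by (simp add: is_family_def)

lemma fam_norm_add:
  assumes F: "is_family F" and "fam_bdd F x" "fam_bdd F y"
  shows "fam_bdd F (x + y)" "fam_norm F (x + y) \<le> fam_norm F x + fam_norm F y"
proof -
  have *: "(\<Sum>i\<in>s. norm ((x + y) i)) \<le> fam_norm F x + fam_norm F y" if "s \<in> F" for s
  proof -
    have "(\<Sum>i\<in>s. norm ((x + y) i)) \<le> (\<Sum>i\<in>s. norm (x i) + norm (y i))"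
      by (rule sum_mono) (simp add: norm_triangle_ineq)
    also have "\<dots> \<le> fam_norm F x + fam_norm F y"
      unfolding sum.distrib using fam_norm_upper assms that by (intro add_mono) blast+
    finally show ?thesis .
  qed
  show "fam_bdd F (x + y)" "fam_norm F (x + y) \<le> fam_norm F x + fam_norm F y"
    using fam_norm_least[OF F *] by blast+
qed

lemma fam_norm_scale_le:
  assumes F: "is_family F" and "fam_bdd F x"
  shows "fam_bdd F (\<lambda>i. a * x i)" "fam_norm F (\<lambda>i. a * x i) \<le> norm a * fam_norm F x"
proof -
  have *: "(\<Sum>i\<in>s. norm (a * x i)) \<le> norm a * fam_norm F x" if "s \<in> F" for s
    using fam_norm_upper[OF assms(2) that]
    by (simp add: norm_mult sum_distrib_left[symmetric] mult_left_mono)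
  show "fam_bdd F (\<lambda>i. a * x i)" "fam_norm F (\<lambda>i. a * x i) \<le> norm a * fam_norm F x"
    using fam_norm_least[OF F *] by blast+
qed

lemma fam_norm_zero:
  assumes F: "is_family F"
  shows "fam_bdd F (0 :: nat \<Rightarrow> 'k::real_or_complex) \<and> fam_norm F (0 :: nat \<Rightarrow> 'k) = 0"
proof -
  have *: "(\<Sum>i\<in>s. norm ((0 :: nat \<Rightarrow> 'k) i)) \<le> 0" for s
    by simp
  have "fam_bdd F (0 :: nat \<Rightarrow> 'k)" "fam_norm F (0 :: nat \<Rightarrow> 'k) \<le> 0"
    using fam_norm_least[OF F *] by blast+
  then show ?thesis using fam_norm_nonneg[OF F, of "0 :: nat \<Rightarrow> 'k"] by linarith
qed

lemma fam_norm_scale: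
  fixes x :: "nat \<Rightarrow> 'k::real_or_complex"
  assumes F: "is_family F" and x: "fam_bdd F x"
  shows "fam_norm F (\<lambda>i. a * x i) = norm a * fam_norm F x"
proof (cases "a = 0")
  case True
  then show ?thesis using fam_norm_zero[OF F, where 'k = 'k] by (simp add: zero_fun_def)
next
  case False
  have "fam_norm F x \<le> norm (inverse a) * fam_norm F (\<lambda>i. a * x i)"
    using fam_norm_scale_le(2)[OF F fam_norm_scale_le(1)[OF F x, of a], of "inverse a"] False
    by (simp flip: mult.assoc)
  then have "norm a * fam_norm F x \<le> norm a * (norm (inverse a) * fam_norm F (\<lambda>i. a * x i))"
    by (rule mult_left_mono) simp
  also have "\<dots> = fam_norm F (\<lambda>i. a * x i)"
    using False by (simp add: norm_inverse)
  finally have "norm a * fam_norm F x \<le> fam_norm F (\<lambda>i. a * x i)" .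
  then show ?thesis using fam_norm_scale_le(2)[OF F x, of a] by simp
qed

lemma fam_norm_minus:
  assumes F: "is_family F" and "fam_bdd F x" "fam_bdd F y"
  shows "fam_bdd F (x - y)" "fam_norm F (x - y) \<le> fam_norm F x + fam_norm F y"
proof -
  have "fam_bdd F (- y)" "fam_norm F (- y) = fam_norm F y"
    using fam_norm_scale_le(1)[OF F assms(3), of "-1"] fam_norm_scale[OF F assms(3), of "-1"]
    by (simp_all add: fun_Compl_def)
  then show "fam_bdd F (x - y)" "fam_norm F (x - y) \<le> fam_norm F x + fam_norm F y"
    using fam_norm_add[OF F assms(2), of "- y"] by simp_all
qed

lemma fam_bdd_c00:
  assumes F: "is_family F" and "x \<in> c00"
  shows "fam_bdd F x"
proof (rule fam_norm_least(1)[OF F])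
  fix s assume "s \<in> F"
  then have "finite s" using F by (auto simp: is_family_def)
  have fin: "finite {i. x i \<noteq> 0}" using assms(2) by (simp add: c00_def)
  have "(\<Sum>i\<in>s. norm (x i)) = (\<Sum>i\<in>s \<inter> {i. x i \<noteq> 0}. norm (x i))"
    using \<open>finite s\<close> by (intro sum.mono_neutral_right) auto
  also have "\<dots> \<le> (\<Sum>i\<in>{i. x i \<noteq> 0}. norm (x i))" using fin by (intro sum_mono2) auto
  finally show "(\<Sum>i\<in>s. norm (x i)) \<le> (\<Sum>i\<in>{i. x i \<noteq> 0}. norm (x i))" .
qed

lemma c00_add: "x \<in> c00 \<Longrightarrow> y \<in> c00 \<Longrightarrow> x + y \<in> c00"
  unfolding c00_def mem_Collect_eq by (rule finite_subset[of _ "{i. x i \<noteq> 0} \<union> {i. y i \<noteq> 0}"]) auto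

lemma c00_zero: "0 \<in> c00"
  by (simp add: c00_def)

lemma c00_scale: "x \<in> c00 \<Longrightarrow> (\<lambda>i. a * x i) \<in> c00"
  unfolding c00_def mem_Collect_eq by (rule finite_subset[of _ "{i. x i \<noteq> 0}"]) auto

lemma vset_seq_space:
  "x \<in> vset (seq_space F) \<longleftrightarrow> fam_bdd F x \<and> (\<forall>e>0. \<exists>u\<in>c00. fam_norm F (x - u) < e)"
  by (simp add: seq_space_def)

lemma normed_seq_space:
  assumes F: "is_family F"
  shows "normed_space (seq_space F :: ('k::real_or_complex, _) nspace)"
proof -
  let ?S = "seq_space F :: ('k, _) nspace"
  have [simp]: "smul ?S = (\<lambda>a x i. a * x i)" "vnorm ?S = fam_norm F"
    by (simp_all add: seq_space_def)
  interpret vs: vector_space "smul ?S"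
    by standard (auto simp: fun_eq_iff algebra_simps)
  have bdd: "fam_bdd F x" if "x \<in> vset ?S" for x using that vset_seq_space by blast
  have "vs.subspace (vset ?S)"
  proof (rule vs.subspaceI)
    show "0 \<in> vset ?S"
      unfolding vset_seq_space using fam_norm_zero[OF F, where 'k = 'k]
      by (intro conjI allI impI bexI[OF _ c00_zero]) simp_all
  next
    fix x y assume xy: "x \<in> vset ?S" "y \<in> vset ?S"
    show "x + y \<in> vset ?S" unfolding vset_seq_space
    proof (intro conjI allI impI)
      show "fam_bdd F (x + y)" using fam_norm_add(1)[OF F] bdd xy by blast
      fix e :: real assume "0 < e"
      then have "0 < e / 2" by simp
      then obtain u v where uv: "u \<in> c00" "fam_norm F (x - u) < e / 2"
          "v \<in> c00" "fam_norm F (y - v) < e / 2"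
        using xy unfolding vset_seq_space by blast
      have "fam_norm F ((x - u) + (y - v)) \<le> fam_norm F (x - u) + fam_norm F (y - v)"
        by (rule fam_norm_add(2)[OF F fam_norm_minus(1)[OF F bdd[OF xy(1)] fam_bdd_c00[OF F uv(1)]]
              fam_norm_minus(1)[OF F bdd[OF xy(2)] fam_bdd_c00[OF F uv(3)]]])
      moreover have "(x - u) + (y - v) = (x + y) - (u + v)" by simp
      ultimately have "fam_norm F ((x + y) - (u + v)) < e" using uv by simp
      then show "\<exists>w\<in>c00. fam_norm F (x + y - w) < e" using c00_add uv by blast
    qed
  next
    fix a x assume x: "x \<in> vset ?S"
    show "smul ?S a x \<in> vset ?S" unfolding vset_seq_space
    proof (intro conjI allI impI)
      show "fam_bdd F (smul ?S a x)" using fam_norm_scale_le(1)[OF F bdd[OF x]] by simp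
      fix e :: real assume "0 < e"
      then have "0 < e / (norm a + 1)" by (simp add: add_nonneg_pos)
      then obtain u where u: "u \<in> c00" "fam_norm F (x - u) < e / (norm a + 1)"
        using x unfolding vset_seq_space by blast
      have b: "fam_bdd F (x - u)" using fam_norm_minus F bdd[OF x] fam_bdd_c00 u by blast
      have "fam_norm F (smul ?S a x - (\<lambda>i. a * u i)) = fam_norm F (\<lambda>i. a * (x - u) i)"
        by (rule arg_cong[where f = "fam_norm F"]) (auto simp: fun_eq_iff algebra_simps)
      also have "\<dots> = norm a * fam_norm F (x - u)" by (rule fam_norm_scale[OF F b])
      also have "\<dots> \<le> (norm a + 1) * fam_norm F (x - u)"
        using fam_norm_nonneg[OF F b] by (simp add: algebra_simps)
      also have "\<dots> < e" using u(2) by (simp add: pos_less_divide_eq add_nonneg_pos mult.commute)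
      finally show "\<exists>w\<in>c00. fam_norm F (smul ?S a x - w) < e" using c00_scale[OF u(1)] by blast
    qed
  qed
  moreover have "x = 0" if "x \<in> vset ?S" "fam_norm F x = 0" for x
    using fam_norm_coord[OF F bdd[OF that(1)]] that(2) by (auto simp: fun_eq_iff)
  ultimately show ?thesis unfolding normed_space_def
    using vs.vector_space_axioms fam_norm_nonneg[OF F bdd] fam_norm_scale[OF F bdd] fam_norm_add(2)[OF F bdd bdd]
    by simp
qed

lemma banach_seq_space:
  assumes F: "is_family F"
  shows "banach_space (seq_space F :: ('k::real_or_complex, _) nspace)"
  unfolding banach_space_def
proof (intro conjI allI impI)
  let ?S = "seq_space F :: ('k, _) nspace"
  show "normed_space ?S" by (rule normed_seq_space[OF F])
  have [simp]: "vnorm ?S = fam_norm F" by (simp add: seq_space_def)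
  fix u :: "nat \<Rightarrow> nat \<Rightarrow> 'k" assume "(\<forall>n. u n \<in> vset ?S) \<and>
     (\<forall>e>0. \<exists>M. \<forall>m\<ge>M. \<forall>n\<ge>M. vnorm ?S (u m - u n) < e)"
  then have uS: "\<And>n. u n \<in> vset ?S"
    and cau: "\<And>e. 0 < e \<Longrightarrow> \<exists>M. \<forall>m\<ge>M. \<forall>n\<ge>M. fam_norm F (u m - u n) < e" by auto
  have bu: "fam_bdd F (u n)" for n using uS vset_seq_space by blast
  have bd: "fam_bdd F (u m - u n)" for m n using fam_norm_minus(1)[OF F] bu by blast
  have "Cauchy (\<lambda>n. u n i)" for i
  proof (rule metric_CauchyI)
    fix e :: real assume "0 < e"
    then obtain M where M: "\<forall>m\<ge>M. \<forall>n\<ge>M. fam_norm F (u m - u n) < e" using cau by blast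
    have "dist (u m i) (u n i) < e" if "m \<ge> M" "n \<ge> M" for m n
      using fam_norm_coord[OF F bd, of m n i] M that by (fastforce simp: dist_norm)
    then show "\<exists>M. \<forall>m\<ge>M. \<forall>n\<ge>M. dist (u m i) (u n i) < e" by blast
  qed
  then have "\<forall>i. \<exists>l. (\<lambda>n. u n i) \<longlonglongrightarrow> l" using Cauchy_convergent convergent_def by blast
  then obtain x where x: "\<And>i. (\<lambda>n. u n i) \<longlonglongrightarrow> x i" by metis
  have lim: "\<exists>M. \<forall>m\<ge>M. fam_bdd F (u m - x) \<and> fam_norm F (u m - x) \<le> e" if e: "0 < e" for e
  proof -
    obtain M where M: "\<forall>m\<ge>M. \<forall>n\<ge>M. fam_norm F (u m - u n) < e" using cau e by blast
    have "(\<Sum>i\<in>s. norm ((u m - x) i)) \<le> e" if "m \<ge> M" "s \<in> F" for m s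
    proof (rule LIMSEQ_le_const2)
      show "(\<lambda>n. \<Sum>i\<in>s. norm ((u m - u n) i)) \<longlonglongrightarrow> (\<Sum>i\<in>s. norm ((u m - x) i))"
        unfolding minus_apply by (intro tendsto_intros x)
      show "\<exists>N. \<forall>n\<ge>N. (\<Sum>i\<in>s. norm ((u m - u n) i)) \<le> e"
        using fam_norm_upper[OF bd that(2), of m] M that(1) by (intro exI[of _ M]) (meson less_imp_le order_trans)
    qed
    then show ?thesis using fam_norm_least[OF F, of "u _ - x" e] by blast
  qed
  have "x \<in> vset ?S" unfolding vset_seq_space
  proof (intro conjI allI impI)
    obtain M where M: "fam_bdd F (u M - x)" using lim[of 1] by auto
    have "u M - (u M - x) = x" by simp
    then show "fam_bdd F x" using fam_norm_minus(1)[OF F bu[of M] M] by simp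
    fix e :: real assume "0 < e"
    then have e: "0 < e / 2" by simp
    then obtain m where m: "fam_bdd F (u m - x)" "fam_norm F (u m - x) \<le> e / 2" using lim by blast
    obtain w where w: "w \<in> c00" "fam_norm F (u m - w) < e / 2"
      using uS[of m] e unfolding vset_seq_space by blast
    have "fam_norm F ((u m - w) - (u m - x)) \<le> fam_norm F (u m - w) + fam_norm F (u m - x)"
      by (rule fam_norm_minus(2)[OF F fam_norm_minus(1)[OF F bu fam_bdd_c00[OF F w(1)]] m(1)])
    moreover have "(u m - w) - (u m - x) = x - w" by simp
    ultimately show "\<exists>w\<in>c00. fam_norm F (x - w) < e" using w m by (intro bexI[of _ w]) auto
  qed
  moreover have "(\<lambda>n. fam_norm F (u n - x)) \<longlonglongrightarrow> 0"
  proof (rule LIMSEQ_I)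
    fix e :: real assume "0 < e"
    then have "0 < e / 2" by simp
    then obtain M where "\<forall>m\<ge>M. fam_bdd F (u m - x) \<and> fam_norm F (u m - x) \<le> e / 2"
      using lim by blast
    then show "\<exists>M. \<forall>n\<ge>M. norm (fam_norm F (u n - x) - 0) < e"
      using fam_norm_nonneg[OF F] \<open>0 < e\<close> by (intro exI[of _ M]) fastforce
  qed
  ultimately show "\<exists>x\<in>vset ?S. (\<lambda>n. vnorm ?S (u n - x)) \<longlonglongrightarrow> 0" by auto
qed

theorem combinatorial_space_exists:
  assumes F: "is_family F"
  shows "is_combinatorial_space F (seq_space F :: ('k::real_or_complex, _) nspace)"
  unfolding is_combinatorial_space_def is_completion_of_def
proof (intro conjI exI)
  let ?S = "seq_space F :: ('k, _) nspace" and ?E = "c00_space F :: ('k, _) nspace"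
  show "banach_space ?S" by (rule banach_seq_space[OF F])
  have "x \<in> vset ?S" if "x \<in> c00" for x
    unfolding vset_seq_space
    using fam_bdd_c00[OF F that] fam_norm_zero[OF F, where 'k = 'k] that by (auto intro!: bexI[of _ x])
  then show "linear_map ?E ?S (\<lambda>x. x)"
    by (auto simp: linear_map_def c00_space_def seq_space_def)
  show "norm_preserving ?E ?S (\<lambda>x. x)"
    by (auto simp: norm_preserving_def c00_space_def seq_space_def)
  show "\<forall>x\<in>vset ?S. \<forall>e>0. \<exists>u\<in>vset ?E. vnorm ?S (x - u) < e"
    using vset_seq_space by (auto simp: c00_space_def seq_space_def)
qed

end

theory Submission
  imports Defs "HOL-Analysis.Finite_Function_Topology"
begin

text \<open>
  The heart of the matter is to recover a family from the isometric structure of the dual of its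
  combinatorial space. A functional on \<open>X\<^sub>F\<close> is determined by its coefficients on the unit vectors,
  and it lies in the dual unit ball iff the moduli of its coefficients are dominated, on every
  nonnegative finitely supported vector, by the indicator of some member of \<open>F\<close>
  (\<open>dominated_iff_pair_c00\<close>). In this picture the extreme points of the ball are exactly the
  signed indicators of maximal members of \<open>F\<close>, that is, the coefficient sequences that are
  unimodular on a maximal set of \<open>F\<close> and vanish elsewhere. That these are extreme is a direct
  computation (\<open>maximal_signed_indicator_extreme\<close>). The converse
  (\<open>extreme_is_maximal_signed_indicator\<close>) replaces the theorems of Krein--Milman and Milman by a
  splitting argument: an extreme functional below \<open>max p q\<close>, for seminorms \<open>p\<close> and \<open>q\<close>, is below
  \<open>p\<close> or below \<open>q\<close> (\<open>extreme_linear_below_max\<close>, by Hahn--Banach). Splitting \<open>F\<close> according to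
  whether \<open>n\<close> belongs to a set, for \<open>n = 0, 1, 2, \<dots>\<close>, decides one coordinate after the other,
  and compactness of \<open>F\<close> puts the resulting support into \<open>F\<close>.

  A dual isometry \<open>T\<close> therefore permutes signed indicators of maximal sets. It maps all signed
  indicators to signed indicators (\<open>T_signed_indicator\<close>), by induction along reverse inclusion,
  which is well founded on a compact family of finite sets. For a nonmaximal \<open>s\<close> every set
  \<open>s \<union> {k}\<close> with \<open>k\<close> large is in \<open>F\<close>, so for \<open>c\<close> the image of a signed indicator of \<open>s\<close> and \<open>y\<close> the
  image of the \<open>k\<close>-th unit vector, all moduli of coordinates of \<open>c + \<theta>y\<close> are \<open>0\<close> or \<open>1\<close> for every
  unimodular \<open>\<theta>\<close>. Over the complex numbers this forces the moduli of \<open>c\<close> to be \<open>0\<close> or \<open>1\<close>. Over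
  the reals the values \<open>\<bar>c\<bar> = \<bar>y\<bar> = 1/2\<close> remain conceivable: the real plane carries an isometry
  between its \<open>l\<^sub>1\<close> and \<open>l\<^sub>\<infinity>\<close> norms, and this does identify the spaces of some different
  compact hereditary families that are not both spreading. Here the half would occur for all
  large \<open>k\<close>, which contradicts the spreading property (\<open>no_half_coordinates\<close>).

  Unimodular multiples of unit vectors are the nonzero signed indicators that are not a sum of two
  nonzero signed indicators whose difference is one as well, so \<open>T\<close> permutes the unit vectors up to
  phases, and the underlying permutation carries \<open>F\<close> onto \<open>G\<close>. Finally two spreading families that are permuted
  onto each other coincide: between \<open>s\<close> and itself one can squeeze a set \<open>t\<close> such that \<open>t\<close> is a
  spread of \<open>s\<close> and \<open>s\<close> is a spread of \<open>\<pi>[t]\<close> (\<open>spread_squeeze\<close>). The remaining implications are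
  soft: completions of the same space are isometric, and isometric spaces have isometric duals.
\<close>

section \<open>Spreading families related by a permutation\<close>

text \<open>
  Matching the largest elements of the two sets with each other preserves the hypothesis on the
  remaining sets, because a tail that misses the maximum of \<open>s\<close> misses \<open>s\<close> altogether. The
  hypothesis says that the \<open>k\<close>-th largest element of \<open>s\<close> never exceeds that of \<open>t\<close>.
\<close>
lemma is_spread_ofI_tail_counts:
  assumes "finite s" "finite t" "card s = card t"
    and "\<And>a. card (s \<inter> {a..}) \<le> card (t \<inter> {a..})"
  shows "is_spread_of t s"
  using assms
proof (induction "card s" arbitrary: s t)
  case 0
  then show ?case by (auto simp: is_spread_of_def)
next
  case (Suc n)
  then have ne: "s \<noteq> {}" "t \<noteq> {}" by auto
  define M N where "M = Max s" and "N = Max t"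
  have M: "M \<in> s" "\<And>i. i \<in> s \<Longrightarrow> i \<le> M" and N: "N \<in> t" "\<And>i. i \<in> t \<Longrightarrow> i \<le> N"
    using ne Suc.prems by (auto simp: M_def N_def)
  have "card (s \<inter> {M..}) \<noteq> 0"
    using M Suc.prems by (auto simp: card_eq_0_iff)
  then have "t \<inter> {M..} \<noteq> {}"
    using Suc.prems(4)[of M] by auto
  then have "M \<le> N" using N(2) by force
  have "is_spread_of (t - {N}) (s - {M})"
  proof (rule Suc.hyps)
    show "n = card (s - {M})" "card (s - {M}) = card (t - {N})"
      using Suc M N by auto
    show "card ((s - {M}) \<inter> {a..}) \<le> card ((t - {N}) \<inter> {a..})" for a
    proof (cases "a \<le> M")
      case True
      have "(s - {M}) \<inter> {a..} = (s \<inter> {a..}) - {M}" "(t - {N}) \<inter> {a..} = (t \<inter> {a..}) - {N}" by auto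
      then show ?thesis
        using Suc.prems True M N \<open>M \<le> N\<close> by (simp add: diff_le_mono)
    next
      case False
      then have "(s - {M}) \<inter> {a..} = {}" using M(2) by force
      then show ?thesis by simp
    qed
  qed (use Suc in auto)
  then obtain \<sigma> where \<sigma>: "inj_on \<sigma> (s - {M})" "\<forall>i\<in>s - {M}. i \<le> \<sigma> i" "\<sigma> ` (s - {M}) = t - {N}"
    by (auto simp: is_spread_of_def)
  have "inj_on (\<sigma>(M := N)) s"
    using \<sigma> by (auto simp: inj_on_def)
  moreover have "(\<sigma>(M := N)) ` s = insert N (\<sigma> ` (s - {M}))"
    using M by auto
  then have "(\<sigma>(M := N)) ` s = t"
    using \<sigma>(3) N by auto
  ultimately show ?case
    using \<sigma> \<open>M \<le> N\<close> unfolding is_spread_of_def by (intro exI[of _ "\<sigma>(M := N)"]) auto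
qed

text \<open>
  The idea is to shift \<open>s\<close> upwards to a set whose image under \<open>\<pi>\<close> is still low. A set \<open>t\<close> is built
  by adding the elements of \<open>s\<close> in increasing order. For a new largest element \<open>M\<close>, any index \<open>i\<close>
  with \<open>\<pi> i \<le> M\<close> may be added to \<open>t\<close> as far as \<open>\<pi>[t]\<close> is concerned. As there are \<open>M + 1\<close> such
  indices, the largest unused one is high enough for the tail counts of \<open>t\<close>.
\<close>
lemma spread_squeeze:
  assumes "bij (\<pi> :: nat \<Rightarrow> nat)" "finite s"
  obtains t where "finite t" "is_spread_of t s" "is_spread_of s (\<pi> ` t)"
proof -
  have inj: "inj_on \<pi> u" for u using assms(1) by (meson bij_is_inj inj_on_subset subset_UNIV)
  have "\<exists>t. finite t \<and> card t = card s \<and> (\<forall>a. card (s \<inter> {a..}) \<le> card (t \<inter> {a..}))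
          \<and> is_spread_of s (\<pi> ` t)"
    using assms(2)
  proof (induction s rule: finite_linorder_max_induct)
    case empty
    then show ?case by (intro exI[of _ "{}"]) (auto simp: is_spread_of_def)
  next
    case (insert M s)
    then obtain t where t: "finite t" "card t = card s" "\<And>a. card (s \<inter> {a..}) \<le> card (t \<inter> {a..})"
      "is_spread_of s (\<pi> ` t)" by blast
    then obtain \<rho> where \<rho>: "inj_on \<rho> (\<pi> ` t)" "\<forall>i\<in>\<pi> ` t. i \<le> \<rho> i" "\<rho> ` \<pi> ` t = s"
      by (auto simp: is_spread_of_def)
    define P where "P = {i. \<pi> i \<le> M}"
    have "bij_betw \<pi> P {..M}"
      using assms(1) unfolding P_def
      by (auto simp: bij_betw_def inj)
    then have P: "finite P" "card P = Suc M"
      using bij_betw_finite bij_betw_same_card by fastforce+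
    have "\<pi> i < M" if "i \<in> t" for i
      using \<rho> that insert.hyps by (metis imageI le_less_trans)
    then have tP: "t \<subseteq> P" by (auto simp: P_def less_imp_le)
    have "s \<subseteq> {..<M}" using insert by auto
    then have "card s \<le> M" using subset_eq_atLeast0_lessThan_card by (simp add: lessThan_atLeast0)
    then have "P - t \<noteq> {}"
      using P t(2) tP by (metis Diff_eq_empty_iff card_mono not_less_eq_eq t(1))
    \<comment> \<open>Above \<open>i\<close> the set \<open>t\<close> contains all of \<open>P\<close>, so its tails from \<open>a > i\<close> on
      have at least \<open>M + 1 - a\<close> elements.\<close>
    define i where "i = Max (P - t)"
    have i: "i \<in> P" "i \<notin> t" and imax: "\<And>k. k \<in> P \<Longrightarrow> k > i \<Longrightarrow> k \<in> t"
      using Max_in[of "P - t"] Max_ge[of "P - t"] P \<open>P - t \<noteq> {}\<close> unfolding i_def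
      by (auto simp: leD)
    have Ms: "M \<notin> s" using insert.hyps by auto
    have count: "card (insert M s \<inter> {a..}) \<le> card (insert i t \<inter> {a..})" for a
    proof (cases "a \<le> i")
      case True
      have "card (insert M s \<inter> {a..}) \<le> Suc (card (s \<inter> {a..}))"
        using insert.hyps by (simp add: Int_insert_left card_insert_if)
      moreover have "insert i t \<inter> {a..} = insert i (t \<inter> {a..})" using True by auto
      ultimately show ?thesis using t(1) t(3)[of a] i by simp
    next
      case False
      have "card P \<le> card (insert i t \<inter> {a..} \<union> {..<a})"
        using imax t(1) False by (intro card_mono) (force+)
      also have "\<dots> \<le> card (insert i t \<inter> {a..}) + a"
        using card_Un_le[of "insert i t \<inter> {a..}" "{..<a}"] by simp
      finally have "Suc M - a \<le> card (insert i t \<inter> {a..})" using P by simp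
      moreover have "card (insert M s \<inter> {a..}) \<le> card {a..M}"
        using \<open>s \<subseteq> {..<M}\<close> by (intro card_mono) auto
      ultimately show ?thesis by simp
    qed
    have new: "\<pi> i \<notin> \<pi> ` t"
      using i assms(1) by (simp add: bij_is_inj inj_image_mem_iff)
    then have "(\<rho>(\<pi> i := M)) k = \<rho> k" if "k \<in> \<pi> ` t" for k
      using that by (metis fun_upd_other)
    then have "(\<rho>(\<pi> i := M)) ` (\<pi> ` t) = \<rho> ` \<pi> ` t"
      by (rule image_cong[OF refl])
    then have "(\<rho>(\<pi> i := M)) ` \<pi> ` insert i t = insert M s"
      using \<rho>(3) by (simp only: image_insert fun_upd_same)
    moreover have "inj_on (\<rho>(\<pi> i := M)) (\<pi> ` insert i t)"
      using \<rho>(1,3) Ms new by (auto simp: inj_on_fun_updI)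
    moreover have "\<forall>k\<in>\<pi> ` insert i t. k \<le> (\<rho>(\<pi> i := M)) k"
      using \<rho>(2) i by (auto simp: P_def)
    ultimately have "is_spread_of (insert M s) (\<pi> ` insert i t)"
      unfolding is_spread_of_def by blast
    then show ?case
      using t i Ms insert.hyps count by (intro exI[of _ "insert i t"]) simp
  qed
  then show thesis
    using that is_spread_ofI_tail_counts[OF assms(2)] by metis
qed

text \<open>
  Passing from \<open>s\<close> to \<open>t\<close> and from \<open>\<pi>[t]\<close> back to \<open>s\<close> uses the spreading property once in each
  family, for the set \<open>t\<close> squeezed in between.
\<close>
lemma spreading_subset_of_permuted:
  assumes "is_family F" "spreading F" "spreading G" "bij \<pi>" "\<And>s. s \<in> F \<Longrightarrow> \<pi> ` s \<in> G"
  shows "F \<subseteq> G"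
proof
  fix s assume s: "s \<in> F"
  then have "finite s" using assms(1) by (auto simp: is_family_def)
  then obtain t where "is_spread_of t s" "is_spread_of s (\<pi> ` t)"
    using spread_squeeze[OF assms(4)] by metis
  then show "s \<in> G" using assms s by (metis spreading_def)
qed

lemma pi_homeomorphic_iff_eq:
  assumes "is_family F" "spreading F" "is_family G" "spreading G"
  shows "pi_homeomorphic F G \<longleftrightarrow> F = G"
proof
  assume "pi_homeomorphic F G"
  then obtain \<pi> :: "nat \<Rightarrow> nat" where \<pi>: "bij \<pi>" "G = {\<pi> ` s |s. s \<in> F}"
    by (auto simp: pi_homeomorphic_def)
  have "inv \<pi> ` t \<in> F" if "t \<in> G" for t
    using that \<pi> by (auto simp: image_comp bij_is_inj)
  then have "G \<subseteq> F"
    using spreading_subset_of_permuted[of G F "inv \<pi>"] assms \<pi> bij_imp_bij_inv by blast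
  moreover have "F \<subseteq> G"
    using spreading_subset_of_permuted[of F G \<pi>] assms \<pi> by blast
  ultimately show "F = G" by blast
next
  assume "F = G"
  then show "pi_homeomorphic F G"
    unfolding pi_homeomorphic_def by (intro exI[of _ id]) auto
qed

section \<open>Sublinear functionals and the Hahn--Banach theorem\<close>

definition sublinear :: "('v::real_vector \<Rightarrow> real) \<Rightarrow> bool" where
  "sublinear p \<longleftrightarrow> (\<forall>x y. p (x + y) \<le> p x + p y) \<and> (\<forall>x. \<forall>t\<ge>0. p (t *\<^sub>R x) = t * p x)"

lemma sublinear_add: "sublinear p \<Longrightarrow> p (x + y) \<le> p x + p y"
  and sublinear_scale: "sublinear p \<Longrightarrow> 0 \<le> t \<Longrightarrow> p (t *\<^sub>R x) = t * p x"
  by (auto simp: sublinear_def)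

lemma sublinear_zero: "sublinear p \<Longrightarrow> p 0 = 0"
  using sublinear_scale[of p 0 0] by simp

lemma sublinear_ge: "sublinear p \<Longrightarrow> - p (- x) \<le> p x"
  using sublinear_add[of p x "- x"] sublinear_zero[of p] by simp

text \<open>
  The inequality for \<open>t\<close> and the one for \<open>1/t\<close> give equality.
\<close>
lemma sublinear_homogI:
  fixes p :: "'v::real_vector \<Rightarrow> real"
  assumes "p 0 = 0" "\<And>t x. 0 < t \<Longrightarrow> p (t *\<^sub>R x) \<le> t * p x" "0 \<le> t"
  shows "p (t *\<^sub>R x) = t * p x"
proof (cases "t = 0")
  case False
  then have t: "t > 0" using assms by simp
  have "t * p x \<le> p (t *\<^sub>R x)"
    using assms(2)[of "inverse t" "t *\<^sub>R x"] t by (simp add: field_simps)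
  then show ?thesis using assms(2)[OF t, of x] by simp
qed (use assms in simp)

text \<open>
  Zorn's lemma applies since the pointwise infimum of a chain is sublinear. It is finite because
  every sublinear \<open>q \<le> p\<close> satisfies \<open>q x \<ge> - p (- x)\<close>.
\<close>
lemma minimal_sublinear_exists:
  fixes p :: "'v::real_vector \<Rightarrow> real"
  assumes "sublinear p"
  shows "\<exists>m. sublinear m \<and> m \<le> p \<and> (\<forall>q. sublinear q \<longrightarrow> q \<le> m \<longrightarrow> q = m)"
proof -
  define A where "A = {q. sublinear q \<and> q \<le> p}"
  let ?P = "\<lambda>f g :: 'v \<Rightarrow> real. g \<le> f"
  have "\<exists>m\<in>A. \<forall>a\<in>A. ?P m a \<longrightarrow> a = m"
  proof (rule predicate_Zorn)
    show "partial_order_on A (relation_of ?P A)"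
      by (auto simp: partial_order_on_def preorder_on_def refl_on_def trans_def antisym_def relation_of_def)
    fix C assume "C \<in> Chains (relation_of ?P A)"
    then have CA: "C \<subseteq> A" and chain: "\<And>f g. f \<in> C \<Longrightarrow> g \<in> C \<Longrightarrow> f \<le> g \<or> g \<le> f"
      by (auto simp: Chains_def relation_of_def)
    show "\<exists>u\<in>A. \<forall>a\<in>C. ?P a u"
    proof (cases "C = {}")
      case True
      then show ?thesis using assms by (auto simp: A_def)
    next
      case False
      define u where "u = (\<lambda>x. INF f\<in>C. f x)"
      have bdd: "bdd_below ((\<lambda>f. f x) ` C)" for x
      proof (rule bdd_belowI2)
        fix f assume "f \<in> C"
        then have "sublinear f" "f \<le> p" using CA by (auto simp: A_def)
        then show "- p (- x) \<le> f x"
          using sublinear_ge[of f x] le_funD[of f p "- x"] by simp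
      qed
      have low: "u x \<le> f x" if "f \<in> C" for f x
        unfolding u_def using bdd that by (rule cINF_lower)
      have grt: "c \<le> u x" if "\<And>f. f \<in> C \<Longrightarrow> c \<le> f x" for c x
        unfolding u_def using False that by (rule cINF_greatest)
      have "u (x + y) \<le> u x + u y" for x y
      proof -
        have "u (x + y) - f x \<le> g y" if fg: "f \<in> C" "g \<in> C" for f g
        proof -
          obtain h where h: "h \<in> C" "h \<le> f" "h \<le> g" using chain[OF fg] fg by auto
          have "u (x + y) \<le> h x + h y"
            using low[OF h(1), of "x + y"] sublinear_add[of h x y] h(1) CA by (auto simp: A_def)
          also have "\<dots> \<le> f x + g y" using h by (intro add_mono) (auto simp: le_fun_def)
          finally show ?thesis by simp
        qed
        then have "u (x + y) - f x \<le> u y" if "f \<in> C" for f using grt that by blast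
        then have "u (x + y) - u y \<le> u x" by (intro grt) (simp add: algebra_simps)
        then show ?thesis by simp
      qed
      moreover have "u (t *\<^sub>R x) = t * u x" if "0 \<le> t" for t x
      proof (rule sublinear_homogI[OF _ _ that])
        have "f 0 = 0" if "f \<in> C" for f
          using CA that sublinear_zero by (auto simp: A_def)
        then show "u 0 = 0" using False low[of _ 0] grt[of 0 0] by (metis antisym all_not_in_conv order_refl)
        fix t :: real and x assume t: "0 < t"
        have "u (t *\<^sub>R x) / t \<le> u x"
        proof (rule grt)
          fix f assume f: "f \<in> C"
          then have "f (t *\<^sub>R x) = t * f x" using CA t sublinear_scale[of f t x] by (auto simp: A_def)
          then show "u (t *\<^sub>R x) / t \<le> f x"
            using low[OF f, of "t *\<^sub>R x"] t by (simp add: field_simps)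
        qed
        then show "u (t *\<^sub>R x) \<le> t * u x" using t by (simp add: field_simps)
      qed
      ultimately have "sublinear u" by (simp add: sublinear_def)
      moreover obtain f where "f \<in> C" using False by auto
      then have "u \<le> f" "f \<le> p" using low[of f] CA by (auto simp: A_def le_fun_def)
      then have "u \<le> p" by (rule order_trans)
      ultimately show ?thesis using low by (auto simp: A_def le_fun_def)
    qed
  qed
  then obtain m where m: "m \<in> A" "\<forall>a\<in>A. a \<le> m \<longrightarrow> a = m" by blast
  then show ?thesis unfolding A_def by (intro exI[of _ m]) (auto intro: order_trans)
qed

text \<open>
  For fixed \<open>y\<close>, replacing \<open>m z\<close> by the infimum of \<open>m (z + t y) - t m y\<close> over \<open>t \<ge> 0\<close> yields a
  sublinear functional that is not larger. By minimality it equals \<open>m\<close>, and its bound at \<open>t = 1\<close> is the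
  missing half \<open>m x + m y \<le> m (x + y)\<close> of additivity.
\<close>
lemma minimal_sublinear_linear:
  fixes m :: "'v::real_vector \<Rightarrow> real"
  assumes m: "sublinear m" and min: "\<And>q. sublinear q \<Longrightarrow> q \<le> m \<Longrightarrow> q = m"
  shows "linear m"
proof -
  have add: "m (x + y) = m x + m y" for x y
  proof -
    define q where "q = (\<lambda>z. INF t\<in>{0::real..}. m (z + t *\<^sub>R y) - t * m y)"
    have "- m (- z) \<le> m (z + t *\<^sub>R y) - t * m y" if "t \<ge> 0" for z t
      using sublinear_add[OF m, of "z + t *\<^sub>R y" "- z"] sublinear_scale[OF m that, of y] by simp
    then have bdd: "bdd_below ((\<lambda>t. m (z + t *\<^sub>R y) - t * m y) ` {0..})" for z
      by (intro bdd_belowI2[where m = "- m (- z)"]) auto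
    have low: "q z \<le> m (z + t *\<^sub>R y) - t * m y" if "t \<ge> 0" for z t
      unfolding q_def using that by (intro cINF_lower bdd) auto
    have grt: "c \<le> q z" if "\<And>t. t \<ge> 0 \<Longrightarrow> c \<le> m (z + t *\<^sub>R y) - t * m y" for c z
      unfolding q_def using that by (intro cINF_greatest) auto
    have le: "q z \<le> m z" for z using low[of 0 z] by simp
    have "sublinear q" unfolding sublinear_def
    proof (intro conjI allI impI)
      fix a b
      have *: "q (a + b) \<le> (m (a + t *\<^sub>R y) - t * m y) + (m (b + s *\<^sub>R y) - s * m y)"
        if "t \<ge> 0" "s \<ge> 0" for s t
      proof -
        have "q (a + b) \<le> m ((a + t *\<^sub>R y) + (b + s *\<^sub>R y)) - (t + s) * m y"
          using low[of "t + s" "a + b"] that by (simp add: algebra_simps)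
        also have "\<dots> \<le> m (a + t *\<^sub>R y) + m (b + s *\<^sub>R y) - (t + s) * m y"
          using sublinear_add[OF m, of "a + t *\<^sub>R y" "b + s *\<^sub>R y"] by simp
        finally show ?thesis by (simp add: algebra_simps)
      qed
      have "q (a + b) - (m (a + t *\<^sub>R y) - t * m y) \<le> q b" if "t \<ge> 0" for t
      proof (rule grt)
        fix s :: real assume "0 \<le> s"
        from *[OF that this]
        show "q (a + b) - (m (a + t *\<^sub>R y) - t * m y) \<le> m (b + s *\<^sub>R y) - s * m y" by linarith
      qed
      then have "q (a + b) - q b \<le> q a" by (intro grt) (simp add: algebra_simps)
      then show "q (a + b) \<le> q a + q b" by simp
    next
      fix z and r :: real assume "0 \<le> r"
      show "q (r *\<^sub>R z) = r * q z"
      proof (rule sublinear_homogI[OF _ _ \<open>0 \<le> r\<close>])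
        have "0 \<le> q 0" using sublinear_scale[OF m] by (intro grt) auto
        then show "q 0 = 0" using le[of 0] sublinear_zero[OF m] by simp
        fix r :: real and z assume r: "0 < r"
        have "q (r *\<^sub>R z) / r \<le> q z"
        proof (rule grt)
          fix t :: real assume "0 \<le> t"
          then have "q (r *\<^sub>R z) \<le> m (r *\<^sub>R (z + t *\<^sub>R y)) - (r * t) * m y"
            using low[of "r * t" "r *\<^sub>R z"] r by (simp add: algebra_simps)
          also have "m (r *\<^sub>R (z + t *\<^sub>R y)) = r * m (z + t *\<^sub>R y)"
            using sublinear_scale[OF m] r by simp
          finally show "q (r *\<^sub>R z) / r \<le> m (z + t *\<^sub>R y) - t * m y"
            using r by (simp add: field_simps)
        qed
        then show "q (r *\<^sub>R z) \<le> r * q z" using r by (simp add: field_simps)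
      qed
    qed
    then have "q = m" using min le by (simp add: le_fun_def)
    then have "m x \<le> m (x + y) - m y" using low[of 1 x] by simp
    then show ?thesis using sublinear_add[OF m, of x y] by simp
  qed
  have neg: "m (- x) = - m x" for x
    using add[of x "- x"] sublinear_zero[OF m] by simp
  show ?thesis
  proof (rule linearI)
    fix r :: real and x
    show "m (r *\<^sub>R x) = r *\<^sub>R m x"
    proof (cases "0 \<le> r")
      case False
      then show ?thesis using neg[of "(- r) *\<^sub>R x"] sublinear_scale[OF m, of "- r" x] by simp
    qed (simp add: sublinear_scale[OF m])
  qed (rule add)
qed

theorem hahn_banach_sublinear:
  assumes "sublinear p"
  obtains L where "linear L" "\<And>x. L x \<le> p x"
  using minimal_sublinear_exists[OF assms] minimal_sublinear_linear by (metis le_funD)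

section \<open>Extreme functionals below a maximum of two seminorms\<close>

text \<open>
  Homogeneity extends the bound from the set where \<open>q\<close> is at most \<open>1\<close>. Where \<open>q\<close> vanishes, so do
  all multiples, and a linear functional bounded above on a ray is not positive there.
\<close>
lemma linear_le_scaled_sublinear:
  assumes q: "sublinear q" "\<And>x. 0 \<le> q x" and "linear M"
    and bound: "\<And>x. q x \<le> 1 \<Longrightarrow> M x \<le> c"
  shows "M x \<le> c * q x"
proof (cases "q x = 0")
  case True
  have "M x \<le> 0"
  proof (rule ccontr)
    assume neg: "\<not> M x \<le> 0"
    define t where "t = (\<bar>c\<bar> + 1) / M x"
    have t: "0 \<le> t" using neg by (simp add: t_def)
    then have "M (t *\<^sub>R x) \<le> c"
      using bound[of "t *\<^sub>R x"] sublinear_scale[OF q(1) t, of x] True by simp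
    moreover have "M (t *\<^sub>R x) = \<bar>c\<bar> + 1"
      using neg by (simp add: t_def linear_scale[OF \<open>linear M\<close>])
    ultimately show False by linarith
  qed
  then show ?thesis using True by simp
next
  case False
  then have pos: "0 < q x" using q(2)[of x] by simp
  then have "M ((1 / q x) *\<^sub>R x) \<le> c"
    using bound[of "(1 / q x) *\<^sub>R x"] sublinear_scale[OF q(1), of "1 / q x" x] by simp
  then show ?thesis using pos by (simp add: linear_scale[OF \<open>linear M\<close>] field_simps)
qed

text \<open>
  The functional \<open>f\<close>, viewed on the diagonal of the square of the space, lies below
  \<open>(x, y) \<mapsto> max (p x) (q y)\<close>. A Hahn--Banach extension to the square has the form
  \<open>L x + (f y - L y)\<close>, and the norms of the two summands add up to at most \<open>1\<close>. The sublinear functional \<open>S\<close>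
  below expresses this extension problem in terms of \<open>L\<close> alone.
\<close>
lemma linear_below_max_splits:
  fixes f :: "'v::real_vector \<Rightarrow> real"
  assumes p: "sublinear p" "\<And>x. 0 \<le> p x" and q: "sublinear q" "\<And>x. 0 \<le> q x"
    and f: "linear f" "\<And>x. f x \<le> max (p x) (q x)"
  obtains L c where "linear L" "0 \<le> c" "c \<le> 1"
    "\<And>x. L x \<le> c * p x" "\<And>x. f x - L x \<le> (1 - c) * q x"
proof -
  define r where "r = (\<lambda>x z. max (p (x + z)) (q z) - f z)"
  define S where "S = (\<lambda>x. INF z. r x z)"
  have below: "- p (- x) \<le> r x z" for x z
    using f(2)[of z] sublinear_add[OF p(1), of "x + z" "- x"] p(2)[of "- x"] unfolding r_def by simp
  have low: "S x \<le> r x z" for x z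
    unfolding S_def by (rule cINF_lower) (auto intro: bdd_belowI2[where m = "- p (- x)"] below)
  have grt: "c \<le> S x" if "\<And>z. c \<le> r x z" for c x
    unfolding S_def using that by (intro cINF_greatest) auto
  have "sublinear S" unfolding sublinear_def
  proof (intro conjI allI impI)
    fix x y
    have "S (x + y) \<le> r x z + r y w" for z w
      using low[of "x + y" "z + w"] sublinear_add[OF p(1), of "x + z" "y + w"]
        sublinear_add[OF q(1), of z w] linear_add[OF f(1), of z w]
      unfolding r_def by (simp add: algebra_simps)
    then have "S (x + y) - r x z \<le> S y" for z
      by (intro grt) (simp add: algebra_simps)
    then have "S (x + y) - S y \<le> S x"
      by (intro grt) (simp add: algebra_simps)
    then show "S (x + y) \<le> S x + S y" by simp
  next
    fix x and t :: real assume "0 \<le> t"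
    then show "S (t *\<^sub>R x) = t * S x"
    proof (rule sublinear_homogI[rotated 2])
      have "0 \<le> S 0" by (rule grt) (use below[of 0] sublinear_zero[OF p(1)] in simp)
      moreover have "S 0 \<le> 0"
        using low[of 0 0] sublinear_zero[OF p(1)] sublinear_zero[OF q(1)] linear_0[OF f(1)]
        by (simp add: r_def)
      ultimately show "S 0 = 0" by simp
      fix t :: real and x assume t: "0 < t"
      have "S (t *\<^sub>R x) / t \<le> S x"
      proof (rule grt)
        fix z
        have "r (t *\<^sub>R x) (t *\<^sub>R z) = t * r x z"
          using t sublinear_scale[OF p(1), of t "x + z"] sublinear_scale[OF q(1), of t z]
            linear_scale[OF f(1), of t z]
          by (simp add: r_def scaleR_add_right max_mult_distrib_left right_diff_distrib)
        then show "S (t *\<^sub>R x) / t \<le> r x z"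
          using low[of "t *\<^sub>R x" "t *\<^sub>R z"] t by (simp add: field_simps)
      qed
      then show "S (t *\<^sub>R x) \<le> t * S x" using t by (simp add: field_simps)
    qed
  qed
  then obtain L where L: "linear L" "\<And>x. L x \<le> S x" by (rule hahn_banach_sublinear) blast
  have key: "L a + (f b - L b) \<le> max (p a) (q b)" for a b
    using L(2)[of "a - b"] low[of "a - b" b] linear_diff[OF L(1), of a b] by (simp add: r_def)
  \<comment> \<open>The constant is the norm of \<open>L\<close> with respect to \<open>p\<close>, so that \<open>key\<close> leaves \<open>1 - c\<close>
    for the norm of \<open>f - L\<close> with respect to \<open>q\<close>.\<close>
  define c where "c = (SUP a\<in>{a. p a \<le> 1}. L a)"
  have L1: "L a \<le> 1" if "p a \<le> 1" for a
    using key[of a 0] that sublinear_zero[OF q(1)] linear_0[OF L(1)] linear_0[OF f(1)] by simp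
  then have "bdd_above (L ` {a. p a \<le> 1})" by (intro bdd_aboveI2[where M = 1]) auto
  then have Lc: "L a \<le> c" if "p a \<le> 1" for a
    unfolding c_def using that by (intro cSUP_upper) auto
  have zero: "p 0 \<le> 1" using sublinear_zero[OF p(1)] by simp
  have least: "c \<le> d" if "\<And>a. p a \<le> 1 \<Longrightarrow> L a \<le> d" for d
    unfolding c_def using that zero by (intro cSUP_least) auto
  have "f b - L b \<le> 1 - c" if "q b \<le> 1" for b
  proof -
    have "c \<le> 1 - (f b - L b)"
    proof (rule least)
      fix a assume "p a \<le> 1"
      then show "L a \<le> 1 - (f b - L b)" using key[of a b] that by linarith
    qed
    then show ?thesis by simp
  qed
  then have "f x - L x \<le> (1 - c) * q x" for x
    using linear_le_scaled_sublinear[OF q linear_compose_sub[OF f(1) L(1)]] by blast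
  moreover have "L x \<le> c * p x" for x
    using linear_le_scaled_sublinear[OF p L(1)] Lc by blast
  moreover have "0 \<le> c" using Lc[OF zero] linear_0[OF L(1)] by simp
  moreover have "c \<le> 1" using least L1 by blast
  ultimately show thesis using that L(1) by blast
qed

text \<open>
  With the splitting \<open>f = c (L/c) + (1 - c) (M/(1 - c))\<close>, where \<open>L/c \<le> p\<close> and \<open>M/(1 - c) \<le> q\<close>, the
  functional \<open>f\<close> can be moved in both directions along the segment between the two parts, as long
  as the coefficients stay in the unit interval. Extremality makes the segment trivial.
\<close>
lemma extreme_linear_below_max:
  fixes f :: "'v::real_vector \<Rightarrow> real"
  assumes p: "sublinear p" "\<And>x. 0 \<le> p x" and q: "sublinear q" "\<And>x. 0 \<le> q x"
    and f: "linear f" "\<And>x. f x \<le> max (p x) (q x)"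
    and extreme: "\<And>v. linear v \<Longrightarrow> (\<And>x. f x + v x \<le> max (p x) (q x)) \<Longrightarrow>
                    (\<And>x. f x - v x \<le> max (p x) (q x)) \<Longrightarrow> (\<And>x. v x = 0)"
  shows "(\<forall>x. f x \<le> p x) \<or> (\<forall>x. f x \<le> q x)"
proof -
  obtain L c where L: "linear L" and c: "0 \<le> c" "c \<le> 1"
    and Lp: "\<And>x. L x \<le> c * p x" and Mq: "\<And>x. f x - L x \<le> (1 - c) * q x"
    using linear_below_max_splits[OF p q f] by blast
  consider "c = 0" | "c = 1" | "0 < c" "c < 1" using c by linarith
  then show ?thesis
  proof cases
    case 1
    then have "L x \<le> 0" "L (- x) \<le> 0" for x using Lp[of x] Lp[of "- x"] by auto
    then have "L x = 0" for x using linear_neg[OF L, of x] by (metis antisym neg_le_0_iff_le)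
    then show ?thesis using Mq 1 by simp
  next
    case 2
    have "f x \<le> p x" for x using Lp[of x] Mq[of x] 2 by simp
    then show ?thesis by blast
  next
    case 3
    define t where "t = min c (1 - c)"
    have t: "0 < t" "t \<le> c" "t \<le> 1 - c" using 3 by (auto simp: t_def)
    define M where "M = (\<lambda>x. f x - L x)"
    have M: "linear M" unfolding M_def by (intro linear_compose_sub f L)
    define v where "v = (\<lambda>x. (t / c) * L x - (t / (1 - c)) * M x)"
    have v: "linear v"
      unfolding v_def using linear_compose_scale_right[OF L, of "t / c"]
        linear_compose_scale_right[OF M, of "t / (1 - c)"] by (intro linear_compose_sub) auto
    have mix: "(1 + \<alpha> / c) * L x + (1 - \<alpha> / (1 - c)) * M x \<le> max (p x) (q x)"
      if "\<bar>\<alpha>\<bar> \<le> t" for \<alpha> x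
    proof -
      have pos: "0 \<le> 1 + \<alpha> / c" "0 \<le> 1 - \<alpha> / (1 - c)"
        using that t 3 by (simp_all add: field_simps)
      have "(1 + \<alpha> / c) * L x \<le> (1 + \<alpha> / c) * (c * p x)"
        using pos by (intro mult_left_mono Lp)
      moreover have "(1 - \<alpha> / (1 - c)) * M x \<le> (1 - \<alpha> / (1 - c)) * ((1 - c) * q x)"
        using pos Mq[of x] unfolding M_def by (intro mult_left_mono)
      moreover have "(1 + \<alpha> / c) * (c * p x) = (c + \<alpha>) * p x"
        "(1 - \<alpha> / (1 - c)) * ((1 - c) * q x) = (1 - (c + \<alpha>)) * q x"
        using 3 by (simp_all add: field_simps)
      moreover have "(c + \<alpha>) * p x + (1 - (c + \<alpha>)) * q x \<le> max (p x) (q x)"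
        using that t by (intro convex_bound_le) auto
      ultimately show ?thesis by linarith
    qed
    have "v x = 0" for x
    proof (rule extreme[OF v])
      show "f x + v x \<le> max (p x) (q x)" for x
        using mix[of t x] t by (simp add: v_def M_def algebra_simps)
      show "f x - v x \<le> max (p x) (q x)" for x
        using mix[of "- t" x] t by (simp add: v_def M_def algebra_simps)
    qed
    then have "t * (L x / c - M x / (1 - c)) = 0" for x
      by (simp add: v_def algebra_simps)
    then have "L x / c = M x / (1 - c)" for x
      using t by simp
    then have "(1 - c) * L x = c * M x" for x
      using 3 by (simp add: field_simps)
    then have "L x = c * f x" for x
      by (simp add: M_def algebra_simps)
    then have "f x \<le> p x" for x using Lp[of x] 3 by simp
    then show ?thesis by blast
  qed
qed

section \<open>Domination of sequences by a family of sets\<close>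

text \<open>
  Finitely supported real vectors are represented by the type \<^typ>\<open>nat \<Rightarrow>\<^sub>0 real\<close>, which is a real
  vector space, so that the results on sublinear functionals apply.
\<close>
abbreviation (input) keys where "keys \<equiv> Poly_Mapping.keys"
abbreviation (input) lookup where "lookup \<equiv> Poly_Mapping.lookup"

text \<open>
  For a family of finite sets this describes the unit ball of the dual space. The existential
  form avoids suprema: only finitely many traces \<open>A \<inter> s\<close> exist, so a supremum over \<open>s\<close> would be attained.
  It also makes sense for subfamilies without the empty set or the singletons, which arise by splitting.
\<close>
definition dominated :: "nat set set \<Rightarrow> (nat \<Rightarrow> 'k::real_normed_vector) \<Rightarrow> bool" where
  "dominated H a \<longleftrightarrow> (\<forall>A x. finite A \<longrightarrow> (\<forall>i. 0 \<le> x i) \<longrightarrow>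
     (\<exists>s\<in>H. (\<Sum>i\<in>A. norm (a i) * x i) \<le> (\<Sum>i\<in>A \<inter> s. x i)))"

lemma dominatedD:
  "dominated H a \<Longrightarrow> finite A \<Longrightarrow> (\<And>i. 0 \<le> x i) \<Longrightarrow>
    \<exists>s\<in>H. (\<Sum>i\<in>A. norm (a i) * x i) \<le> (\<Sum>i\<in>A \<inter> s. x i)"
  unfolding dominated_def by blast

lemma dominated_norm_cong:
  assumes "\<And>i. norm (a i) = norm (b i)"
  shows "dominated H a \<longleftrightarrow> dominated H b"
  using assms by (simp add: dominated_def)

lemma dominated_mono: "dominated H a \<Longrightarrow> H \<subseteq> H' \<Longrightarrow> dominated H' a"
  unfolding dominated_def by (meson subsetD)

lemma dominated_nonempty: "dominated H a \<Longrightarrow> H \<noteq> {}"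
  using dominatedD[of H a "{}" "\<lambda>_. 0"] by auto

lemma dominated_coord_zero:
  assumes "dominated H a" "\<And>s. s \<in> H \<Longrightarrow> n \<notin> s"
  shows "a n = 0"
  using dominatedD[OF assms(1), of "{n}" "\<lambda>_. 1"] assms(2) by auto

lemma dominated_coord_le:
  assumes "dominated H a"
  shows "norm (a n) \<le> 1"
proof -
  obtain s where "norm (a n) \<le> (\<Sum>i\<in>{n} \<inter> s. 1)"
    using dominatedD[OF assms, of "{n}" "\<lambda>_. 1"] by auto
  also have "\<dots> \<le> 1" by (simp add: Int_insert_left)
  finally show ?thesis .
qed

text \<open>
  For a family \<open>H\<close> this is the norm of its combinatorial space over the reals. The maximum exists for nonempty \<open>H\<close>, even an infinite one,
  as only finitely many traces on the support occur.
\<close>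
definition peak :: "nat set set \<Rightarrow> (nat \<Rightarrow>\<^sub>0 real) \<Rightarrow> real" where
  "peak H x = (MAX s\<in>H. \<Sum>i\<in>keys x \<inter> s. \<bar>lookup x i\<bar>)"

definition pairing :: "(nat \<Rightarrow> real) \<Rightarrow> (nat \<Rightarrow>\<^sub>0 real) \<Rightarrow> real" where
  "pairing a x = (\<Sum>i\<in>keys x. a i * lookup x i)"

lemma finite_restricted_sums:
  "finite A \<Longrightarrow> finite ((\<lambda>s. \<Sum>i\<in>A \<inter> s. f i) ` H)"
  by (rule finite_subset[of _ "sum f ` Pow A"]) auto

lemma peak_ge:
  assumes "s \<in> H" "finite A"
  shows "(\<Sum>i\<in>A \<inter> s. \<bar>lookup x i\<bar>) \<le> peak H x"
proof -
  have "(\<Sum>i\<in>A \<inter> s. \<bar>lookup x i\<bar>) = (\<Sum>i\<in>(A \<inter> s) \<inter> keys x. \<bar>lookup x i\<bar>)"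
    using assms by (intro sum.mono_neutral_right) (auto simp: in_keys_iff)
  also have "\<dots> \<le> (\<Sum>i\<in>keys x \<inter> s. \<bar>lookup x i\<bar>)"
    by (intro sum_mono2) auto
  also have "\<dots> \<le> peak H x"
    unfolding peak_def using assms by (intro Max_ge finite_restricted_sums) auto
  finally show ?thesis .
qed

lemma peak_attained:
  assumes "H \<noteq> {}"
  obtains s where "s \<in> H" "peak H x = (\<Sum>i\<in>keys x \<inter> s. \<bar>lookup x i\<bar>)"
proof -
  have "peak H x \<in> (\<lambda>s. \<Sum>i\<in>keys x \<inter> s. \<bar>lookup x i\<bar>) ` H"
    unfolding peak_def using assms by (intro Max_in finite_restricted_sums) auto
  then show thesis using that by auto
qed

lemma peak_nonneg: "H \<noteq> {} \<Longrightarrow> 0 \<le> peak H x"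
  by (metis peak_attained sum_nonneg abs_ge_zero)

lemma lookup_scaleR: "lookup (t *\<^sub>R x) i = t *\<^sub>R lookup (x :: nat \<Rightarrow>\<^sub>0 real) i"
proof -
  have "finite {i. t *\<^sub>R lookup x i \<noteq> 0}"
    by (rule finite_subset[of _ "keys x"]) (auto simp: in_keys_iff)
  then show ?thesis by (simp add: scaleR_poly_mapping_def)
qed

lemma sublinear_peak:
  assumes "H \<noteq> {}"
  shows "sublinear (peak H)"
  unfolding sublinear_def
proof (intro conjI allI impI)
  fix x y
  obtain s where s: "s \<in> H" "peak H (x + y) = (\<Sum>i\<in>keys (x + y) \<inter> s. \<bar>lookup (x + y) i\<bar>)"
    using peak_attained[OF assms] by blast
  have "(\<Sum>i\<in>keys (x + y) \<inter> s. \<bar>lookup (x + y) i\<bar>) \<le>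
        (\<Sum>i\<in>keys (x + y) \<inter> s. \<bar>lookup x i\<bar> + \<bar>lookup y i\<bar>)"
    by (intro sum_mono) (simp add: lookup_add)
  also have "\<dots> \<le> peak H x + peak H y"
    unfolding sum.distrib by (intro add_mono peak_ge s) auto
  finally show "peak H (x + y) \<le> peak H x + peak H y" using s by simp
next
  fix x and t :: real assume "0 \<le> t"
  then show "peak H (t *\<^sub>R x) = t * peak H x"
  proof (rule sublinear_homogI[rotated 2])
    show "peak H 0 = 0" using peak_attained[OF assms, of 0] by auto
    fix t :: real and x assume t: "0 < t"
    obtain s where s: "s \<in> H" "peak H (t *\<^sub>R x) = (\<Sum>i\<in>keys (t *\<^sub>R x) \<inter> s. \<bar>lookup (t *\<^sub>R x) i\<bar>)"
      using peak_attained[OF assms] by blast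
    have "(\<Sum>i\<in>keys (t *\<^sub>R x) \<inter> s. \<bar>lookup (t *\<^sub>R x) i\<bar>) = t * (\<Sum>i\<in>keys (t *\<^sub>R x) \<inter> s. \<bar>lookup x i\<bar>)"
      using t by (simp add: lookup_scaleR abs_mult sum_distrib_left)
    also have "\<dots> \<le> t * peak H x"
      using t by (intro mult_left_mono peak_ge s) auto
    finally show "peak H (t *\<^sub>R x) \<le> t * peak H x" using s by simp
  qed
qed

lemma peak_Un:
  assumes "H \<noteq> {}" "H' \<noteq> {}"
  shows "peak (H \<union> H') x = max (peak H x) (peak H' x)"
  unfolding peak_def image_Un using assms by (intro Max_Un finite_restricted_sums) auto

lemma pairing_superset:
  "finite A \<Longrightarrow> keys x \<subseteq> A \<Longrightarrow> pairing a x = (\<Sum>i\<in>A. a i * lookup x i)"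
  unfolding pairing_def by (rule sum.mono_neutral_left) (auto simp: in_keys_iff)

lemma linear_pairing: "linear (pairing a)"
proof (rule linearI)
  fix x y
  show "pairing a (x + y) = pairing a x + pairing a y"
    using keys_add[of x y]
    by (simp add: pairing_superset[of "keys x \<union> keys y"] lookup_add distrib_left sum.distrib)
next
  fix t :: real and x :: "nat \<Rightarrow>\<^sub>0 real"
  have "keys (t *\<^sub>R x) \<subseteq> keys x" by (auto simp: in_keys_iff lookup_scaleR)
  then show "pairing a (t *\<^sub>R x) = t *\<^sub>R pairing a x"
    by (simp add: pairing_superset[of "keys x"] lookup_scaleR sum_distrib_left mult.left_commute)
qed

lemma linear_is_pairing:
  fixes L :: "(nat \<Rightarrow>\<^sub>0 real) \<Rightarrow> real"
  assumes "linear L"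
  shows "L x = pairing (\<lambda>i. L (Poly_Mapping.single i 1)) x"
proof -
  have "x = (\<Sum>i\<in>keys x. lookup x i *\<^sub>R Poly_Mapping.single i 1)"
    by (rule poly_mapping_eqI)
       (simp add: lookup_sum lookup_scaleR lookup_single when_def if_distrib[of "(*) _"] in_keys_iff
         cong: if_cong)
  then have "L x = L (\<Sum>i\<in>keys x. lookup x i *\<^sub>R Poly_Mapping.single i 1)" by simp
  then show ?thesis
    by (simp add: pairing_def linear_sum[OF assms] linear_scale[OF assms] mult.commute)
qed

lemma pairing_add: "pairing (a + b) x = pairing a x + pairing b x"
  and pairing_diff: "pairing (a - b) x = pairing a x - pairing b x"
  by (simp_all add: pairing_def algebra_simps sum.distrib sum_subtractf)

text \<open>
  A sequence and its moduli give the same condition because the seminorm does not depend on signs: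
  the signs of \<open>a\<close> can be moved into the test vector.
\<close>
lemma dominated_iff_pairing:
  fixes a :: "nat \<Rightarrow> real"
  assumes "H \<noteq> {}"
  shows "dominated H a \<longleftrightarrow> (\<forall>x. pairing a x \<le> peak H x)"
proof
  assume dom: "dominated H a"
  show "\<forall>x. pairing a x \<le> peak H x"
  proof
    fix x
    obtain s where s: "s \<in> H"
      "(\<Sum>i\<in>keys x. norm (a i) * \<bar>lookup x i\<bar>) \<le> (\<Sum>i\<in>keys x \<inter> s. \<bar>lookup x i\<bar>)"
      using dominatedD[OF dom, of "keys x" "\<lambda>i. \<bar>lookup x i\<bar>"] by auto
    have "pairing a x \<le> (\<Sum>i\<in>keys x. norm (a i) * \<bar>lookup x i\<bar>)"
      unfolding pairing_def by (intro sum_mono) (simp add: abs_mult[symmetric])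
    also note s(2)
    also have "(\<Sum>i\<in>keys x \<inter> s. \<bar>lookup x i\<bar>) \<le> peak H x" by (rule peak_ge) (use s in auto)
    finally show "pairing a x \<le> peak H x" .
  qed
next
  assume le: "\<forall>x. pairing a x \<le> peak H x"
  show "dominated H a" unfolding dominated_def
  proof (intro allI impI)
    fix A :: "nat set" and x :: "nat \<Rightarrow> real" assume A: "finite A" and x: "\<forall>i. 0 \<le> x i"
    define g where "g = (\<lambda>i. if i \<in> A then sgn (a i) * x i else 0)"
    define y where "y = Abs_poly_mapping g"
    have "finite {i. g i \<noteq> 0}" by (rule finite_subset[OF _ A]) (auto simp: g_def)
    then have y: "lookup y = g" by (simp add: y_def)
    have sub: "keys y \<subseteq> A" by (auto simp: in_keys_iff y g_def split: if_splits)
    obtain s where s: "s \<in> H" "peak H y = (\<Sum>i\<in>keys y \<inter> s. \<bar>lookup y i\<bar>)"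
      using peak_attained[OF assms] by blast
    have "(\<Sum>i\<in>A. norm (a i) * x i) = pairing a y"
      unfolding pairing_superset[OF A sub] y g_def
      by (intro sum.cong) (auto simp: sgn_mult_abs abs_sgn mult.assoc[symmetric])
    also have "\<dots> \<le> (\<Sum>i\<in>keys y \<inter> s. \<bar>lookup y i\<bar>)" using le s(2) by metis
    also have "\<dots> \<le> (\<Sum>i\<in>keys y \<inter> s. x i)"
      using x sub by (intro sum_mono) (auto simp: y g_def abs_mult abs_sgn_eq)
    also have "\<dots> \<le> (\<Sum>i\<in>A \<inter> s. x i)"
      using x sub A by (intro sum_mono2) auto
    finally show "\<exists>s\<in>H. (\<Sum>i\<in>A. norm (a i) * x i) \<le> (\<Sum>i\<in>A \<inter> s. x i)" using s by blast
  qed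
qed

text \<open>
  The extreme points of the unit ball, described by the absence of symmetric perturbations; this form
  is visibly preserved by linear isometries.
\<close>
definition dominated_extreme :: "nat set set \<Rightarrow> (nat \<Rightarrow> 'k::real_normed_vector) \<Rightarrow> bool" where
  "dominated_extreme H a \<longleftrightarrow> dominated H a \<and>
     (\<forall>v. dominated H (a + v) \<longrightarrow> dominated H (a - v) \<longrightarrow> v = 0)"

text \<open>
  This is where the Hahn--Banach theorem enters the combinatorics: the seminorm of a union of
  two families is the maximum of their seminorms.
\<close>
lemma dominated_extreme_split:
  fixes a :: "nat \<Rightarrow> real"
  assumes ext: "dominated_extreme (H \<union> H') a"
  shows "dominated H a \<or> dominated H' a"
proof (cases "H = {} \<or> H' = {}")
  case True
  then show ?thesis using ext by (auto simp: dominated_extreme_def)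
next
  case False
  then have ne: "H \<noteq> {}" "H' \<noteq> {}" "H \<union> H' \<noteq> {}" by auto
  note dom = dominated_iff_pairing[OF ne(3)] peak_Un[OF ne(1,2)]
  have "(\<forall>x. pairing a x \<le> peak H x) \<or> (\<forall>x. pairing a x \<le> peak H' x)"
  proof (rule extreme_linear_below_max[OF sublinear_peak[OF ne(1)] _ sublinear_peak[OF ne(2)]])
    show "pairing a x \<le> max (peak H x) (peak H' x)" for x
      using ext dom by (simp add: dominated_extreme_def)
    fix v x assume v: "linear v" "\<And>x. pairing a x + v x \<le> max (peak H x) (peak H' x)"
      "\<And>x. pairing a x - v x \<le> max (peak H x) (peak H' x)"
    define w where "w = (\<lambda>i. v (Poly_Mapping.single i 1))"
    have vw: "v x = pairing w x" for x
      unfolding w_def by (rule linear_is_pairing[OF v(1)])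
    have "dominated (H \<union> H') (a + w)" "dominated (H \<union> H') (a - w)"
      using v(2,3) dom by (simp_all add: pairing_add pairing_diff vw)
    then have "w = 0" using ext by (simp add: dominated_extreme_def)
    then show "v x = 0" by (simp add: vw pairing_def)
  qed (use ne in \<open>auto simp: peak_nonneg linear_pairing\<close>)
  then show ?thesis using dominated_iff_pairing ne by blast
qed

section \<open>Phases in the scalar field\<close>

text \<open>
  The parallelogram law only involves addition and the norm, so it can be pulled back along the
  identification of the scalar field with the reals or the complex numbers.
\<close>
lemma parallelogram_real_or_complex:
  fixes x y :: "'k::real_or_complex"
  shows "(norm (x + y))\<^sup>2 + (norm (x - y))\<^sup>2 = 2 * (norm x)\<^sup>2 + 2 * (norm y)\<^sup>2"
proof -
  have law: "(norm (u + v))\<^sup>2 + (norm (u - v))\<^sup>2 = 2 * (norm u)\<^sup>2 + 2 * (norm v)\<^sup>2"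
    for u v :: "'b::real_inner"
    by (simp add: power2_norm_eq_inner inner_simps inner_commute)
  have transfer: ?thesis
    if \<phi>: "\<forall>x y. \<phi> (x + y) = \<phi> x + \<phi> y" "\<forall>r x. \<phi> (r *\<^sub>R x) = r *\<^sub>R \<phi> x" "\<forall>x. norm (\<phi> x) = norm x"
    for \<phi> :: "'k \<Rightarrow> 'b::real_inner"
  proof -
    have "\<phi> (x - y) = \<phi> (x + (- 1) *\<^sub>R y)" by simp
    also have "\<dots> = \<phi> x - \<phi> y" using \<phi>(1,2) by (metis diff_conv_add_uminus scaleR_minus1_left)
    finally show ?thesis using law[of "\<phi> x" "\<phi> y"] \<phi> by (metis)
  qed
  show ?thesis
    using real_or_complex[where 'a = 'k] by (elim disjE exE conjE) (rule transfer; assumption)+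
qed

lemma real_or_imaginary_unit:
  "(\<forall>x :: 'k::real_or_complex. \<exists>r. x = of_real r) \<or> (\<exists>\<iota> :: 'k. \<iota> * \<iota> = - 1)"
proof -
  have one: "\<phi> 1 = 1" if "bij \<phi>" "\<forall>x y. \<phi> (x * y) = \<phi> x * \<phi> y" for \<phi> :: "'k \<Rightarrow> 'b::field"
  proof -
    obtain z where "\<phi> z = 1" using \<open>bij \<phi>\<close> by (metis bij_pointE)
    then show ?thesis using that(2) by (metis mult.left_neutral mult.right_neutral)
  qed
  show ?thesis
    using real_or_complex[where 'a = 'k]
  proof
    assume "\<exists>\<phi> :: 'k \<Rightarrow> real. bij \<phi> \<and> (\<forall>x y. \<phi> (x + y) = \<phi> x + \<phi> y) \<and> (\<forall>x y. \<phi> (x * y) = \<phi> x * \<phi> y)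
        \<and> (\<forall>r x. \<phi> (r *\<^sub>R x) = r *\<^sub>R \<phi> x) \<and> (\<forall>x. norm (\<phi> x) = norm x)"
    then obtain \<phi> :: "'k \<Rightarrow> real" where \<phi>: "bij \<phi>" "\<forall>x y. \<phi> (x * y) = \<phi> x * \<phi> y"
      "\<forall>r x. \<phi> (r *\<^sub>R x) = r *\<^sub>R \<phi> x" by blast
    have "\<phi> (of_real (\<phi> x)) = \<phi> x" for x
      using \<phi>(3) one[OF \<phi>(1,2)] by (simp add: of_real_def)
    then have "x = of_real (\<phi> x)" for x
      using \<phi>(1) by (metis bij_is_inj inj_eq)
    then show ?thesis by blast
  next
    assume "\<exists>\<phi> :: 'k \<Rightarrow> complex. bij \<phi> \<and> (\<forall>x y. \<phi> (x + y) = \<phi> x + \<phi> y) \<and> (\<forall>x y. \<phi> (x * y) = \<phi> x * \<phi> y)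
        \<and> (\<forall>r x. \<phi> (r *\<^sub>R x) = r *\<^sub>R \<phi> x) \<and> (\<forall>x. norm (\<phi> x) = norm x)"
    then obtain \<phi> :: "'k \<Rightarrow> complex" where \<phi>: "bij \<phi>" "\<forall>x y. \<phi> (x * y) = \<phi> x * \<phi> y"
      "\<forall>r x. \<phi> (r *\<^sub>R x) = r *\<^sub>R \<phi> x" by blast
    obtain \<iota> where "\<phi> \<iota> = \<i>" using \<phi>(1) by (metis bij_pointE)
    then have "\<phi> (\<iota> * \<iota>) = - 1" using \<phi>(2) by simp
    also have "- 1 = \<phi> ((- 1) *\<^sub>R 1)" using \<phi>(3) one[OF \<phi>(1,2)] by (metis scaleR_minus1_left)
    finally have "\<iota> * \<iota> = - 1" using \<phi>(1) by (metis bij_is_inj inj_eq scaleR_minus1_left)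
    then show ?thesis by blast
  qed
qed

text \<open>
  Scalars of modulus \<open>1\<close> are extreme points of the unit disc, by the parallelogram law.
\<close>
lemma unimodular_plus_minus_le_one:
  fixes \<theta> v :: "'k::real_or_complex"
  assumes "norm \<theta> = 1" "norm (\<theta> + v) \<le> 1" "norm (\<theta> - v) \<le> 1"
  shows "v = 0"
proof -
  have "(norm (\<theta> + v))\<^sup>2 \<le> 1" "(norm (\<theta> - v))\<^sup>2 \<le> 1"
    using assms by (simp_all add: power_le_one)
  then have "(norm v)\<^sup>2 \<le> 0"
    using parallelogram_real_or_complex[of \<theta> v] unfolding assms(1) power_one by linarith
  then show ?thesis by simp
qed

lemma unimodular_sum_or_diff:
  fixes a b :: "'k::real_or_complex"
  assumes "norm a = 1" "norm b = 1" "norm (a + b) \<in> {0, 1}" "norm (a - b) \<in> {0, 1}"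
  shows False
proof -
  have "(norm (a + b))\<^sup>2 \<le> 1" "(norm (a - b))\<^sup>2 \<le> 1" using assms(3,4) by auto
  then show False using parallelogram_real_or_complex[of a b] assms(1,2) by simp
qed

text \<open>
  Choosing \<open>\<theta>\<close> so that \<open>\<theta>y\<close> points in the direction of \<open>c\<close>, and then in the opposite direction,
  shows that \<open>\<bar>c\<bar> + \<bar>y\<bar>\<close> and \<open>\<bar>c\<bar> - \<bar>y\<bar>\<close> have modulus \<open>0\<close> or \<open>1\<close>. This leaves the two cases with a zero and
  the case of two halves, in which an imaginary unit \<open>\<iota>\<close> would give the modulus \<open>\<bar>1 + \<iota>\<bar> / 2\<close>,
  the square root of \<open>1/2\<close>.
\<close>
lemma zero_one_norm_all_phases:
  fixes c y :: "'k::real_or_complex"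
  assumes all: "\<And>\<theta>. norm \<theta> = 1 \<Longrightarrow> norm (c + \<theta> * y) \<in> {0, 1}"
  shows "(c = 0 \<and> norm y \<in> {0, 1}) \<or> (y = 0 \<and> norm c \<in> {0, 1}) \<or>
    (norm c = 1/2 \<and> norm y = 1/2 \<and> (\<forall>x :: 'k. \<exists>r. x = of_real r))"
proof (cases "c = 0 \<or> y = 0")
  case True
  then show ?thesis using all[of 1] by auto
next
  case False
  define \<theta> where "\<theta> = sgn c / sgn y"
  have \<theta>: "norm \<theta> = 1" using False by (simp add: \<theta>_def norm_divide norm_sgn)
  have cy: "c = of_real (norm c) * sgn c" "y = of_real (norm y) * sgn y"
    using False by (simp_all add: sgn_div_norm scaleR_conv_of_real)
  have ty: "\<theta> * y = of_real (norm y) * sgn c"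
    using False by (subst cy(2)) (simp add: \<theta>_def sgn_zero_iff)
  have comb: "norm (c + \<mu> * (\<theta> * y)) = norm (of_real (norm c) + \<mu> * of_real (norm y))" for \<mu> :: 'k
  proof -
    have "c + \<mu> * (\<theta> * y) = (of_real (norm c) + \<mu> * of_real (norm y)) * sgn c"
      by (subst cy(1)) (simp add: ty algebra_simps)
    then show ?thesis using False by (simp add: norm_mult norm_sgn)
  qed
  have "norm (c + 1 * (\<theta> * y)) = norm c + norm y"
    unfolding comb by (simp flip: of_real_add)
  moreover have "norm (c + (- 1) * (\<theta> * y)) = \<bar>norm c - norm y\<bar>"
    unfolding comb by (simp flip: of_real_diff)
  ultimately have "norm c + norm y \<in> {0, 1}" "\<bar>norm c - norm y\<bar> \<in> {0, 1}"
    using all[of \<theta>] all[of "- \<theta>"] \<theta> by simp_all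
  moreover have "0 < norm c" "0 < norm y" using False by auto
  ultimately have half: "norm c = 1/2" "norm y = 1/2" by (auto simp del: zero_less_norm_iff)
  have "\<not> (\<exists>\<iota> :: 'k. \<iota> * \<iota> = - 1)"
  proof
    assume "\<exists>\<iota> :: 'k. \<iota> * \<iota> = - 1"
    then obtain \<iota> :: 'k where \<iota>: "\<iota> * \<iota> = - 1" by blast
    have "norm \<iota> * norm \<iota> = 1" using arg_cong[OF \<iota>, of norm] by (simp add: norm_mult)
    then have "(norm \<iota>)\<^sup>2 = 1\<^sup>2" by (simp add: power2_eq_square)
    then have n\<iota>: "norm \<iota> = 1" by (rule power2_eq_imp_eq) auto
    have "1 + \<iota> = \<iota> * (1 - \<iota>)" using \<iota> by (simp add: algebra_simps)
    then have "norm (1 + \<iota>) = norm (1 - \<iota>)" using n\<iota> by (simp add: norm_mult)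
    then have two: "(norm (1 + \<iota>))\<^sup>2 = 2"
      using parallelogram_real_or_complex[of 1 \<iota>] n\<iota> by simp
    have factor: "of_real (1/2) + \<iota> * of_real (1/2) = (1 + \<iota>) * of_real (1/2)"
      by (simp add: algebra_simps)
    have "norm (c + \<iota> * (\<theta> * y)) = norm (1 + \<iota>) / 2"
      unfolding comb half factor norm_mult norm_of_real by simp
    moreover have "norm (c + \<iota> * (\<theta> * y)) \<in> {0, 1}"
      using all[of "\<iota> * \<theta>"] n\<iota> \<theta> by (simp add: norm_mult mult.assoc)
    ultimately have "norm (1 + \<iota>) = 0 \<or> norm (1 + \<iota>) = 2" by auto
    then show False using two by auto
  qed
  then show ?thesis using half real_or_imaginary_unit by blast
qed

section \<open>Extreme dominated sequences\<close>

abbreviation supp :: "(nat \<Rightarrow> 'k::zero) \<Rightarrow> nat set" where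
  "supp a \<equiv> {i. a i \<noteq> 0}"

definition signed_indicators :: "nat set set \<Rightarrow> (nat \<Rightarrow> 'k::real_or_complex) set" where
  "signed_indicators F = {a. (\<forall>i. norm (a i) \<in> {0, 1}) \<and> supp a \<in> F}"

definition maximal_in :: "nat set set \<Rightarrow> nat set \<Rightarrow> bool" where
  "maximal_in F s \<longleftrightarrow> s \<in> F \<and> (\<forall>t\<in>F. s \<subseteq> t \<longrightarrow> t = s)"

lemma signed_indicator_dominated:
  assumes "a \<in> signed_indicators F"
  shows "dominated F a"
  unfolding dominated_def
proof (intro allI impI bexI)
  show "supp a \<in> F" using assms by (simp add: signed_indicators_def)
  fix A :: "nat set" and x :: "nat \<Rightarrow> real" assume "finite A" "\<forall>i. 0 \<le> x i"
  have "(\<Sum>i\<in>A. norm (a i) * x i) = (\<Sum>i\<in>A \<inter> supp a. norm (a i) * x i)"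
    using \<open>finite A\<close> by (intro sum.mono_neutral_right) auto
  also have "\<dots> = (\<Sum>i\<in>A \<inter> supp a. x i)"
    using assms by (intro sum.cong) (auto simp: signed_indicators_def)
  finally show "(\<Sum>i\<in>A. norm (a i) * x i) \<le> (\<Sum>i\<in>A \<inter> supp a. x i)" by simp
qed

text \<open>
  On the support of \<open>a\<close> a perturbation vanishes by strict convexity of the scalar field. Off the
  support, at a point \<open>i\<close>, the test vector is the indicator of \<open>supp a \<union> {i}\<close>. By maximality no member of \<open>F\<close>
  contains this set, so its norm is the size of \<open>supp a\<close>, and nothing is left for the coordinate \<open>i\<close>.
\<close>
lemma maximal_signed_indicator_extreme:
  assumes F: "is_family F" and a: "a \<in> signed_indicators F" and max: "maximal_in F (supp a)"
  shows "dominated_extreme F a"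
  unfolding dominated_extreme_def
proof (intro conjI allI impI ext)
  show "dominated F a" by (rule signed_indicator_dominated[OF a])
  fix v j assume v: "dominated F (a + v)" "dominated F (a - v)"
  let ?s = "supp a"
  have fin: "finite ?s" using F max by (auto simp: maximal_in_def is_family_def)
  have on: "v i = 0" if "i \<in> ?s" for i
    using unimodular_plus_minus_le_one[of "a i" "v i"] dominated_coord_le[OF v(1), of i]
      dominated_coord_le[OF v(2), of i] that a by (auto simp: signed_indicators_def)
  have off: "v i = 0" if i: "i \<notin> ?s" for i
  proof -
    obtain t where t: "t \<in> F" "(\<Sum>k\<in>insert i ?s. norm ((a + v) k) * 1) \<le> (\<Sum>k\<in>insert i ?s \<inter> t. 1)"
      using dominatedD[OF v(1), of "insert i ?s" "\<lambda>_. 1"] fin by auto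
    have "(\<Sum>k\<in>?s. norm ((a + v) k)) = (\<Sum>k\<in>?s. 1)"
      using on a by (intro sum.cong) (auto simp: signed_indicators_def)
    then have sum: "(\<Sum>k\<in>insert i ?s. norm ((a + v) k) * 1) = norm (v i) + card ?s"
      using fin i by simp
    have "\<not> insert i ?s \<subseteq> t"
      using max t(1) i unfolding maximal_in_def by blast
    then have "insert i ?s \<inter> t \<subset> insert i ?s" by blast
    then have "card (insert i ?s \<inter> t) < card (insert i ?s)" using fin by (intro psubset_card_mono) auto
    then have "card (insert i ?s \<inter> t) \<le> card ?s" using fin i by simp
    then have "(\<Sum>k\<in>insert i ?s \<inter> t. 1 :: real) \<le> card ?s" by simp
    then have "norm (v i) \<le> 0" using t(2) sum by linarith
    then show ?thesis by simp
  qed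
  show "v j = 0 j" using on off by (cases "j \<in> ?s") auto
qed

text \<open>
  If \<open>n\<close> belongs to all sets of \<open>H\<close>, the coordinate \<open>n\<close> contributes to every sum on the right-hand
  side, so any coefficient of modulus at most \<open>1\<close> is allowed there, whatever the other coefficients are.
\<close>
lemma dominated_fun_upd:
  assumes "dominated H a" "\<And>s. s \<in> H \<Longrightarrow> n \<in> s" "norm c \<le> 1"
  shows "dominated H (a(n := c))"
  unfolding dominated_def
proof (intro allI impI)
  fix A :: "nat set" and x :: "nat \<Rightarrow> real" assume A: "finite A" and x: "\<forall>i. 0 \<le> x i"
  obtain s where s: "s \<in> H" "(\<Sum>i\<in>A - {n}. norm (a i) * x i) \<le> (\<Sum>i\<in>(A - {n}) \<inter> s. x i)"
    using dominatedD[OF assms(1), of "A - {n}" x] A x by auto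
  have eq: "(\<Sum>i\<in>A - {n}. norm ((a(n := c)) i) * x i) = (\<Sum>i\<in>A - {n}. norm (a i) * x i)"
    by (intro sum.cong) auto
  have "(\<Sum>i\<in>A. norm ((a(n := c)) i) * x i) \<le> (\<Sum>i\<in>A \<inter> s. x i)"
  proof (cases "n \<in> A")
    case True
    have "(\<Sum>i\<in>A. norm ((a(n := c)) i) * x i) = norm c * x n + (\<Sum>i\<in>A - {n}. norm (a i) * x i)"
      using sum.remove[OF A True, of "\<lambda>i. norm ((a(n := c)) i) * x i"] eq by simp
    also have "\<dots> \<le> x n + (\<Sum>i\<in>(A - {n}) \<inter> s. x i)"
      using s(2) assms(3) x by (intro add_mono) (auto intro: mult_left_le_one_le)
    also have "\<dots> = (\<Sum>i\<in>A \<inter> s. x i)"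
      using sum.remove[of "A \<inter> s" n x] A True assms(2)[OF s(1)] by (simp add: Int_Diff Diff_Int_distrib2)
    finally show ?thesis .
  next
    case False
    then show ?thesis using s(2) eq by simp
  qed
  then show "\<exists>s\<in>H. (\<Sum>i\<in>A. norm ((a(n := c)) i) * x i) \<le> (\<Sum>i\<in>A \<inter> s. x i)" using s(1) by blast
qed

text \<open>
  By \<open>dominated_fun_upd\<close> a coefficient of modulus below \<open>1\<close> could be perturbed in both directions.
\<close>
lemma dominated_extreme_common_point:
  fixes a :: "nat \<Rightarrow> real"
  assumes ext: "dominated_extreme H a" and H: "dominated H' a" "H' \<subseteq> H" "\<And>s. s \<in> H' \<Longrightarrow> n \<in> s"
  shows "\<bar>a n\<bar> = 1"
proof (rule ccontr)
  assume "\<bar>a n\<bar> \<noteq> 1"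
  then have lt: "\<bar>a n\<bar> < 1" using dominated_coord_le[OF H(1), of n] by simp
  define v where "v = (\<lambda>i. if i = n then 1 - \<bar>a n\<bar> else 0)"
  have "a + v = a(n := a n + (1 - \<bar>a n\<bar>))" "a - v = a(n := a n - (1 - \<bar>a n\<bar>))"
    by (auto simp: v_def)
  moreover have "dominated H' (a(n := a n + (1 - \<bar>a n\<bar>)))" "dominated H' (a(n := a n - (1 - \<bar>a n\<bar>)))"
    using H lt by (auto intro!: dominated_fun_upd)
  ultimately have "dominated H (a + v)" "dominated H (a - v)"
    using dominated_mono H(2) by metis+
  then have "v = 0" using ext by (simp add: dominated_extreme_def)
  then show False using lt by (auto simp: v_def dest: fun_cong[of _ _ n])
qed

text \<open>
  Compactness is used through pointwise limits of sequences of sets.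
\<close>
lemma compact_family_limit:
  assumes "compact_family F" "\<And>n. t n \<in> F" "\<And>i. \<forall>\<^sub>F n in sequentially. (i \<in> t n) = (i \<in> s)"
  shows "s \<in> F"
proof -
  have "(\<lambda>n i. i \<in> t n) \<longlonglongrightarrow> (\<lambda>i. i \<in> s)"
    unfolding limitin_canonical_iff[symmetric] euclidean_product_topology[symmetric] limitin_componentwise
    using assms(3) by (auto intro: tendsto_eventually)
  then have "(\<lambda>i. i \<in> s) \<in> (\<lambda>s i. i \<in> s) ` F"
    using assms(1,2) unfolding compact_family_def
    by (elim closed_sequentially) auto
  then obtain u where u: "u \<in> F" "(\<lambda>i. i \<in> s) = (\<lambda>i. i \<in> u)" by blast
  then have "s = u" by (metis Collect_mem_eq)
  with u show ?thesis by simp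
qed

text \<open>
  The subfamily of those \<open>s \<in> F\<close> that agree with the support of \<open>a\<close> below \<open>n\<close> still dominates \<open>a\<close>, by
  induction on \<open>n\<close>: it splits into the sets with and without \<open>n\<close>, and one of the two parts
  suffices. In the first case \<open>a n = 1\<close>, in the second \<open>a n = 0\<close>. A dominating family is
  nonempty, so all initial segments of the support belong to \<open>F\<close>.
\<close>
lemma real_extreme_is_indicator:
  fixes a :: "nat \<Rightarrow> real"
  assumes F: "compact_family F" "hereditary F" and ext: "dominated_extreme F a" and nonneg: "\<And>i. 0 \<le> a i"
  shows "a i \<in> {0, 1}" "supp a \<in> F"
proof -
  define H where "H = (\<lambda>n. {s \<in> F. s \<inter> {..<n} = supp a \<inter> {..<n}})"
  have dom: "dominated F a" using ext by (simp add: dominated_extreme_def)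
  have key: "dominated (H n) a \<and> (\<forall>i<n. a i \<in> {0, 1})" for n
  proof (induction n)
    case 0
    then show ?case using dom by (simp add: H_def)
  next
    case (Suc n)
    have "dominated_extreme (H n) a"
      using ext Suc dominated_mono[of "H n" _ F] unfolding dominated_extreme_def by (auto simp: H_def)
    moreover have "H n = {s \<in> H n. n \<in> s} \<union> {s \<in> H n. n \<notin> s}" by auto
    ultimately consider "dominated {s \<in> H n. n \<in> s} a" | "dominated {s \<in> H n. n \<notin> s} a"
      using dominated_extreme_split by metis
    then show ?case
    proof cases
      case 1
      have "\<bar>a n\<bar> = 1"
        by (rule dominated_extreme_common_point[OF ext 1]) (auto simp: H_def)
      then have "a n = 1" using nonneg[of n] by simp
      moreover from this have "{s \<in> H n. n \<in> s} \<subseteq> H (Suc n)"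
        by (auto simp: H_def lessThan_Suc)
      ultimately show ?thesis using dominated_mono[OF 1] Suc by (auto simp: less_Suc_eq)
    next
      case 2
      have "a n = 0" using dominated_coord_zero[OF 2, of n] by blast
      moreover from this have "{s \<in> H n. n \<notin> s} \<subseteq> H (Suc n)"
        by (auto simp: H_def lessThan_Suc)
      ultimately show ?thesis using dominated_mono[OF 2] Suc by (auto simp: less_Suc_eq)
    qed
  qed
  then show "a i \<in> {0, 1}" by blast
  have "supp a \<inter> {..<n} \<in> F" for n
  proof -
    obtain s where "s \<in> F" "s \<inter> {..<n} = supp a \<inter> {..<n}"
      using key dominated_nonempty[of "H n" a] by (auto simp: H_def)
    then show ?thesis using F(2) unfolding hereditary_def by (metis inf_le1)
  qed
  then show "supp a \<in> F"
  proof (rule compact_family_limit[OF F(1)])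
    fix i
    show "\<forall>\<^sub>F n in sequentially. (i \<in> supp a \<inter> {..<n}) = (i \<in> supp a)"
      using eventually_gt_at_top[of i] by eventually_elim auto
  qed
qed

text \<open>
  A perturbation of the moduli, multiplied by the phases of \<open>a\<close>, is a perturbation of \<open>a\<close>. At the
  zeros of \<open>a\<close> the phase is chosen to be \<open>1\<close>.
\<close>
lemma dominated_extreme_norm:
  fixes a :: "nat \<Rightarrow> 'k::real_or_complex"
  assumes ext: "dominated_extreme F a"
  shows "dominated_extreme F (\<lambda>i. norm (a i))"
  unfolding dominated_extreme_def
proof (intro conjI allI impI)
  show "dominated F (\<lambda>i. norm (a i))"
    using ext dominated_norm_cong[of "\<lambda>i. norm (a i)" a] by (simp add: dominated_extreme_def)
  fix v assume v: "dominated F ((\<lambda>i. norm (a i)) + v)" "dominated F ((\<lambda>i. norm (a i)) - v)"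
  define \<theta> where "\<theta> = (\<lambda>i. if a i = 0 then 1 else sgn (a i))"
  have \<theta>: "norm (\<theta> i) = 1" "a i = norm (a i) *\<^sub>R \<theta> i" for i
    by (auto simp: \<theta>_def norm_sgn sgn_div_norm)
  define w where "w = (\<lambda>i. v i *\<^sub>R \<theta> i)"
  have "(a + w) i = (norm (a i) + v i) *\<^sub>R \<theta> i" "(a - w) i = (norm (a i) - v i) *\<^sub>R \<theta> i" for i
    using \<theta>(2)[of i] by (simp_all add: w_def scaleR_add_left scaleR_diff_left)
  then have "norm ((a + w) i) = norm (((\<lambda>i. norm (a i)) + v) i)"
    "norm ((a - w) i) = norm (((\<lambda>i. norm (a i)) - v) i)" for i
    using \<theta>(1) by simp_all
  then have "dominated F (a + w)" "dominated F (a - w)"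
    using v dominated_norm_cong by metis+
  then have "w = 0" using ext by (simp add: dominated_extreme_def)
  then have "v i *\<^sub>R \<theta> i = 0" for i by (simp add: w_def fun_eq_iff)
  moreover have "\<theta> i \<noteq> 0" for i using \<theta>(1)[of i] by auto
  ultimately show "v = 0" by (simp add: fun_eq_iff)
qed

text \<open>
  If a point \<open>j\<close> could be added to the support within \<open>F\<close>, adding and subtracting the \<open>j\<close>-th unit vector
  would be a symmetric perturbation.
\<close>
lemma extreme_is_maximal_signed_indicator:
  fixes a :: "nat \<Rightarrow> 'k::real_or_complex"
  assumes F: "compact_family F" "hereditary F" and ext: "dominated_extreme F a"
  shows "a \<in> signed_indicators F" "maximal_in F (supp a)"
proof -
  have sup: "norm (a i) \<in> {0, 1}" "supp a \<in> F" for i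
    using real_extreme_is_indicator[OF F dominated_extreme_norm[OF ext]] by auto
  then show "a \<in> signed_indicators F" by (simp add: signed_indicators_def)
  show "maximal_in F (supp a)" unfolding maximal_in_def
  proof (intro conjI ballI impI sup, rule ccontr)
    fix t assume t: "t \<in> F" "supp a \<subseteq> t" "t \<noteq> supp a"
    then obtain j where j: "j \<in> t" "a j = 0" by blast
    define v :: "nat \<Rightarrow> 'k" where "v = (\<lambda>i. if i = j then 1 else 0)"
    have "supp (a + v) = insert j (supp a)" "supp (a - v) = insert j (supp a)"
      using j by (auto simp: v_def)
    moreover have "insert j (supp a) \<in> F"
      using F(2) t j unfolding hereditary_def by (metis insert_subset)
    moreover have "norm ((a + v) i) \<in> {0, 1}" "norm ((a - v) i) \<in> {0, 1}" for i
      using sup(1)[of i] j by (auto simp: v_def)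
    ultimately have "dominated F (a + v)" "dominated F (a - v)"
      by (auto intro!: signed_indicator_dominated simp: signed_indicators_def)
    then have "v = 0" using ext by (simp add: dominated_extreme_def)
    then show False by (auto simp: v_def dest: fun_cong[of _ _ j])
  qed
qed

text \<open>
  The union of a strictly increasing sequence in a compact family is a member, hence finite, which is
  absurd.
\<close>
lemma wf_family:
  assumes F: "is_family F" "compact_family F"
  shows "wf {(t, s). s \<in> F \<and> t \<in> F \<and> s \<subset> t}"
  unfolding wf_iff_no_infinite_down_chain
proof
  assume "\<exists>f. \<forall>i. (f (Suc i), f i) \<in> {(t, s). s \<in> F \<and> t \<in> F \<and> s \<subset> t}"
  then obtain f where f: "\<And>i. f i \<in> F" "\<And>i. f i \<subset> f (Suc i)"
    unfolding mem_Collect_eq case_prod_conv by metis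
  have mono: "f m \<subseteq> f n" if "m \<le> n" for m n
    by (rule lift_Suc_mono_le[OF _ that]) (use f(2) in blast)
  have "(\<Union>n. f n) \<in> F"
  proof (rule compact_family_limit[OF F(2) f(1)])
    fix i
    show "\<forall>\<^sub>F n in sequentially. (i \<in> f n) = (i \<in> (\<Union>n. f n))"
    proof (cases "i \<in> (\<Union>n. f n)")
      case True
      then obtain m where "i \<in> f m" by blast
      then show ?thesis
        unfolding eventually_sequentially using mono by (intro exI[of _ m]) blast
    qed simp
  qed
  then have fin: "finite (\<Union>n. f n)" using F(1) by (auto simp: is_family_def)
  have "n \<le> card (f n)" for n
  proof (induction n)
    case (Suc n)
    have "card (f n) < card (f (Suc n))"
      using f(2) fin by (intro psubset_card_mono) (auto intro: finite_subset[OF _ fin])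
    then show ?case using Suc by simp
  qed simp
  moreover have "card (f n) \<le> card (\<Union>n. f n)" for n using fin by (intro card_mono) auto
  ultimately show False by (metis le_trans not_less_eq_eq)
qed

section \<open>Isometries between spaces of coefficients\<close>

lemma spread_of_far_set:
  assumes "finite s" "finite t" "card s = card t" "\<And>i j. i \<in> s \<Longrightarrow> j \<in> t \<Longrightarrow> i \<le> j"
  shows "is_spread_of t s"
proof -
  obtain \<sigma> where "bij_betw \<sigma> s t" using finite_same_card_bij assms by blast
  then show ?thesis
    unfolding is_spread_of_def using assms(4) by (intro exI[of _ \<sigma>]) (auto simp: bij_betw_def)
qed

text \<open>
  Any set that lies beyond \<open>s\<close> and is not larger than \<open>s\<close> is a spread of a subset of \<open>s\<close>.
\<close>
lemma far_sets_in_spreading_family: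
  assumes F: "is_family F" "spreading F" "hereditary F" and s: "s \<in> F"
  obtains M where "\<And>t. finite t \<Longrightarrow> card t \<le> card s \<Longrightarrow> t \<subseteq> {M..} \<Longrightarrow> t \<in> F"
proof
  fix t assume t: "finite t" "card t \<le> card s" "t \<subseteq> {Max s..}"
  have fin: "finite s" using F(1) s by (auto simp: is_family_def)
  then obtain u where u: "u \<subseteq> s" "card u = card t" using t(2) by (meson obtain_subset_with_card_n)
  have "i \<le> j" if "i \<in> u" "j \<in> t" for i j
    using that t(3) u(1) fin by (meson Max_ge atLeast_iff order_trans subsetD)
  then have "is_spread_of t u"
    using u fin t(1) by (intro spread_of_far_set) (auto intro: finite_subset)
  moreover have "u \<in> F" using F(3) s u(1) by (auto simp: hereditary_def)
  ultimately show "t \<in> F" using F(2) by (auto simp: spreading_def)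
qed

text \<open>
  A point that extends \<open>s\<close> may be moved upwards beyond \<open>s\<close>.
\<close>
lemma nonmaximal_extends_far:
  assumes F: "is_family F" "spreading F" "hereditary F" and s: "s \<in> F" "\<not> maximal_in F s"
  obtains N where "\<And>k. N \<le> k \<Longrightarrow> k \<notin> s \<and> insert k s \<in> F"
proof -
  obtain t where t: "t \<in> F" "s \<subseteq> t" "t \<noteq> s" using s by (auto simp: maximal_in_def)
  then obtain j where j: "j \<in> t" "j \<notin> s" by blast
  have ins: "insert j s \<in> F" using F(3) t j by (auto simp: hereditary_def)
  have fin: "finite s" using F(1) s by (auto simp: is_family_def)
  show thesis
  proof
    fix k assume k: "Suc (Max (insert j s)) \<le> k"
    then have big: "i < k" if "i \<in> insert j s" for i
      using fin that by (meson Max_ge Suc_le_lessD finite.insertI order_le_less_trans)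
    have "is_spread_of (insert k s) (insert j s)"
      unfolding is_spread_of_def using j big
      by (intro exI[of _ "(\<lambda>i. i)(j := k)"]) (auto simp: inj_on_def less_imp_le)
    then show "k \<notin> s \<and> insert k s \<in> F"
      using F(2) ins big by (auto simp: spreading_def)
  qed
qed

definition unit_seq :: "nat \<Rightarrow> nat \<Rightarrow> 'k::real_or_complex" where
  "unit_seq k = (\<lambda>i. if i = k then 1 else 0)"

definition signed_on :: "nat set \<Rightarrow> (nat \<Rightarrow> 'k) \<Rightarrow> nat \<Rightarrow> 'k::real_or_complex" where
  "signed_on s \<theta> = (\<lambda>i. if i \<in> s then \<theta> i else 0)"

lemma signed_on_empty: "signed_on {} \<theta> = 0"
  by (simp add: signed_on_def fun_eq_iff)

lemma signed_on_insert:
  "k \<notin> s \<Longrightarrow> signed_on (insert k s) \<theta> = signed_on s \<theta> + (\<lambda>i. \<theta> k * unit_seq k i)"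
  by (auto simp: signed_on_def unit_seq_def fun_eq_iff)

lemma signed_on_signed_indicator:
  "s \<in> F \<Longrightarrow> (\<And>i. i \<in> s \<Longrightarrow> norm (\<theta> i) = 1) \<Longrightarrow> signed_on s \<theta> \<in> signed_indicators F"
proof -
  assume s: "s \<in> F" and \<theta>: "\<And>i. i \<in> s \<Longrightarrow> norm (\<theta> i) = 1"
  then have "\<theta> i \<noteq> 0" if "i \<in> s" for i using that by (metis norm_zero zero_neq_one)
  then have "supp (signed_on s \<theta>) = s" by (auto simp: signed_on_def)
  then show ?thesis using s \<theta> by (simp add: signed_indicators_def signed_on_def)
qed

lemma unit_seq_signed_indicator: "is_family F \<Longrightarrow> unit_seq k \<in> signed_indicators F"
  by (simp add: signed_indicators_def unit_seq_def is_family_def)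

text \<open>
  An isometry between two dual spaces, expressed in coefficients. The sets \<open>V\<close> and \<open>W\<close> stand for the
  coefficient sequences of all bounded functionals; only their linear structure and the two
  unit balls matter. The inverse \<open>T'\<close> is a parameter in order that the situation be symmetric.
\<close>
locale dual_isometry =
  fixes F G :: "nat set set" and V W :: "(nat \<Rightarrow> 'k::real_or_complex) set"
    and T T' :: "(nat \<Rightarrow> 'k) \<Rightarrow> nat \<Rightarrow> 'k"
  assumes F: "regular_family F" and G: "regular_family G"
    and V_add: "a \<in> V \<Longrightarrow> b \<in> V \<Longrightarrow> a + b \<in> V" and V_scale: "a \<in> V \<Longrightarrow> (\<lambda>i. c * a i) \<in> V"
    and W_add: "a \<in> W \<Longrightarrow> b \<in> W \<Longrightarrow> a + b \<in> W" and W_scale: "a \<in> W \<Longrightarrow> (\<lambda>i. c * a i) \<in> W"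
    and V_dom: "dominated F a \<Longrightarrow> a \<in> V" and W_dom: "dominated G a \<Longrightarrow> a \<in> W"
    and T_in: "a \<in> V \<Longrightarrow> T a \<in> W" and T'_in: "a \<in> W \<Longrightarrow> T' a \<in> V"
    and T'T: "a \<in> V \<Longrightarrow> T' (T a) = a" and TT': "a \<in> W \<Longrightarrow> T (T' a) = a"
    and T_add: "a \<in> V \<Longrightarrow> b \<in> V \<Longrightarrow> T (a + b) = T a + T b"
    and T_scale: "a \<in> V \<Longrightarrow> T (\<lambda>i. c * a i) = (\<lambda>i. c * T a i)"
    and T_dom: "a \<in> V \<Longrightarrow> dominated G (T a) \<longleftrightarrow> dominated F a"
begin

lemma inverse: "dual_isometry G F W V T' T"
proof
  fix a b assume "a \<in> W" "b \<in> W"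
  then show "T' (a + b) = T' a + T' b"
    by (metis T'T T'_in TT' T_add V_add)
next
  fix a c assume a: "a \<in> W"
  have "T (\<lambda>i. c * T' a i) = (\<lambda>i. c * a i)" using T_scale[OF T'_in[OF a]] TT'[OF a] by simp
  then show "T' (\<lambda>i. c * a i) = (\<lambda>i. c * T' a i)"
    using T'T[OF V_scale[OF T'_in[OF a]]] by metis
next
  fix a assume "a \<in> W"
  then show "dominated F (T' a) = dominated G a" using T_dom T'_in TT' by metis
qed (use F G V_add V_scale W_add W_scale V_dom W_dom T_in T'_in T'T TT' in auto)

lemma regularF: "is_family F" "compact_family F" "hereditary F" "spreading F"
  and regularG: "is_family G" "compact_family G" "hereditary G" "spreading G"
  using F G by (auto simp: regular_family_def)

lemma V_diff: "a \<in> V \<Longrightarrow> b \<in> V \<Longrightarrow> a - b \<in> V"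
  and T_diff: "a \<in> V \<Longrightarrow> b \<in> V \<Longrightarrow> T (a - b) = T a - T b"
proof -
  assume ab: "a \<in> V" "b \<in> V"
  have neg: "a - b = a + (\<lambda>i. (- 1) * b i)" by (simp add: fun_eq_iff)
  show "a - b \<in> V" unfolding neg by (intro V_add V_scale ab)
  show "T (a - b) = T a - T b"
    unfolding neg T_add[OF ab(1) V_scale[OF ab(2)]] T_scale[OF ab(2)] by (simp add: fun_eq_iff)
qed

lemma T_zero: "0 \<in> V" "T 0 = 0"
proof -
  have "(0 :: nat \<Rightarrow> 'k) = signed_on {} (\<lambda>_. 1)" by (simp add: signed_on_empty)
  then have "(0 :: nat \<Rightarrow> 'k) \<in> signed_indicators F"
    using signed_on_signed_indicator[of "{}" F "\<lambda>_. 1 :: 'k"] regularF by (simp add: is_family_def)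
  then show 0: "0 \<in> V" using V_dom signed_indicator_dominated by blast
  show "T 0 = 0" using T_diff[OF 0 0] by simp
qed

lemma T_extreme:
  assumes ext: "dominated_extreme F a"
  shows "dominated_extreme G (T a)"
  unfolding dominated_extreme_def
proof (intro conjI allI impI)
  have dom: "dominated F a" using ext by (simp add: dominated_extreme_def)
  then show "dominated G (T a)" using T_dom V_dom by blast
  fix v assume v: "dominated G (T a + v)" "dominated G (T a - v)"
  interpret inv: dual_isometry G F W V T' T by (rule inverse)
  have a: "a \<in> V" using dom V_dom by blast
  have "(T a + v) - T a \<in> W" by (intro inv.V_diff W_dom v T_in a)
  then have vW: "v \<in> W" by simp
  define w where "w = T' v"
  have w: "w \<in> V" "T w = v" using vW T'_in TT' by (auto simp: w_def)
  have "dominated F (a + w)" "dominated F (a - w)"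
    using v T_dom[OF V_add[OF a w(1)]] T_dom[OF V_diff[OF a w(1)]] T_add[OF a w(1)] T_diff[OF a w(1)] w(2)
    by simp_all
  then have "w = 0" using ext by (simp add: dominated_extreme_def)
  then show "v = 0" using w T_zero by simp
qed

lemma T_maximal:
  assumes "a \<in> signed_indicators F" "maximal_in F (supp a)"
  shows "T a \<in> signed_indicators G" "maximal_in G (supp (T a))"
  using extreme_is_maximal_signed_indicator[OF regularG(2,3) T_extreme]
    maximal_signed_indicator_extreme[OF regularF(1) assms] by blast+

lemma signed_indicator_in_V: "a \<in> signed_indicators F \<Longrightarrow> a \<in> V"
  using V_dom signed_indicator_dominated by blast

lemma unit_seq_in_V: "unit_seq k \<in> V"
  using signed_indicator_in_V unit_seq_signed_indicator regularF by blast

lemma T_signed_on: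
  assumes "finite s"
  shows "signed_on s \<theta> \<in> V \<and> T (signed_on s \<theta>) j = (\<Sum>i\<in>s. \<theta> i * T (unit_seq i) j)"
  using assms
proof (induction s)
  case empty
  show ?case by (metis signed_on_empty T_zero sum.empty zero_fun_apply)
next
  case (insert k s)
  have eq: "signed_on (insert k s) \<theta> = signed_on s \<theta> + (\<lambda>i. \<theta> k * unit_seq k i)"
    by (rule signed_on_insert) (rule insert.hyps)
  have V: "signed_on s \<theta> \<in> V" "(\<lambda>i. \<theta> k * unit_seq k i) \<in> V"
    using insert.IH V_scale[OF unit_seq_in_V] by auto
  show ?case
    unfolding eq
  proof
    show "signed_on s \<theta> + (\<lambda>i. \<theta> k * unit_seq k i) \<in> V" by (rule V_add[OF V])
    show "T (signed_on s \<theta> + (\<lambda>i. \<theta> k * unit_seq k i)) j = (\<Sum>i\<in>insert k s. \<theta> i * T (unit_seq i) j)"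
      unfolding T_add[OF V] T_scale[OF unit_seq_in_V] using insert by (simp add: add.commute)
  qed
qed

lemma T_pair:
  assumes "k \<noteq> l"
  shows "T (signed_on {k, l} (\<lambda>i. if i = l then \<theta> else 1)) = (\<lambda>j. T (unit_seq k) j + \<theta> * T (unit_seq l) j)"
  using T_signed_on[of "{k, l}" "\<lambda>i. if i = l then \<theta> else 1"] assms by (simp add: fun_eq_iff)

text \<open>
  The hypothesis is tested on members of \<open>F\<close> far out, whose shape depends only on their size. If \<open>F\<close> has a
  set with three elements, three halves with aligned phases add up to \<open>3/2\<close>, but coordinates in
  the unit ball have modulus at most \<open>1\<close>. If all members of \<open>F\<close> have at most one element, unit vectors
  are extreme, hence their images have no halves. There remain families of singletons and pairs,
  where far pairs are maximal. There the images \<open>y k\<close> all have their halves at the same finite set \<open>B\<close> of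
  places, so two of them, \<open>y l\<close> and \<open>y m\<close>, agree on \<open>B\<close>. Off \<open>B\<close> they have disjoint supports,
  so that \<open>y l + y m\<close> has strictly larger support than \<open>y l - y m\<close>. But both are images of
  extreme points, and supports of extreme points are maximal.
\<close>
lemma no_half_coordinates:
  assumes real: "\<forall>x :: 'k. \<exists>r. x = of_real r"
    and half: "\<And>k. N \<le> k \<Longrightarrow> norm (T (unit_seq k) b) = 1/2"
  shows False
proof -
  let ?y = "\<lambda>k. T (unit_seq k)"
  note far = far_sets_in_spreading_family[OF regularF(1,4,3)]
  have fin: "finite t" if "t \<in> F" for t using regularF(1) that by (auto simp: is_family_def)
  consider (three) t where "t \<in> F" "3 \<le> card t"
    | (two) t where "t \<in> F" "card t = 2" "\<And>u. u \<in> F \<Longrightarrow> card u \<le> 2"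
    | (one) "\<And>u. u \<in> F \<Longrightarrow> card u \<le> 1"
  proof -
    have "(\<exists>t\<in>F. 3 \<le> card t) \<or> (\<exists>t\<in>F. card t = 2) \<and> (\<forall>u\<in>F. card u \<le> 2) \<or> (\<forall>u\<in>F. card u \<le> 1)"
      by (metis One_nat_def Suc_1 le_SucE not_less_eq_eq numeral_3_eq_3)
    then show thesis using that by blast
  qed
  then show False
  proof cases
    case three
    obtain M where M: "\<And>u. finite u \<Longrightarrow> card u \<le> card t \<Longrightarrow> u \<subseteq> {M..} \<Longrightarrow> u \<in> F"
      using far[OF three(1)] by blast
    define P where "P = max M N"
    \<comment> \<open>The phases align the coordinates at \<open>b\<close>.\<close>
    define \<theta> where "\<theta> = (\<lambda>i. inverse (sgn (?y i b)))"
    have nz: "?y i b \<noteq> 0" if "N \<le> i" for i using half[OF that] by auto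
    have \<theta>: "norm (\<theta> i) = 1" "\<theta> i * ?y i b = of_real (1/2)" if "N \<le> i" for i
    proof -
      show "norm (\<theta> i) = 1" using nz[OF that] by (simp add: \<theta>_def norm_inverse norm_sgn)
      have "?y i b = of_real (norm (?y i b)) * sgn (?y i b)"
        using nz[OF that] by (simp add: sgn_div_norm scaleR_conv_of_real)
      then have eq: "?y i b = of_real (1/2) * sgn (?y i b)" unfolding half[OF that] .
      show "\<theta> i * ?y i b = of_real (1/2)"
        using nz[OF that] by (subst eq) (simp add: \<theta>_def sgn_zero_iff)
    qed
    let ?K = "{P, P + 1, P + 2}"
    have "?K \<in> F" by (rule M) (use three(2) in \<open>auto simp: P_def\<close>)
    then have "signed_on ?K \<theta> \<in> signed_indicators F"
      by (rule signed_on_signed_indicator) (auto intro!: \<theta> simp: P_def)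
    then have "dominated G (T (signed_on ?K \<theta>))"
      using T_dom signed_indicator_in_V signed_indicator_dominated by blast
    then have "norm (T (signed_on ?K \<theta>) b) \<le> 1" by (rule dominated_coord_le)
    moreover have "T (signed_on ?K \<theta>) b = (\<Sum>i\<in>?K. \<theta> i * ?y i b)"
      using T_signed_on[of ?K \<theta> b] by blast
    moreover have "\<dots> = (\<Sum>i\<in>?K. of_real (1/2))"
      by (intro sum.cong refl \<theta>) (auto simp: P_def)
    moreover have "\<dots> = of_real (3/2)" by simp
    ultimately have "norm (of_real (3/2) :: 'k) \<le> 1" by metis
    then show False unfolding norm_of_real by simp
  next
    case two
    obtain M where M: "\<And>u. finite u \<Longrightarrow> card u \<le> card t \<Longrightarrow> u \<subseteq> {M..} \<Longrightarrow> u \<in> F"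
      using far[OF two(1)] by blast
    define P where "P = max M N"
    have pair: "(\<lambda>j. ?y k j + \<theta> * ?y l j) \<in> signed_indicators G"
      "maximal_in G (supp (\<lambda>j. ?y k j + \<theta> * ?y l j))"
      if kl: "P \<le> k" "P \<le> l" "k \<noteq> l" and \<theta>: "norm \<theta> = 1" for k l \<theta>
    proof -
      have inF: "{k, l} \<in> F" by (rule M) (use kl two(2) in \<open>auto simp: P_def\<close>)
      have "maximal_in F {k, l}" unfolding maximal_in_def
      proof (intro conjI inF ballI impI)
        fix u assume "u \<in> F" "{k, l} \<subseteq> u"
        then show "u = {k, l}"
          using card_seteq[of u "{k, l}"] fin two(3)[of u] kl(3) by simp
      qed
      moreover have "supp (signed_on {k, l} (\<lambda>i. if i = l then \<theta> else 1)) = {k, l}"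
        using \<theta> by (auto simp: signed_on_def)
      moreover have "signed_on {k, l} (\<lambda>i. if i = l then \<theta> else 1) \<in> signed_indicators F"
        by (rule signed_on_signed_indicator[OF inF]) (use \<theta> in auto)
      ultimately show "(\<lambda>j. ?y k j + \<theta> * ?y l j) \<in> signed_indicators G"
        "maximal_in G (supp (\<lambda>j. ?y k j + \<theta> * ?y l j))"
        using T_maximal[of "signed_on {k, l} (\<lambda>i. if i = l then \<theta> else 1)"] T_pair[OF kl(3), of \<theta>]
        by simp_all
    qed
    have alt: "?y k j = 0 \<or> ?y l j = 0 \<or> (norm (?y k j) = 1/2 \<and> norm (?y l j) = 1/2)"
      if "P \<le> k" "P \<le> l" "k \<noteq> l" for k l j
    proof -
      have "norm (?y k j + \<theta> * ?y l j) \<in> {0, 1}" if "norm \<theta> = 1" for \<theta>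
        using pair(1)[OF \<open>P \<le> k\<close> \<open>P \<le> l\<close> \<open>k \<noteq> l\<close> that] by (simp add: signed_indicators_def)
      from zero_one_norm_all_phases[OF this] show ?thesis by blast
    qed
    have alt2: "norm (?y l j) = 1/2" if "norm (?y k j) = 1/2" "P \<le> k" "P \<le> l" for k l j
    proof (cases "k = l")
      case False
      have "norm (?y k j + \<theta> * ?y l j) \<in> {0, 1}" if "norm \<theta> = 1" for \<theta>
        using pair(1)[OF \<open>P \<le> k\<close> \<open>P \<le> l\<close> False that] by (simp add: signed_indicators_def)
      from zero_one_norm_all_phases[OF this] that(1) show ?thesis by auto
    qed (use that in simp)
    define B where "B = {j. norm (?y P j) = 1/2}"
    have supfin: "finite (supp (\<lambda>j. ?y P j + \<theta> * ?y (Suc P) j))" if "norm \<theta> = 1" for \<theta>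
      using pair(1)[of P "Suc P" \<theta>] that regularG(1) by (auto simp: signed_indicators_def is_family_def)
    have "B \<subseteq> supp (\<lambda>j. ?y P j + 1 * ?y (Suc P) j) \<union> supp (\<lambda>j. ?y P j + (- 1) * ?y (Suc P) j)"
    proof (rule ccontr)
      assume "\<not> ?thesis"
      then obtain j where j: "j \<in> B" "?y P j + 1 * ?y (Suc P) j = 0" "?y P j + (- 1) * ?y (Suc P) j = 0"
        by blast
      have "2 * ?y P j = ?y P j + ?y P j" by (rule mult_2)
      also have "\<dots> = (?y P j + 1 * ?y (Suc P) j) + (?y P j + (- 1) * ?y (Suc P) j)" by simp
      also have "\<dots> = 0" unfolding j by simp
      finally show False using j(1) by (auto simp: B_def)
    qed
    then have "finite B" using supfin[of 1] supfin[of "- 1"] by (simp add: finite_subset)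
    \<comment> \<open>On \<open>B\<close> the values are \<open>1/2\<close> and \<open>-1/2\<close>, so \<open>f l\<close> records the restriction of \<open>?y l\<close>
      to \<open>B\<close>; the pigeonhole principle yields two equal restrictions.\<close>
    define f where "f = (\<lambda>l. {j \<in> B. ?y l j = 1/2})"
    have "f ` {P..} \<subseteq> Pow B" by (auto simp: f_def)
    then have "finite (f ` {P..})" using \<open>finite B\<close> by (simp add: finite_subset)
    then have "\<not> inj_on f {P..}" using finite_imageD infinite_Ici by blast
    then obtain l m where lm: "P \<le> l" "P \<le> m" "l \<noteq> m" "f l = f m" by (auto simp: inj_on_def)
    have same: "?y l j = ?y m j" if "j \<in> B" for j
    proof -
      have n: "norm (?y l j) = 1/2" "norm (?y m j) = 1/2"
        using that alt2[where k = P and l = l and j = j] alt2[where k = P and l = m and j = j] lm(1,2)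
        by (auto simp: B_def)
      have pm: "x = 1/2 \<or> x = - (1/2)" if "norm x = 1/2" for x :: 'k
      proof -
        obtain r where r: "x = of_real r" using real by blast
        then have "r = 1/2 \<or> r = - (1/2)" using that by auto
        then show ?thesis unfolding r by (elim disjE; hypsubst; simp)
      qed
      have "?y l j = 1/2 \<longleftrightarrow> ?y m j = 1/2" using lm(4) that by (auto simp: f_def)
      then show ?thesis using pm[OF n(1)] pm[OF n(2)] by metis
    qed
    have b: "b \<in> B" using half[of P] by (simp add: B_def P_def)
    let ?p = "\<lambda>j. ?y l j + 1 * ?y m j" and ?q = "\<lambda>j. ?y l j + (- 1) * ?y m j"
    have "supp ?q \<subseteq> supp ?p"
    proof
      fix j assume "j \<in> supp ?q"
      then have ne: "?y l j \<noteq> ?y m j" by simp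
      then have "j \<notin> B" using same by blast
      then have "norm (?y l j) \<noteq> 1/2" using alt2[where k = l and l = P and j = j] lm(1) by (auto simp: B_def)
      then have "?y l j = 0 \<or> ?y m j = 0" using alt[OF lm(1,2,3), where j = j] by blast
      then show "j \<in> supp ?p" using ne by auto
    qed
    moreover have "supp ?p \<in> G" using pair(1)[OF lm(1,2,3), of 1] by (simp add: signed_indicators_def)
    ultimately have "supp ?p = supp ?q"
      using pair(2)[OF lm(1,2,3), of "- 1"] unfolding maximal_in_def by simp
    moreover have "b \<notin> supp ?q" using same[OF b] by simp
    moreover have "b \<in> supp ?p"
    proof -
      have "norm (?y l b) = 1/2" using alt2[where k = P and l = l and j = b] b lm(1) by (simp add: B_def)
      then have "2 * ?y l b \<noteq> 0" by auto
      moreover have "?y l b + 1 * ?y m b = 2 * ?y l b"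
        unfolding same[OF b] mult_2 mult_1_left by (rule refl)
      ultimately show ?thesis by (simp only: mem_Collect_eq not_False_eq_True)
    qed
    ultimately show False by blast
  next
    case one
    have N: "{N} \<in> F" using regularF(1) by (simp add: is_family_def)
    have "maximal_in F {N}" unfolding maximal_in_def
    proof (intro conjI N ballI impI)
      fix u assume "u \<in> F" "{N} \<subseteq> u"
      then show "u = {N}" using card_seteq[of u "{N}"] fin one[of u] by simp
    qed
    moreover have "supp (unit_seq N :: nat \<Rightarrow> 'k) = {N}" by (auto simp: unit_seq_def)
    ultimately have "?y N \<in> signed_indicators G"
      using T_maximal(1)[OF unit_seq_signed_indicator[OF regularF(1)], of N] by metis
    then have "norm (?y N b) \<in> {0, 1}" by (simp add: signed_indicators_def)
    then show False using half[of N] by simp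
  qed
qed

text \<open>
  Induction along reverse inclusion of supports. For a nonmaximal support the induction hypothesis
  applies to the far extensions by one point, with an arbitrary phase at that point, and
  \<open>zero_one_norm_all_phases\<close> to each coordinate of their images.
\<close>
lemma T_signed_indicator:
  assumes "a \<in> signed_indicators F"
  shows "T a \<in> signed_indicators G"
proof -
  have "\<forall>a :: nat \<Rightarrow> 'k. a \<in> signed_indicators F \<longrightarrow> supp a = s \<longrightarrow> T a \<in> signed_indicators G" for s
  proof (induction s rule: wf_induct_rule[OF wf_family[OF regularF(1,2)]])
    case (1 s)
    show ?case
    proof (intro allI impI)
      fix a :: "nat \<Rightarrow> 'k" assume a: "a \<in> signed_indicators F" "supp a = s"
      then have sF: "s \<in> F" by (simp add: signed_indicators_def)
      show "T a \<in> signed_indicators G"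
      proof (cases "maximal_in F s")
        case True
        then show ?thesis using T_maximal a by blast
      next
        case False
        obtain N where N: "\<And>k. N \<le> k \<Longrightarrow> k \<notin> s \<and> insert k s \<in> F"
          using nonmaximal_extends_far[OF regularF(1,4,3) sF False] by blast
        have ext: "(\<lambda>j. T a j + \<theta> * T (unit_seq k) j) \<in> signed_indicators G"
          if k: "N \<le> k" and \<theta>: "norm \<theta> = 1" for k \<theta>
        proof -
          let ?w = "a + (\<lambda>i. \<theta> * unit_seq k i)"
          have "supp ?w = insert k s"
            using N[OF k] a(2) \<theta> by (auto simp: unit_seq_def)
          moreover have "norm (?w i) \<in> {0, 1}" for i
            using N[OF k] a \<theta> by (auto simp: unit_seq_def signed_indicators_def)
          ultimately have w: "?w \<in> signed_indicators F" "supp ?w = insert k s"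
            using N[OF k] by (auto simp: signed_indicators_def)
          then have "T ?w \<in> signed_indicators G"
            using 1[of "insert k s"] N[OF k] sF by blast
          moreover have "T ?w = (\<lambda>j. T a j + \<theta> * T (unit_seq k) j)"
            using T_add[OF signed_indicator_in_V[OF a(1)] V_scale[OF unit_seq_in_V]]
              T_scale[OF unit_seq_in_V] by (simp add: fun_eq_iff)
          ultimately show ?thesis by simp
        qed
        have "norm (T a j + \<theta> * T (unit_seq k) j) \<in> {0, 1}" if "N \<le> k" "norm \<theta> = 1" for k \<theta> j
          using ext[OF that] by (simp add: signed_indicators_def)
        then have alt: "(T a j = 0 \<and> norm (T (unit_seq k) j) \<in> {0, 1}) \<or>
            (T (unit_seq k) j = 0 \<and> norm (T a j) \<in> {0, 1}) \<or>
            (norm (T a j) = 1/2 \<and> norm (T (unit_seq k) j) = 1/2 \<and> (\<forall>x :: 'k. \<exists>r. x = of_real r))"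
          if "N \<le> k" for k j
          using zero_one_norm_all_phases that by blast
        have "norm (T a j) \<noteq> 1/2" for j
        proof
          assume "norm (T a j) = 1/2"
          then have "norm (T (unit_seq k) j) = 1/2 \<and> (\<forall>x :: 'k. \<exists>r. x = of_real r)" if "N \<le> k" for k
            using alt[OF that, of j] by auto
          then show False using no_half_coordinates[of N j] by blast
        qed
        then have alt': "T a j = 0 \<or> (T (unit_seq N) j = 0 \<and> norm (T a j) \<in> {0, 1})" for j
          using alt[of N j] by blast
        \<comment> \<open>Where \<open>T a\<close> is nonzero the image of the unit vector vanishes, so nothing cancels.\<close>
        have "supp (T a) \<subseteq> supp (\<lambda>j. T a j + 1 * T (unit_seq N) j)"
          using alt' by fastforce
        moreover have "supp (\<lambda>j. T a j + 1 * T (unit_seq N) j) \<in> G"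
          using ext[of N 1] by (simp add: signed_indicators_def)
        ultimately have "supp (T a) \<in> G"
          using regularG(3) unfolding hereditary_def by blast
        moreover have "norm (T a j) \<in> {0, 1}" for j using alt'[of j] by auto
        ultimately show ?thesis by (simp add: signed_indicators_def)
      qed
    qed
  qed
  then show ?thesis using assms by blast
qed

text \<open>
  If the image \<open>u\<close> of a unit vector had two nonzero coordinates, it would be a sum of two nonzero parts \<open>u1\<close>
  and \<open>u2\<close> with disjoint supports. Their preimages \<open>v1\<close>, \<open>v2\<close> and the difference \<open>v1 - v2\<close> are signed
  indicators, and so is the sum, a unit vector. By the parallelogram law \<open>v1\<close> and \<open>v2\<close> have disjoint supports, so one of
  them is zero.
\<close>
lemma T_unit_seq:
  "\<exists>j \<theta>. norm \<theta> = 1 \<and> T (unit_seq i) = (\<lambda>k. \<theta> * unit_seq j k)"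
proof -
  interpret inv: dual_isometry G F W V T' T by (rule inverse)
  define u where "u = T (unit_seq i)"
  have u: "u \<in> signed_indicators G"
    unfolding u_def by (intro T_signed_indicator unit_seq_signed_indicator regularF)
  have T'u: "T' u = unit_seq i" unfolding u_def by (rule T'T[OF unit_seq_in_V])
  have "u \<noteq> 0"
  proof
    assume "u = 0"
    then have "unit_seq i = (0 :: nat \<Rightarrow> 'k)" using T'u inv.T_zero(2) by simp
    then show False by (auto simp: unit_seq_def dest: fun_cong[of _ _ i])
  qed
  then obtain j where j: "u j \<noteq> 0" by (auto simp: fun_eq_iff)
  have "u k = 0" if "k \<noteq> j" for k
  proof (rule ccontr)
    assume k: "u k \<noteq> 0"
    define u1 where "u1 = (\<lambda>l. if l = j then u l else 0)"
    define u2 where "u2 = (\<lambda>l. if l = j then 0 else u l)"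
    have signed: "w \<in> signed_indicators G" if "\<And>l. norm (w l) = norm (u l) \<or> w l = 0" for w
    proof -
      have "norm (u l) \<in> {0, 1}" for l using u by (simp add: signed_indicators_def)
      then have "norm (w l) \<in> {0, 1}" for l using that[of l] by (metis insertCI norm_zero)
      moreover have "supp w \<subseteq> supp u" using that by (metis (mono_tags, lifting) mem_Collect_eq norm_eq_zero subsetI)
      then have "supp w \<in> G" using u regularG(3) by (auto simp: signed_indicators_def hereditary_def)
      ultimately show ?thesis by (simp add: signed_indicators_def)
    qed
    have u12: "u1 \<in> signed_indicators G" "u2 \<in> signed_indicators G" "u1 - u2 \<in> signed_indicators G"
      by (rule signed; auto simp: u1_def u2_def)+
    define v1 v2 where "v1 = T' u1" and "v2 = T' u2"
    have v: "v1 \<in> signed_indicators F" "v2 \<in> signed_indicators F"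
      unfolding v1_def v2_def by (intro inv.T_signed_indicator u12)+
    have "T' (u1 - u2) = v1 - v2"
      unfolding v1_def v2_def by (rule inv.T_diff[OF u12(1,2)[THEN inv.signed_indicator_in_V]])
    then have vd: "v1 - v2 \<in> signed_indicators F"
      using inv.T_signed_indicator[OF u12(3)] by simp
    have "u1 + u2 = u" by (auto simp: u1_def u2_def)
    then have sum: "v1 + v2 = unit_seq i"
      using inv.T_add[OF u12(1,2)[THEN inv.signed_indicator_in_V]] T'u by (simp add: v1_def v2_def)
    have disj: "v1 l = 0 \<or> v2 l = 0" for l
    proof (rule ccontr)
      assume ne: "\<not> ?thesis"
      have "norm (v1 l + v2 l) \<in> {0, 1}" using fun_cong[OF sum, of l] by (simp add: unit_seq_def)
      moreover have "norm (v1 l - v2 l) \<in> {0, 1}" using vd by (simp add: signed_indicators_def)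
      moreover have "norm (v1 l) = 1" "norm (v2 l) = 1"
        using v(1,2) ne by (auto simp: signed_indicators_def)
      ultimately show False using unimodular_sum_or_diff by blast
    qed
    have off: "v1 l = 0 \<and> v2 l = 0" if "l \<noteq> i" for l
      using fun_cong[OF sum, of l] disj[of l] that by (auto simp: unit_seq_def)
    have "v1 = 0 \<or> v2 = 0"
      using disj[of i] off by (metis ext zero_fun_apply)
    then have "u1 = 0 \<or> u2 = 0"
      using TT' u12(1,2)[THEN inv.signed_indicator_in_V] T_zero(2) unfolding v1_def v2_def by metis
    then show False using j k that by (auto simp: u1_def u2_def dest: fun_cong[of _ _ j] fun_cong[of _ _ k])
  qed
  then have "u = (\<lambda>k. u j * unit_seq j k)" by (auto simp: unit_seq_def)
  moreover have "norm (u j) = 1" using u j by (auto simp: signed_indicators_def)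
  ultimately show ?thesis unfolding u_def by blast
qed

text \<open>
  The image of the indicator of \<open>s\<close> is a signed indicator with support \<open>\<pi>[s]\<close>.
\<close>
lemma image_in_family:
  assumes T: "\<And>i. norm (\<theta> i) = 1" "\<And>i. T (unit_seq i) = (\<lambda>k. \<theta> i * unit_seq (\<pi> i) k)"
    and "inj \<pi>" and s: "s \<in> F"
  shows "\<pi> ` s \<in> G"
proof -
  have fin: "finite s" using s regularF(1) by (auto simp: is_family_def)
  let ?a = "signed_on s (\<lambda>_. 1)"
  have val: "T ?a j = (\<Sum>i\<in>s. if \<pi> i = j then \<theta> i else 0)" for j
    using T_signed_on[OF fin, of "\<lambda>_. 1" j] T(2) by (auto simp: unit_seq_def intro!: sum.cong)
  have on: "T ?a (\<pi> i) = \<theta> i" if "i \<in> s" for i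
    unfolding val using \<open>inj \<pi>\<close> fin that by (simp add: inj_eq sum.delta)
  have off: "T ?a j = 0" if "j \<notin> \<pi> ` s" for j
    unfolding val using that by (intro sum.neutral) auto
  have "\<theta> i \<noteq> 0" for i using T(1)[of i] by auto
  then have "supp (T ?a) = \<pi> ` s" using on off by auto
  moreover have "T ?a \<in> signed_indicators G"
    by (intro T_signed_indicator signed_on_signed_indicator s) simp
  ultimately show ?thesis by (simp add: signed_indicators_def)
qed

lemma index_inverse:
  assumes "\<And>i. T (unit_seq i) = (\<lambda>k. \<theta> i * unit_seq (\<pi> i) k)"
    and "\<And>j. T' (unit_seq j) = (\<lambda>k. \<theta>' j * unit_seq (\<rho> j) k)"
  shows "\<pi> (\<rho> j) = j"
proof (rule ccontr)
  assume "\<pi> (\<rho> j) \<noteq> j"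
  interpret inv: dual_isometry G F W V T' T by (rule inverse)
  have "unit_seq j = T (T' (unit_seq j))" by (rule TT'[OF inv.unit_seq_in_V, symmetric])
  also have "\<dots> = (\<lambda>k. \<theta>' j * (\<theta> (\<rho> j) * unit_seq (\<pi> (\<rho> j)) k))"
    unfolding assms(2) T_scale[OF unit_seq_in_V] assms(1) by simp
  finally have "unit_seq j j = \<theta>' j * (\<theta> (\<rho> j) * unit_seq (\<pi> (\<rho> j)) j)" by (rule fun_cong)
  then show False using \<open>\<pi> (\<rho> j) \<noteq> j\<close> by (simp add: unit_seq_def)
qed

lemma pi_homeomorphic: "pi_homeomorphic F G"
proof -
  interpret inv: dual_isometry G F W V T' T by (rule inverse)
  obtain \<pi> \<theta> where \<pi>: "\<And>i. norm (\<theta> i) = 1" "\<And>i. T (unit_seq i) = (\<lambda>k. \<theta> i * unit_seq (\<pi> i) k)"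
    using T_unit_seq by metis
  obtain \<rho> \<theta>' where \<rho>: "\<And>i. norm (\<theta>' i) = 1" "\<And>i. T' (unit_seq i) = (\<lambda>k. \<theta>' i * unit_seq (\<rho> i) k)"
    using inv.T_unit_seq by metis
  have \<pi>\<rho>: "\<pi> (\<rho> j) = j" and \<rho>\<pi>: "\<rho> (\<pi> j) = j" for j
    using index_inverse[OF \<pi>(2) \<rho>(2)] inv.index_inverse[OF \<rho>(2) \<pi>(2)] by auto
  have "bij \<pi>" by (rule o_bij[of \<rho>]) (auto simp: \<pi>\<rho> \<rho>\<pi>)
  have "inj \<rho>" using \<pi>\<rho> by (metis injI)
  have "G = {\<pi> ` s |s. s \<in> F}"
  proof (intro equalityI subsetI)
    fix t assume "t \<in> G"
    then have "\<rho> ` t \<in> F" using inv.image_in_family[OF \<rho> \<open>inj \<rho>\<close>] by blast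
    moreover have "t = \<pi> ` \<rho> ` t" by (simp add: image_comp \<pi>\<rho>)
    ultimately show "t \<in> {\<pi> ` s |s. s \<in> F}" by blast
  next
    fix t assume "t \<in> {\<pi> ` s |s. s \<in> F}"
    then show "t \<in> G" using image_in_family[OF \<pi> bij_is_inj[OF \<open>bij \<pi>\<close>]] by blast
  qed
  then show ?thesis using \<open>bij \<pi>\<close> unfolding pi_homeomorphic_def by blast
qed

end

section \<open>Completions and duals of normed spaces\<close>

context
  fixes X :: "('k::real_or_complex, 'v::ab_group_add) nspace"
  assumes X: "normed_space X"
begin

interpretation vs: vector_space "smul X" using X by (simp add: normed_space_def)

lemma subspace_vset: "vs.subspace (vset X)"
  using X by (simp add: normed_space_def)

lemma vset_zero: "0 \<in> vset X"
  and vset_add: "x \<in> vset X \<Longrightarrow> y \<in> vset X \<Longrightarrow> x + y \<in> vset X"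
  and vset_smul: "x \<in> vset X \<Longrightarrow> smul X a x \<in> vset X"
  and vset_diff: "x \<in> vset X \<Longrightarrow> y \<in> vset X \<Longrightarrow> x - y \<in> vset X"
  using subspace_vset by (simp_all add: vs.subspace_0 vs.subspace_add vs.subspace_scale vs.subspace_diff)

lemma smul_minus_one: "smul X (- 1) x = - x"
  and smul_diff: "smul X a (x - y) = smul X a x - smul X a y"
  by (simp_all add: vs.scale_right_diff_distrib)

lemma vnorm_nonneg: "x \<in> vset X \<Longrightarrow> 0 \<le> vnorm X x"
  and vnorm_eq_zero: "x \<in> vset X \<Longrightarrow> vnorm X x = 0 \<Longrightarrow> x = 0"
  and vnorm_smul: "x \<in> vset X \<Longrightarrow> vnorm X (smul X a x) = norm a * vnorm X x"
  and vnorm_add: "x \<in> vset X \<Longrightarrow> y \<in> vset X \<Longrightarrow> vnorm X (x + y) \<le> vnorm X x + vnorm X y"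
  using X by (simp_all add: normed_space_def)

lemma vnorm_zero: "vnorm X 0 = 0"
  using vnorm_smul[OF vset_zero, of 0] by simp

lemma vnorm_minus_commute: "x \<in> vset X \<Longrightarrow> y \<in> vset X \<Longrightarrow> vnorm X (x - y) = vnorm X (y - x)"
  using vnorm_smul[OF vset_diff, of y x "- 1"] smul_minus_one[of "y - x"] by simp

lemma vnorm_triangle:
  "x \<in> vset X \<Longrightarrow> y \<in> vset X \<Longrightarrow> z \<in> vset X \<Longrightarrow> vnorm X (x - z) \<le> vnorm X (x - y) + vnorm X (y - z)"
  using vnorm_add[OF vset_diff vset_diff, of x y y z] by simp

lemma vnorm_le_diff: "x \<in> vset X \<Longrightarrow> y \<in> vset X \<Longrightarrow> vnorm X x \<le> vnorm X (x - y) + vnorm X y"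
  using vnorm_add[OF vset_diff, of x y y] by simp

end

lemma linear_map_in: "linear_map X Y T \<Longrightarrow> x \<in> vset X \<Longrightarrow> T x \<in> vset Y"
  and linear_map_add: "linear_map X Y T \<Longrightarrow> x \<in> vset X \<Longrightarrow> y \<in> vset X \<Longrightarrow> T (x + y) = T x + T y"
  and linear_map_smul: "linear_map X Y T \<Longrightarrow> x \<in> vset X \<Longrightarrow> T (smul X a x) = smul Y a (T x)"
  by (auto simp: linear_map_def)

lemma linear_map_diff:
  assumes "normed_space X" "normed_space Y" "linear_map X Y T" "x \<in> vset X" "y \<in> vset X"
  shows "T (x - y) = T x - T y"
proof -
  have "T (x - y) = T (x + smul X (- 1) y)" using smul_minus_one[OF assms(1)] by simp
  also have "\<dots> = T x + smul Y (- 1) (T y)"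
    using assms by (simp add: linear_map_add linear_map_smul vset_smul)
  finally show ?thesis using smul_minus_one[OF assms(2)] by simp
qed

lemma banach_space_limit:
  assumes "banach_space Z" "\<And>n. u n \<in> vset Z"
    and "\<And>e. 0 < e \<Longrightarrow> \<exists>M. \<forall>m\<ge>M. \<forall>n\<ge>M. vnorm Z (u m - u n) < e"
  shows "\<exists>z\<in>vset Z. (\<lambda>n. vnorm Z (u n - z)) \<longlonglongrightarrow> 0"
  using assms by (simp add: banach_space_def)

text \<open>
  The difference of the two maps vanishes on a dense set and is bounded.
\<close>
lemma bounded_linear_maps_agree:
  assumes X: "normed_space X" and Z: "normed_space Z" and E: "D \<subseteq> vset X"
    and dense: "\<And>x e. x \<in> vset X \<Longrightarrow> 0 < e \<Longrightarrow> \<exists>u\<in>D. vnorm X (x - u) < e"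
    and L: "linear_map X Z L" "\<And>x. x \<in> vset X \<Longrightarrow> vnorm Z (L x) \<le> C * vnorm X x"
    and M: "linear_map X Z M" "\<And>x. x \<in> vset X \<Longrightarrow> vnorm Z (M x) \<le> C' * vnorm X x"
    and agree: "\<And>u. u \<in> D \<Longrightarrow> L u = M u" and x: "x \<in> vset X"
  shows "L x = M x"
proof -
  have "vnorm Z (L x - M x) \<le> 0 + e" if e: "0 < e" for e
  proof -
    define K where "K = \<bar>C\<bar> + \<bar>C'\<bar> + 1"
    have K: "0 < K" by (simp add: K_def)
    then obtain u where u: "u \<in> D" "vnorm X (x - u) < e / K" using dense[OF x, of "e / K"] e by auto
    have uX: "u \<in> vset X" "x - u \<in> vset X" using u E x vset_diff[OF X] by auto
    have "L x - M x = L (x - u) - M (x - u)"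
      using linear_map_diff[OF X Z L(1) x uX(1)] linear_map_diff[OF X Z M(1) x uX(1)] agree[OF u(1)] by simp
    also have "vnorm Z \<dots> \<le> vnorm Z (L (x - u)) + vnorm Z (M (x - u))"
      using vnorm_le_diff[OF Z, of "- M (x - u)" "- L (x - u)"]
        vnorm_triangle[OF Z, of "L (x - u)" 0 "M (x - u)"] vnorm_minus_commute[OF Z, of 0 "M (x - u)"]
        linear_map_in[OF L(1) uX(2)] linear_map_in[OF M(1) uX(2)] vset_zero[OF Z] by simp
    also have "\<dots> \<le> C * vnorm X (x - u) + C' * vnorm X (x - u)"
      by (intro add_mono L M uX)
    also have "\<dots> \<le> K * vnorm X (x - u)"
      unfolding distrib_right[symmetric] K_def
      by (intro mult_right_mono vnorm_nonneg[OF X] uX) auto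
    also have "\<dots> \<le> e" using u(2) K by (simp add: field_simps)
    finally show ?thesis by simp
  qed
  then have "vnorm Z (L x - M x) \<le> 0" by (rule field_le_epsilon)
  moreover have "L x - M x \<in> vset Z" using vset_diff[OF Z] linear_map_in L(1) M(1) x by blast
  ultimately show ?thesis
    using vnorm_nonneg[OF Z] vnorm_eq_zero[OF Z] by (metis antisym eq_iff_diff_eq_0)
qed

text \<open>
  The graph of the extension is the closure \<open>R\<close> of the graph of \<open>S\<close>. Completeness of \<open>Z\<close> makes \<open>R\<close> total, and the bound
  \<open>C\<close>, which passes to \<open>R\<close>, makes it single-valued. As \<open>R\<close> is compatible with the linear operations, no
  choices have to be compared.
\<close>
lemma extend_bounded_linear_map:
  assumes E: "normed_space E" and X: "normed_space X" and Z: "banach_space Z"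
    and j: "linear_map E X j" "norm_preserving E X j"
    and dense: "\<And>x e. x \<in> vset X \<Longrightarrow> 0 < e \<Longrightarrow> \<exists>u\<in>vset E. vnorm X (x - j u) < e"
    and S: "linear_map E Z S" "\<And>u. u \<in> vset E \<Longrightarrow> vnorm Z (S u) \<le> C * vnorm E u" and C: "0 \<le> C"
  obtains L where "linear_map X Z L" "\<And>u. u \<in> vset E \<Longrightarrow> L (j u) = S u"
    "\<And>x. x \<in> vset X \<Longrightarrow> vnorm Z (L x) \<le> C * vnorm X x"
proof -
  have NZ: "normed_space Z" using Z by (simp add: banach_space_def)
  have jn: "vnorm X (j u) = vnorm E u" if "u \<in> vset E" for u
    using j(2) that by (simp add: norm_preserving_def)
  note jin = linear_map_in[OF j(1)] and Sin = linear_map_in[OF S(1)]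
  define R where "R = (\<lambda>x z. z \<in> vset Z \<and>
    (\<forall>e>0. \<exists>u\<in>vset E. vnorm X (x - j u) < e \<and> vnorm Z (z - S u) < e))"
  have RZ: "z \<in> vset Z" if "R x z" for x z using that by (simp add: R_def)
  have Rapprox: "\<exists>u\<in>vset E. vnorm X (x - j u) < e \<and> vnorm Z (z - S u) < e" if "R x z" "0 < e" for x z e
    using that by (simp add: R_def)
  have RI: "R x z" if "z \<in> vset Z"
    "\<And>e. 0 < e \<Longrightarrow> \<exists>u\<in>vset E. vnorm X (x - j u) < e \<and> vnorm Z (z - S u) < e" for x z
    using that by (simp add: R_def)
  have total: "\<exists>z. R x z" if x: "x \<in> vset X" for x
  proof -
    have "\<exists>u\<in>vset E. vnorm X (x - j u) < inverse (Suc n)" for n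
      using dense[OF x, of "inverse (Suc n)"] by simp
    then obtain u where u: "\<And>n. u n \<in> vset E" "\<And>n. vnorm X (x - j (u n)) < inverse (Suc n)" by metis
    have SuZ: "S (u n) \<in> vset Z" for n using Sin u by blast
    have close: "vnorm Z (S (u m) - S (u n)) \<le> C * (inverse (Suc m) + inverse (Suc n))" for m n
    proof -
      have "vnorm Z (S (u m) - S (u n)) = vnorm Z (S (u m - u n))"
        using linear_map_diff[OF E NZ S(1)] u by simp
      also have "\<dots> \<le> C * vnorm X (j (u m - u n))"
        using S(2) jn vset_diff[OF E] u by simp
      also have "j (u m - u n) = j (u m) - j (u n)" using linear_map_diff[OF E X j(1)] u by simp
      also have "vnorm X \<dots> \<le> vnorm X (j (u m) - x) + vnorm X (x - j (u n))"
        using vnorm_triangle[OF X] jin u x by blast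
      also have "\<dots> \<le> inverse (Suc m) + inverse (Suc n)"
        using u(2)[of m] u(2)[of n] vnorm_minus_commute[OF X x jin[OF u(1)]] by simp
      finally show ?thesis using C by (simp add: mult_left_mono)
    qed
    have cau: "\<exists>M. \<forall>m\<ge>M. \<forall>n\<ge>M. vnorm Z (S (u m) - S (u n)) < e" if e: "0 < e" for e
    proof -
      obtain M where M: "inverse (real (Suc M)) < e / (2 * (C + 1))"
        using reals_Archimedean[of "e / (2 * (C + 1))"] e C by auto
      have "vnorm Z (S (u m) - S (u n)) < e" if "M \<le> m" "M \<le> n" for m n
      proof -
        have inv: "inverse (real (Suc k)) \<le> inverse (real (Suc M))" if "M \<le> k" for k
          using that by (intro le_imp_inverse_le) auto
        have "inverse (real (Suc m)) + inverse (real (Suc n)) \<le> 2 * inverse (real (Suc M))"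
          using inv[OF that(1)] inv[OF that(2)] by linarith
        then have "C * (inverse (Suc m) + inverse (Suc n)) \<le> C * (2 * inverse (Suc M))"
          using C by (rule mult_left_mono)
        also have "\<dots> \<le> (C + 1) * (2 * inverse (Suc M))"
          by (intro mult_right_mono) auto
        also have "\<dots> < (C + 1) * (2 * (e / (2 * (C + 1))))"
          using M C by (intro mult_strict_left_mono) auto
        also have "\<dots> = e" using C by (simp add: field_simps)
        finally show ?thesis using close[of m n] by linarith
      qed
      then show ?thesis by blast
    qed
    have "\<exists>z\<in>vset Z. (\<lambda>n. vnorm Z (S (u n) - z)) \<longlonglongrightarrow> 0"
      by (rule banach_space_limit[OF Z SuZ cau])
    then obtain z where z: "z \<in> vset Z" "(\<lambda>n. vnorm Z (S (u n) - z)) \<longlonglongrightarrow> 0" by blast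
    have "R x z"
    proof (rule RI[OF z(1)])
      fix e :: real assume e: "0 < e"
      have "\<forall>\<^sub>F n in sequentially. vnorm Z (S (u n) - z) < e"
        using order_tendstoD(2)[OF z(2) e] .
      moreover have "\<forall>\<^sub>F n in sequentially. inverse (real (Suc n)) < e"
        using order_tendstoD(2)[OF LIMSEQ_inverse_real_of_nat e] .
      ultimately have "\<forall>\<^sub>F n in sequentially. vnorm Z (S (u n) - z) < e \<and> inverse (real (Suc n)) < e"
        by (rule eventually_conj)
      then obtain n where n: "vnorm Z (S (u n) - z) < e" "inverse (real (Suc n)) < e"
        by (auto simp: eventually_sequentially)
      show "\<exists>u\<in>vset E. vnorm X (x - j u) < e \<and> vnorm Z (z - S u) < e"
        using n u(1)[of n] u(2)[of n] vnorm_minus_commute[OF NZ z(1) SuZ] by (intro bexI[of _ "u n"]) auto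
    qed
    then show ?thesis by blast
  qed
  have bound: "vnorm Z z \<le> C * vnorm X x" if R: "R x z" and x: "x \<in> vset X" for x z
  proof (rule field_le_epsilon)
    fix e :: real assume e: "0 < e"
    define d where "d = e / (C + 1)"
    have "0 < d" "(C + 1) * d = e" using e C by (simp_all add: d_def)
    then have d: "0 < d" "d + C * d = e" by (simp_all add: distrib_right)
    obtain u where u: "u \<in> vset E" "vnorm X (x - j u) < d" "vnorm Z (z - S u) < d"
      using Rapprox[OF R d(1)] by blast
    have "vnorm X (j u) \<le> vnorm X (j u - x) + vnorm X x" by (rule vnorm_le_diff[OF X jin[OF u(1)] x])
    then have ju: "vnorm X (j u) \<le> d + vnorm X x"
      using u(2) vnorm_minus_commute[OF X x jin[OF u(1)]] by simp
    have "vnorm Z z \<le> vnorm Z (z - S u) + vnorm Z (S u)" by (rule vnorm_le_diff[OF NZ RZ[OF R] Sin[OF u(1)]])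
    also have "\<dots> \<le> d + C * (d + vnorm X x)"
      using u(3) S(2)[OF u(1)] jn[OF u(1)] mult_left_mono[OF ju C] by simp
    also have "\<dots> = C * vnorm X x + e" using d(2) by (simp add: distrib_left)
    finally show "vnorm Z z \<le> C * vnorm X x + e" .
  qed
  have add: "R (x + y) (z + w)" if xy: "x \<in> vset X" "y \<in> vset X" and R: "R x z" "R y w" for x y z w
  proof (rule RI)
    show "z + w \<in> vset Z" using vset_add[OF NZ] RZ R by blast
    fix e :: real assume "0 < e"
    then have e: "0 < e / 2" by simp
    obtain u v where u: "u \<in> vset E" "vnorm X (x - j u) < e / 2" "vnorm Z (z - S u) < e / 2"
      and v: "v \<in> vset E" "vnorm X (y - j v) < e / 2" "vnorm Z (w - S v) < e / 2"
      using Rapprox[OF R(1) e] Rapprox[OF R(2) e] by blast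
    have eq: "x + y - j (u + v) = (x - j u) + (y - j v)" "z + w - S (u + v) = (z - S u) + (w - S v)"
      using linear_map_add[OF j(1) u(1) v(1)] linear_map_add[OF S(1) u(1) v(1)] by simp_all
    have "vnorm X (x + y - j (u + v)) < e" unfolding eq
      using vnorm_add[OF X vset_diff[OF X xy(1) jin[OF u(1)]] vset_diff[OF X xy(2) jin[OF v(1)]]] u v
      by linarith
    moreover have "vnorm Z (z + w - S (u + v)) < e" unfolding eq
      using vnorm_add[OF NZ vset_diff[OF NZ RZ[OF R(1)] Sin[OF u(1)]] vset_diff[OF NZ RZ[OF R(2)] Sin[OF v(1)]]] u v
      by linarith
    ultimately show "\<exists>u\<in>vset E. vnorm X (x + y - j u) < e \<and> vnorm Z (z + w - S u) < e"
      using vset_add[OF E u(1) v(1)] by blast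
  qed
  have scale: "R (smul X a x) (smul Z a z)" if x: "x \<in> vset X" and R: "R x z" for a x z
  proof (rule RI)
    show "smul Z a z \<in> vset Z" using vset_smul[OF NZ] RZ R by blast
    fix e :: real assume e: "0 < e"
    define d where "d = e / (norm a + 1)"
    have pos: "0 < norm a + 1" by (simp add: add_nonneg_pos)
    then have "0 < d" "(norm a + 1) * d = e" using e by (simp_all add: d_def)
    then have d: "0 < d" "norm a * d < e" by (simp_all add: distrib_right)
    obtain u where u: "u \<in> vset E" "vnorm X (x - j u) < d" "vnorm Z (z - S u) < d"
      using Rapprox[OF R d(1)] by blast
    have small: "norm a * t < e" if "t < d" for t
      using mult_left_mono[of t d "norm a"] that d(2) by simp
    have eq: "smul X a x - j (smul E a u) = smul X a (x - j u)" "smul Z a z - S (smul E a u) = smul Z a (z - S u)"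
      unfolding linear_map_smul[OF j(1) u(1)] linear_map_smul[OF S(1) u(1)] smul_diff[OF X] smul_diff[OF NZ]
      by (rule refl)+
    have "vnorm X (smul X a x - j (smul E a u)) < e"
      unfolding eq vnorm_smul[OF X vset_diff[OF X x jin[OF u(1)]]] by (rule small[OF u(2)])
    moreover have "vnorm Z (smul Z a z - S (smul E a u)) < e"
      unfolding eq vnorm_smul[OF NZ vset_diff[OF NZ RZ[OF R] Sin[OF u(1)]]] by (rule small[OF u(3)])
    ultimately show "\<exists>w\<in>vset E. vnorm X (smul X a x - j w) < e \<and> vnorm Z (smul Z a z - S w) < e"
      using vset_smul[OF E u(1)] by blast
  qed
  have unique: "z = w" if x: "x \<in> vset X" and R: "R x z" "R x w" for x z w
  proof -
    have "R (x + smul X (- 1) x) (z + smul Z (- 1) w)"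
      by (intro add scale x R vset_smul[OF X])
    then have "R 0 (z - w)" using smul_minus_one[OF X] smul_minus_one[OF NZ] by simp
    then have "vnorm Z (z - w) \<le> 0" "z - w \<in> vset Z"
      using bound[OF _ vset_zero[OF X], of "z - w"] vnorm_zero[OF X] RZ[of 0 "z - w"] by simp_all
    then show ?thesis
      using vnorm_nonneg[OF NZ] vnorm_eq_zero[OF NZ] by (metis antisym eq_iff_diff_eq_0)
  qed
  define L where "L = (\<lambda>x. THE z. R x z)"
  have LR: "R x (L x)" if x: "x \<in> vset X" for x
    unfolding L_def using theI'[of "R x"] total[OF x] unique[OF x] by blast
  have Leq: "L x = z" if "x \<in> vset X" "R x z" for x z using unique LR that by blast
  show thesis
  proof
    show "linear_map X Z L" unfolding linear_map_def
    proof (intro conjI ballI allI)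
      show "L ` vset X \<subseteq> vset Z" using RZ[OF LR] by blast
      show "L (x + y) = L x + L y" if "x \<in> vset X" "y \<in> vset X" for x y
        by (rule Leq[OF vset_add[OF X that] add[OF that LR[OF that(1)] LR[OF that(2)]]])
      show "L (smul X a x) = smul Z a (L x)" if "x \<in> vset X" for a x
        by (rule Leq[OF vset_smul[OF X that] scale[OF that LR[OF that]]])
    qed
    show "L (j u) = S u" if u: "u \<in> vset E" for u
    proof (rule Leq[OF jin[OF u] RI[OF Sin[OF u]]])
      fix e :: real assume "0 < e"
      then show "\<exists>v\<in>vset E. vnorm X (j u - j v) < e \<and> vnorm Z (S u - S v) < e"
        using u vnorm_zero[OF X] vnorm_zero[OF NZ] by (intro bexI[of _ u]) auto
    qed
    show "vnorm Z (L x) \<le> C * vnorm X x" if "x \<in> vset X" for x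
      using bound LR that by blast
  qed
qed

text \<open>
  Extending either embedding along the other gives two contractions that are inverse to each
  other on dense sets, hence everywhere.
\<close>
lemma completions_isometric:
  assumes E: "normed_space E" and X: "is_completion_of X E" and Y: "is_completion_of Y E"
  shows "isometric X Y"
proof -
  obtain i where i: "linear_map E X i" "norm_preserving E X i"
    "\<And>x e. x \<in> vset X \<Longrightarrow> 0 < e \<Longrightarrow> \<exists>u\<in>vset E. vnorm X (x - i u) < e"
    using X by (auto simp: is_completion_of_def)
  obtain j where j: "linear_map E Y j" "norm_preserving E Y j"
    "\<And>x e. x \<in> vset Y \<Longrightarrow> 0 < e \<Longrightarrow> \<exists>u\<in>vset E. vnorm Y (x - j u) < e"
    using Y by (auto simp: is_completion_of_def)
  have BX: "banach_space X" and BY: "banach_space Y" using X Y by (auto simp: is_completion_of_def)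
  then have NX: "normed_space X" and NY: "normed_space Y" by (auto simp: banach_space_def)
  obtain L where L: "linear_map X Y L" "\<And>u. u \<in> vset E \<Longrightarrow> L (i u) = j u"
    "\<And>x. x \<in> vset X \<Longrightarrow> vnorm Y (L x) \<le> 1 * vnorm X x"
    by (rule extend_bounded_linear_map[OF E NX BY i j(1), of 1]) (use j(2) in \<open>auto simp: norm_preserving_def\<close>)
  obtain M where M: "linear_map Y X M" "\<And>u. u \<in> vset E \<Longrightarrow> M (j u) = i u"
    "\<And>x. x \<in> vset Y \<Longrightarrow> vnorm X (M x) \<le> 1 * vnorm Y x"
    by (rule extend_bounded_linear_map[OF E NY BX j i(1), of 1]) (use i(2) in \<open>auto simp: norm_preserving_def\<close>)
  have round: "B (A x) = x"
    if N: "normed_space P" and A: "linear_map P Q A" "\<And>x. x \<in> vset P \<Longrightarrow> vnorm Q (A x) \<le> 1 * vnorm P x"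
      and B: "linear_map Q P B" "\<And>x. x \<in> vset Q \<Longrightarrow> vnorm P (B x) \<le> 1 * vnorm Q x"
      and k: "linear_map E P k" "\<And>x e. x \<in> vset P \<Longrightarrow> 0 < e \<Longrightarrow> \<exists>u\<in>vset E. vnorm P (x - k u) < e"
      and BA: "\<And>u. u \<in> vset E \<Longrightarrow> B (A (k u)) = k u" and x: "x \<in> vset P"
    for P :: "('a, 'p::ab_group_add) nspace" and Q :: "('a, 'q::ab_group_add) nspace" and A B k x
  proof (rule bounded_linear_maps_agree[OF N N, where L = "\<lambda>x. B (A x)" and M = "\<lambda>x. x" and D = "k ` vset E"])
    show "k ` vset E \<subseteq> vset P" using k(1) by (simp add: linear_map_def)
    show "\<exists>u\<in>k ` vset E. vnorm P (x - u) < e" if "x \<in> vset P" "0 < e" for x e using k(2)[OF that] by blast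
    show "linear_map P P (\<lambda>x. B (A x))" "linear_map P P (\<lambda>x. x)"
      using A(1) B(1) by (auto simp: linear_map_def image_subset_iff)
    show "vnorm P (B (A x)) \<le> 1 * vnorm P x" if "x \<in> vset P" for x
      using A(2)[OF that] B(2)[OF linear_map_in[OF A(1) that]] by simp
    show "vnorm P x \<le> 1 * vnorm P x" for x by simp
  qed (use BA x in auto)
  have MoL: "M (L x) = x" if "x \<in> vset X" for x
    by (rule round[OF NX L(1,3) M(1,3) i(1,3)]) (use L M that in auto)
  have LoM: "L (M y) = y" if "y \<in> vset Y" for y
    by (rule round[OF NY M(1,3) L(1,3) j(1,3)]) (use L M that in auto)
  have "bij_betw L (vset X) (vset Y)"
    by (rule bij_betw_byWitness[where f' = M])
       (use MoL LoM linear_map_in[OF L(1)] linear_map_in[OF M(1)] in auto)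
  moreover have "norm_preserving X Y L"
    unfolding norm_preserving_def
  proof
    fix x assume x: "x \<in> vset X"
    show "vnorm Y (L x) = vnorm X x"
      using L(3)[OF x] M(3)[OF linear_map_in[OF L(1) x]] MoL[OF x] by simp
  qed
  ultimately show ?thesis using L(1) by (auto simp: isometric_def)
qed

lemma dual_spaceD:
  assumes "f \<in> vset (dual_space X)"
  shows "linear_map X scalar_space f" "\<exists>C. \<forall>x\<in>vset X. norm (f x) \<le> C * vnorm X x"
    "x \<notin> vset X \<Longrightarrow> f x = 0"
  using assms by (simp_all add: dual_space_def)

lemma dual_spaceI:
  assumes "linear_map X scalar_space f" "\<And>x. x \<in> vset X \<Longrightarrow> norm (f x) \<le> C * vnorm X x"
    "\<And>x. x \<notin> vset X \<Longrightarrow> f x = 0"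
  shows "f \<in> vset (dual_space X)"
  using assms by (auto simp: dual_space_def)

text \<open>
  Rescaling vectors to norm \<open>1\<close>. The boundedness of \<open>f\<close> is what makes the supremum that defines its norm
  meaningful, and what forces \<open>f x = 0\<close> when the norm of \<open>x\<close> is zero.
\<close>
lemma dual_norm_le_one_iff:
  assumes X: "normed_space X" and f: "f \<in> vset (dual_space X)"
  shows "vnorm (dual_space X) f \<le> 1 \<longleftrightarrow> (\<forall>x\<in>vset X. norm (f x) \<le> vnorm X x)"
proof -
  let ?S = "{norm (f x) |x. x \<in> vset X \<and> vnorm X x \<le> 1}"
  have lin: "linear_map X scalar_space f" using f by (simp add: dual_space_def)
  obtain C where C: "\<And>x. x \<in> vset X \<Longrightarrow> norm (f x) \<le> C * vnorm X x" using f by (auto simp: dual_space_def)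
  have "norm (f 0) \<in> ?S" using vset_zero[OF X] vnorm_zero[OF X] by (auto intro!: exI[of _ 0])
  then have ne: "?S \<noteq> {}" by blast
  have bdd: "bdd_above ?S"
  proof (rule bdd_aboveI)
    fix r assume "r \<in> ?S"
    then obtain x where x: "x \<in> vset X" "vnorm X x \<le> 1" "r = norm (f x)" by blast
    have "C * vnorm X x \<le> \<bar>C\<bar> * 1"
      using x vnorm_nonneg[OF X x(1)] by (intro mult_mono) auto
    then show "r \<le> \<bar>C\<bar>" using C[OF x(1)] x(3) by simp
  qed
  have "vnorm (dual_space X) f = Sup ?S" by (simp add: dual_space_def)
  moreover have "Sup ?S \<le> 1 \<longleftrightarrow> (\<forall>r\<in>?S. r \<le> 1)" using cSup_le_iff[OF ne bdd] .
  moreover have "(\<forall>r\<in>?S. r \<le> 1) \<longleftrightarrow> (\<forall>x\<in>vset X. norm (f x) \<le> vnorm X x)"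
  proof
    assume le: "\<forall>r\<in>?S. r \<le> 1"
    show "\<forall>x\<in>vset X. norm (f x) \<le> vnorm X x"
    proof
      fix x assume x: "x \<in> vset X"
      show "norm (f x) \<le> vnorm X x"
      proof (cases "vnorm X x = 0")
        case True
        then show ?thesis using C[OF x] by simp
      next
        case False
        then have pos: "0 < vnorm X x" using vnorm_nonneg[OF X x] by simp
        define a :: 'a where "a = of_real (inverse (vnorm X x))"
        have na: "norm a = inverse (vnorm X x)" unfolding a_def norm_of_real using pos by simp
        have "norm (f (smul X a x)) \<le> 1"
        proof -
          have "vnorm X (smul X a x) \<le> 1" using vnorm_smul[OF X x, of a] na pos by simp
          then show ?thesis using le vset_smul[OF X x, of a] by blast
        qed
        moreover have "f (smul X a x) = a * f x" using linear_map_smul[OF lin x] by (simp add: scalar_space_def)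
        ultimately show ?thesis using na pos by (simp add: norm_mult field_simps)
      qed
    qed
  next
    assume "\<forall>x\<in>vset X. norm (f x) \<le> vnorm X x"
    then show "\<forall>r\<in>?S. r \<le> 1" by fastforce
  qed
  ultimately show ?thesis by simp
qed

text \<open>
  Functionals are transported by composition with the inverse isometry and extended by zero outside
  the subspace.
\<close>
lemma isometric_duals:
  assumes X: "normed_space X" and Y: "normed_space Y" and iso: "isometric X Y"
  shows "isometric (dual_space X) (dual_space Y)"
proof -
  obtain T where T: "linear_map X Y T" "bij_betw T (vset X) (vset Y)" "norm_preserving X Y T"
    using iso by (auto simp: isometric_def)
  define R where "R = inv_into (vset X) T"
  have R: "bij_betw R (vset Y) (vset X)" unfolding R_def by (rule bij_betw_inv_into[OF T(2)])
  have RT: "R (T x) = x" if "x \<in> vset X" for x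
    unfolding R_def using bij_betw_inv_into_left[OF T(2) that] .
  have TR: "T (R y) = y" if "y \<in> vset Y" for y
    unfolding R_def using bij_betw_inv_into_right[OF T(2) that] .
  have Rin: "R y \<in> vset X" if "y \<in> vset Y" for y using R that by (auto simp: bij_betw_def)
  have Tin: "T x \<in> vset Y" if "x \<in> vset X" for x using linear_map_in[OF T(1) that] .
  have Rlin: "linear_map Y X R" unfolding linear_map_def
  proof (intro conjI ballI allI)
    show "R ` vset Y \<subseteq> vset X" using Rin by auto
    show "R (x + y) = R x + R y" if "x \<in> vset Y" "y \<in> vset Y" for x y
      using RT[OF vset_add[OF X Rin[OF that(1)] Rin[OF that(2)]]]
        linear_map_add[OF T(1) Rin[OF that(1)] Rin[OF that(2)]] TR that by simp
    show "R (smul Y a x) = smul X a (R x)" if "x \<in> vset Y" for a x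
      using RT[OF vset_smul[OF X Rin[OF that]]] linear_map_smul[OF T(1) Rin[OF that]] TR that by simp
  qed
  have Tn: "vnorm Y (T x) = vnorm X x" if "x \<in> vset X" for x
    using T(3) that by (simp add: norm_preserving_def)
  have Rn: "vnorm X (R y) = vnorm Y y" if "y \<in> vset Y" for y
    using Tn[OF Rin[OF that]] TR[OF that] by simp
  have pull: "(\<lambda>y. if y \<in> vset Q then f (A y) else 0) \<in> vset (dual_space Q)"
    if N: "normed_space Q" and A: "linear_map Q P A" "\<And>y. y \<in> vset Q \<Longrightarrow> vnorm P (A y) = vnorm Q y"
      and f: "f \<in> vset (dual_space P)"
    for P :: "('a, 'p::ab_group_add) nspace" and Q :: "('a, 'q::ab_group_add) nspace" and A f
  proof -
    have "linear_map P scalar_space f" using f by (simp add: dual_space_def)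
    then have "linear_map Q scalar_space (\<lambda>y. if y \<in> vset Q then f (A y) else 0)"
      using A(1) vset_add[OF N] vset_smul[OF N] by (simp add: linear_map_def scalar_space_def image_subset_iff)
    moreover obtain C where "\<And>x. x \<in> vset P \<Longrightarrow> norm (f x) \<le> C * vnorm P x"
      using f by (auto simp: dual_space_def)
    then have "\<forall>y\<in>vset Q. norm (if y \<in> vset Q then f (A y) else 0) \<le> C * vnorm Q y"
      using A linear_map_in[OF A(1)] by fastforce
    ultimately show ?thesis by (auto simp: dual_space_def)
  qed
  define \<Phi> where "\<Phi> = (\<lambda>f y. if y \<in> vset Y then f (R y) else (0 :: 'a))"
  define \<Psi> where "\<Psi> = (\<lambda>f x. if x \<in> vset X then f (T x) else (0 :: 'a))"
  have \<Phi>in: "\<Phi> f \<in> vset (dual_space Y)" if "f \<in> vset (dual_space X)" for f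
    unfolding \<Phi>_def by (rule pull[OF Y Rlin Rn that])
  have \<Psi>in: "\<Psi> f \<in> vset (dual_space X)" if "f \<in> vset (dual_space Y)" for f
    unfolding \<Psi>_def by (rule pull[OF X T(1) Tn that])
  have "bij_betw \<Phi> (vset (dual_space X)) (vset (dual_space Y))"
  proof (rule bij_betw_byWitness[where f' = \<Psi>])
    show "\<forall>f\<in>vset (dual_space X). \<Psi> (\<Phi> f) = f"
      by (auto simp: \<Phi>_def \<Psi>_def RT Tin dual_space_def fun_eq_iff)
    show "\<forall>f\<in>vset (dual_space Y). \<Phi> (\<Psi> f) = f"
      by (auto simp: \<Phi>_def \<Psi>_def TR Rin dual_space_def fun_eq_iff)
  qed (use \<Phi>in \<Psi>in in auto)
  moreover have "linear_map (dual_space X) (dual_space Y) \<Phi>"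
    unfolding linear_map_def
  proof (intro conjI ballI allI)
    show "\<Phi> ` vset (dual_space X) \<subseteq> vset (dual_space Y)" using \<Phi>in by blast
    show "\<Phi> (f + g) = \<Phi> f + \<Phi> g" for f g by (simp add: \<Phi>_def fun_eq_iff)
    show "\<Phi> (smul (dual_space X) a f) = smul (dual_space Y) a (\<Phi> f)" for a f
      by (simp add: \<Phi>_def dual_space_def fun_eq_iff)
  qed
  moreover have "norm_preserving (dual_space X) (dual_space Y) \<Phi>"
    unfolding norm_preserving_def
  proof
    fix f
    have "{norm (\<Phi> f y) |y. y \<in> vset Y \<and> vnorm Y y \<le> 1} = {norm (f x) |x. x \<in> vset X \<and> vnorm X x \<le> 1}"
      (is "?A = ?B")
    proof
      show "?A \<subseteq> ?B" using Rin Rn by (force simp: \<Phi>_def)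
      show "?B \<subseteq> ?A"
      proof
        fix r assume "r \<in> ?B"
        then obtain x where "x \<in> vset X" "vnorm X x \<le> 1" "r = norm (f x)" by blast
        then show "r \<in> ?A" using Tin Tn RT by (auto simp: \<Phi>_def intro!: exI[of _ "T x"])
      qed
    qed
    then show "vnorm (dual_space Y) (\<Phi> f) = vnorm (dual_space X) f"
      by (simp add: dual_space_def)
  qed
  ultimately show ?thesis by (auto simp: isometric_def)
qed

section \<open>Coefficients of functionals on a combinatorial space\<close>

definition pair_c00 :: "(nat \<Rightarrow> 'k) \<Rightarrow> (nat \<Rightarrow> 'k) \<Rightarrow> 'k::real_or_complex" where
  "pair_c00 a u = (\<Sum>i\<in>supp u. a i * u i)"

lemma pair_c00_superset:
  "finite s \<Longrightarrow> supp u \<subseteq> s \<Longrightarrow> pair_c00 a u = (\<Sum>i\<in>s. a i * u i)"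
  unfolding pair_c00_def by (rule sum.mono_neutral_left) auto

lemma pair_c00_add_right:
  assumes "u \<in> c00" "v \<in> c00"
  shows "pair_c00 a (u + v) = pair_c00 a u + pair_c00 a v"
proof -
  have fin: "finite (supp u \<union> supp v)" using assms by (simp add: c00_def)
  have "pair_c00 a w = (\<Sum>i\<in>supp u \<union> supp v. a i * w i)" if "w \<in> {u, v, u + v}" for w
    by (rule pair_c00_superset[OF fin]) (use that in auto)
  then show ?thesis by (simp add: sum.distrib distrib_left)
qed

lemma pair_c00_scale_right:
  assumes "u \<in> c00"
  shows "pair_c00 a (\<lambda>i. c * u i) = c * pair_c00 a u"
proof -
  have fin: "finite (supp u)" using assms by (simp add: c00_def)
  have "pair_c00 a (\<lambda>i. c * u i) = (\<Sum>i\<in>supp u. a i * (c * u i))"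
    by (rule pair_c00_superset[OF fin]) auto
  then show ?thesis by (simp add: pair_c00_def sum_distrib_left mult.left_commute)
qed

lemma pair_c00_add_left: "pair_c00 (a + b) u = pair_c00 a u + pair_c00 b u"
  by (simp add: pair_c00_def sum.distrib distrib_right)

lemma pair_c00_scale_left: "pair_c00 (\<lambda>i. c * a i) u = c * pair_c00 a u"
  by (simp add: pair_c00_def sum_distrib_left mult.assoc)

lemma unit_seq_c00: "unit_seq k \<in> c00"
  by (simp add: unit_seq_def c00_def)

lemma pair_c00_unit_seq: "pair_c00 a (unit_seq k) = a k"
proof -
  have "pair_c00 a (unit_seq k) = (\<Sum>i\<in>{k}. a i * unit_seq k i)"
    by (rule pair_c00_superset) (auto simp: unit_seq_def)
  then show ?thesis by (simp add: unit_seq_def)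
qed

definition bounded_coefficients :: "nat set set \<Rightarrow> (nat \<Rightarrow> 'k::real_or_complex) set" where
  "bounded_coefficients F = {a. \<exists>C. \<forall>u\<in>c00. norm (pair_c00 a u) \<le> C * fam_norm F u}"

lemma bounded_coefficients_add:
  assumes "a \<in> bounded_coefficients F" "b \<in> bounded_coefficients F"
  shows "a + b \<in> bounded_coefficients F"
proof -
  obtain C D where "\<And>u. u \<in> c00 \<Longrightarrow> norm (pair_c00 a u) \<le> C * fam_norm F u"
    "\<And>u. u \<in> c00 \<Longrightarrow> norm (pair_c00 b u) \<le> D * fam_norm F u"
    using assms by (auto simp: bounded_coefficients_def)
  then have "norm (pair_c00 (a + b) u) \<le> (C + D) * fam_norm F u" if "u \<in> c00" for u
    unfolding pair_c00_add_left distrib_right using that by (intro norm_triangle_le add_mono) auto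
  then show ?thesis by (auto simp: bounded_coefficients_def)
qed

lemma bounded_coefficients_scale:
  assumes "a \<in> bounded_coefficients F"
  shows "(\<lambda>i. c * a i) \<in> bounded_coefficients F"
proof -
  obtain C where C: "\<And>u. u \<in> c00 \<Longrightarrow> norm (pair_c00 a u) \<le> C * fam_norm F u"
    using assms by (auto simp: bounded_coefficients_def)
  have "norm (pair_c00 (\<lambda>i. c * a i) u) \<le> (norm c * C) * fam_norm F u" if "u \<in> c00" for u
    unfolding pair_c00_scale_left norm_mult mult.assoc by (intro mult_left_mono C that) auto
  then show ?thesis by (auto simp: bounded_coefficients_def)
qed

text \<open>
  The norm of a finitely supported vector is attained at some member of the family, since the members have
  only finitely many traces on the support. For the converse the phases of \<open>a\<close> are moved into
  the test vector; \<open>inverse (sgn 0) = 0\<close> does no harm where \<open>a\<close> vanishes.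
\<close>
lemma dominated_iff_pair_c00:
  fixes a :: "nat \<Rightarrow> 'k::real_or_complex"
  assumes F: "is_family F"
  shows "dominated F a \<longleftrightarrow> (\<forall>u\<in>c00. norm (pair_c00 a u) \<le> fam_norm F u)"
proof
  assume dom: "dominated F a"
  show "\<forall>u\<in>c00. norm (pair_c00 a u) \<le> fam_norm F u"
  proof
    fix u :: "nat \<Rightarrow> 'k" assume u: "u \<in> c00"
    then have fin: "finite (supp u)" by (simp add: c00_def)
    obtain s where s: "s \<in> F" "(\<Sum>i\<in>supp u. norm (a i) * norm (u i)) \<le> (\<Sum>i\<in>supp u \<inter> s. norm (u i))"
      using dominatedD[OF dom fin, of "\<lambda>i. norm (u i)"] by auto
    have "norm (pair_c00 a u) \<le> (\<Sum>i\<in>supp u. norm (a i) * norm (u i))"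
      unfolding pair_c00_def by (rule sum_norm_le) (simp add: norm_mult)
    also note s(2)
    also have "(\<Sum>i\<in>supp u \<inter> s. norm (u i)) \<le> (\<Sum>i\<in>s. norm (u i))"
      using s(1) F by (intro sum_mono2) (auto simp: is_family_def)
    also have "\<dots> \<le> fam_norm F u"
      by (rule fam_norm_upper[OF fam_bdd_c00[OF F u] s(1)])
    finally show "norm (pair_c00 a u) \<le> fam_norm F u" .
  qed
next
  assume le: "\<forall>u\<in>c00. norm (pair_c00 a u) \<le> fam_norm F u"
  show "dominated F a" unfolding dominated_def
  proof (intro allI impI)
    fix A :: "nat set" and x :: "nat \<Rightarrow> real" assume A: "finite A" and x: "\<forall>i. 0 \<le> x i"
    define u where "u = (\<lambda>i. if i \<in> A then of_real (x i) * inverse (sgn (a i)) else 0)"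
    have sub: "supp u \<subseteq> A" by (auto simp: u_def)
    then have u: "u \<in> c00" using A by (auto simp: c00_def intro: finite_subset)
    have fin: "finite s" if "s \<in> F" for s using F that by (auto simp: is_family_def)
    let ?S = "(\<lambda>s. \<Sum>i\<in>A \<inter> s. norm (u i)) ` F"
    have eq: "(\<Sum>i\<in>s. norm (u i)) = (\<Sum>i\<in>A \<inter> s. norm (u i))" if "s \<in> F" for s
      using fin[OF that] sub by (intro sum.mono_neutral_right) auto
    have "{\<Sum>i\<in>s. norm (u i) |s. s \<in> F} = ?S"
      unfolding Setcompr_eq_image by (rule image_cong[OF refl eq])
    then have "fam_norm F u = Sup ?S" by (simp add: fam_norm_def)
    also have "\<dots> = Max ?S"
      using F finite_restricted_sums[OF A, of "\<lambda>i. norm (u i)" F] by (intro cSup_eq_Max) (auto simp: is_family_def)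
    also have "\<dots> \<in> ?S"
      using F finite_restricted_sums[OF A, of "\<lambda>i. norm (u i)" F] by (intro Max_in) (auto simp: is_family_def)
    finally obtain s where s: "s \<in> F" "fam_norm F u = (\<Sum>i\<in>A \<inter> s. norm (u i))" by blast
    have au: "a i * u i = of_real (norm (a i) * x i)" if "i \<in> A" for i
    proof (cases "a i = 0")
      case False
      have "a i = of_real (norm (a i)) * sgn (a i)"
        using False by (simp add: sgn_div_norm scaleR_conv_of_real)
      then have "a i * u i = of_real (norm (a i)) * sgn (a i) * (of_real (x i) * inverse (sgn (a i)))"
        using that by (simp add: u_def)
      also have "\<dots> = of_real (norm (a i) * x i)" using False by (simp add: sgn_zero_iff)
      finally show ?thesis .
    qed simp
    have "pair_c00 a u = of_real (\<Sum>i\<in>A. norm (a i) * x i)"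
      unfolding pair_c00_superset[OF A sub] of_real_sum by (intro sum.cong au) auto
    then have "norm (pair_c00 a u) = (\<Sum>i\<in>A. norm (a i) * x i)"
      using x by (simp add: sum_nonneg del: of_real_sum)
    then have "(\<Sum>i\<in>A. norm (a i) * x i) \<le> (\<Sum>i\<in>A \<inter> s. norm (u i))" using le u s by auto
    also have "\<dots> \<le> (\<Sum>i\<in>A \<inter> s. x i)"
      using x by (intro sum_mono) (auto simp: u_def norm_mult norm_inverse norm_sgn)
    finally show "\<exists>s\<in>F. (\<Sum>i\<in>A. norm (a i) * x i) \<le> (\<Sum>i\<in>A \<inter> s. x i)" using s(1) by blast
  qed
qed

lemma dominated_bounded_coefficients:
  "is_family F \<Longrightarrow> dominated F a \<Longrightarrow> a \<in> bounded_coefficients F"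
  unfolding bounded_coefficients_def dominated_iff_pair_c00 by (auto intro: exI[of _ 1])

lemma normed_c00_space:
  assumes F: "is_family F"
  shows "normed_space (c00_space F :: ('k::real_or_complex, _) nspace)"
proof -
  let ?E = "c00_space F :: ('k, _) nspace"
  have [simp]: "smul ?E = (\<lambda>a x i. a * x i)" "vnorm ?E = fam_norm F" "vset ?E = c00"
    by (simp_all add: c00_space_def)
  interpret vs: vector_space "smul ?E"
    by standard (auto simp: fun_eq_iff algebra_simps)
  have "vs.subspace (vset ?E)"
    by (rule vs.subspaceI) (auto simp: c00_zero c00_add c00_scale)
  moreover have "x = 0" if "x \<in> c00" "fam_norm F x = 0" for x :: "nat \<Rightarrow> 'k"
    using fam_norm_coord[OF F fam_bdd_c00[OF F that(1)]] that(2) by (auto simp: fun_eq_iff)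
  moreover have "0 \<le> fam_norm F x" "fam_norm F (\<lambda>i. a * x i) = norm a * fam_norm F x"
    if "x \<in> c00" for x :: "nat \<Rightarrow> 'k" and a
    using fam_norm_nonneg[OF F] fam_norm_scale[OF F] fam_bdd_c00[OF F that] by auto
  moreover have "fam_norm F (x + y) \<le> fam_norm F x + fam_norm F y"
    if "x \<in> c00" "y \<in> c00" for x y :: "nat \<Rightarrow> 'k"
    by (rule fam_norm_add(2)[OF F fam_bdd_c00[OF F that(1)] fam_bdd_c00[OF F that(2)]])
  ultimately show ?thesis unfolding normed_space_def
    using vs.vector_space_axioms by simp
qed

lemma banach_scalar_space: "banach_space (scalar_space :: ('k::real_or_complex, 'k) nspace)"
proof -
  let ?K = "scalar_space :: ('k, 'k) nspace"
  have [simp]: "smul ?K = (*)" "vnorm ?K = norm" "vset ?K = UNIV"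
    by (simp_all add: scalar_space_def)
  interpret vs: vector_space "smul ?K"
    by standard (auto simp: algebra_simps)
  have "normed_space ?K" unfolding normed_space_def
    using vs.vector_space_axioms vs.subspace_UNIV by (simp add: norm_mult norm_triangle_ineq)
  moreover have "\<exists>x. (\<lambda>n. norm (u n - x)) \<longlonglongrightarrow> 0"
    if cau: "\<forall>e>0. \<exists>M. \<forall>m\<ge>M. \<forall>n\<ge>M. norm (u m - u n) < e" for u :: "nat \<Rightarrow> 'k"
  proof -
    have "Cauchy u" using cau by (auto simp: Cauchy_def dist_norm)
    then obtain x where "u \<longlonglongrightarrow> x" using Cauchy_convergent convergent_def by blast
    then show ?thesis by (metis LIM_zero_iff tendsto_norm_zero_iff)
  qed
  ultimately show ?thesis by (simp add: banach_space_def)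
qed

lemma linear_map_on_c00:
  fixes g :: "(nat \<Rightarrow> 'k::real_or_complex) \<Rightarrow> 'k"
  assumes g: "linear_map (c00_space F) scalar_space g" and u: "u \<in> c00"
  shows "g u = pair_c00 (\<lambda>i. g (unit_seq i)) u"
proof -
  have gadd: "g (x + y) = g x + g y" if "x \<in> c00" "y \<in> c00" for x y
    using linear_map_add[OF g] that by (simp add: c00_space_def)
  have gscale: "g (\<lambda>i. c * x i) = c * g x" if "x \<in> c00" for c x
    using linear_map_smul[OF g, of x c] that by (simp add: c00_space_def scalar_space_def)
  have "signed_on s u \<in> c00 \<and> g (signed_on s u) = (\<Sum>i\<in>s. g (unit_seq i) * u i)" if "finite s" for s
    using that
  proof (induction s)
    case empty
    have "g 0 = 0" using gadd[OF c00_zero c00_zero] by simp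
    then show ?case by (metis signed_on_empty c00_zero sum.empty)
  next
    case (insert k s)
    have eq: "signed_on (insert k s) u = signed_on s u + (\<lambda>i. u k * unit_seq k i)"
      by (rule signed_on_insert) (rule insert.hyps)
    have in_c00: "signed_on s u \<in> c00" "(\<lambda>i. u k * unit_seq k i) \<in> c00"
      using insert.IH c00_scale[OF unit_seq_c00] by auto
    show ?case unfolding eq
    proof
      show "signed_on s u + (\<lambda>i. u k * unit_seq k i) \<in> c00" by (rule c00_add[OF in_c00])
      show "g (signed_on s u + (\<lambda>i. u k * unit_seq k i)) = (\<Sum>i\<in>insert k s. g (unit_seq i) * u i)"
        unfolding gadd[OF in_c00] gscale[OF unit_seq_c00] using insert by (simp add: ac_simps)
    qed
  qed
  moreover have "finite (supp u)" "signed_on (supp u) u = u"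
    using u by (auto simp: c00_def signed_on_def)
  ultimately show ?thesis by (metis pair_c00_def)
qed

lemma dual_space_add:
  assumes f: "f \<in> vset (dual_space X)" and g: "g \<in> vset (dual_space X)"
  shows "f + g \<in> vset (dual_space X)"
proof -
  obtain C where C: "\<And>x. x \<in> vset X \<Longrightarrow> norm (f x) \<le> C * vnorm X x" using dual_spaceD(2)[OF f] by blast
  obtain D where D: "\<And>x. x \<in> vset X \<Longrightarrow> norm (g x) \<le> D * vnorm X x" using dual_spaceD(2)[OF g] by blast
  show ?thesis
  proof (rule dual_spaceI)
    show "linear_map X scalar_space (f + g)"
      using dual_spaceD(1)[OF f] dual_spaceD(1)[OF g]
      by (simp add: linear_map_def scalar_space_def algebra_simps)
    show "norm ((f + g) x) \<le> (C + D) * vnorm X x" if "x \<in> vset X" for x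
      unfolding plus_fun_apply distrib_right using C[OF that] D[OF that] by (intro norm_triangle_le add_mono)
    show "(f + g) x = 0" if "x \<notin> vset X" for x
      using dual_spaceD(3)[OF f that] dual_spaceD(3)[OF g that] by simp
  qed
qed

lemma dual_space_scale:
  assumes f: "f \<in> vset (dual_space X)"
  shows "smul (dual_space X) c f \<in> vset (dual_space X)"
proof -
  obtain C where C: "\<And>x. x \<in> vset X \<Longrightarrow> norm (f x) \<le> C * vnorm X x" using dual_spaceD(2)[OF f] by blast
  have eq: "smul (dual_space X) c f = (\<lambda>x. c * f x)" by (simp add: dual_space_def)
  show ?thesis unfolding eq
  proof (rule dual_spaceI)
    show "linear_map X scalar_space (\<lambda>x. c * f x)"
      using dual_spaceD(1)[OF f] by (simp add: linear_map_def scalar_space_def algebra_simps)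
    show "norm (c * f x) \<le> (norm c * C) * vnorm X x" if "x \<in> vset X" for x
      unfolding norm_mult mult.assoc by (intro mult_left_mono C that) auto
    show "c * f x = 0" if "x \<notin> vset X" for x using dual_spaceD(3)[OF f that] by simp
  qed
qed

text \<open>
  A functional is determined by its values on the unit vectors because their span is dense in the
  completion, and every bounded coefficient sequence comes from a functional by extension. Density also
  shows that the norm is determined on finitely supported vectors.
\<close>
lemma dual_space_coefficients:
  fixes X :: "('k::real_or_complex, 'a::ab_group_add) nspace"
  assumes F: "is_family F" and X: "is_combinatorial_space F X"
  obtains \<Phi> where "bij_betw \<Phi> (vset (dual_space X)) (bounded_coefficients F)"
    "\<And>f g. \<Phi> (f + g) = \<Phi> f + \<Phi> g" "\<And>c f. \<Phi> (smul (dual_space X) c f) = (\<lambda>i. c * \<Phi> f i)"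
    "\<And>f. f \<in> vset (dual_space X) \<Longrightarrow> vnorm (dual_space X) f \<le> 1 \<longleftrightarrow> dominated F (\<Phi> f)"
proof -
  let ?E = "c00_space F :: ('k, _) nspace" and ?K = "scalar_space :: ('k, 'k) nspace"
  have E: "vset ?E = c00" "vnorm ?E = fam_norm F" by (simp_all add: c00_space_def)
  have NE: "normed_space ?E" by (rule normed_c00_space[OF F])
  have BK: "banach_space ?K" by (rule banach_scalar_space)
  then have NK: "normed_space ?K" by (simp add: banach_space_def)
  obtain j where BX: "banach_space X" and j: "linear_map ?E X j" "norm_preserving ?E X j"
    and dense: "\<And>x e. x \<in> vset X \<Longrightarrow> 0 < e \<Longrightarrow> \<exists>u\<in>vset ?E. vnorm X (x - j u) < e"
    using X unfolding is_combinatorial_space_def is_completion_of_def by blast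
  have NX: "normed_space X" using BX by (simp add: banach_space_def)
  have jin: "j u \<in> vset X" and jn: "vnorm X (j u) = fam_norm F u" if "u \<in> c00" for u
    using linear_map_in[OF j(1)] j(2) that by (auto simp: E norm_preserving_def)
  have denseD: "\<exists>y\<in>j ` c00. vnorm X (x - y) < e" if "x \<in> vset X" "0 < e" for x e
    using dense[OF that] E by auto
  define \<Phi> where "\<Phi> = (\<lambda>f i. f (j (unit_seq i)) :: 'k)"
  have dual: "linear_map X ?K f" "\<exists>C. \<forall>x\<in>vset X. norm (f x) \<le> C * vnorm X x" "\<And>x. x \<notin> vset X \<Longrightarrow> f x = 0"
    if "f \<in> vset (dual_space X)" for f
    using that by (auto simp: dual_space_def)
  have val: "f (j u) = pair_c00 (\<Phi> f) u" if f: "linear_map X ?K f" and u: "u \<in> c00" for f u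
  proof -
    have "linear_map ?E ?K (\<lambda>u. f (j u))"
      using f j(1) by (simp add: linear_map_def image_subset_iff)
    from linear_map_on_c00[OF this u] show ?thesis by (simp add: \<Phi>_def)
  qed
  have Knorm: "vnorm ?K = norm" by (simp add: scalar_space_def)
  have into: "\<Phi> f \<in> bounded_coefficients F" if f: "f \<in> vset (dual_space X)" for f
  proof -
    obtain C where "\<And>x. x \<in> vset X \<Longrightarrow> norm (f x) \<le> C * vnorm X x" using dual(2)[OF f] by blast
    then have "norm (pair_c00 (\<Phi> f) u) \<le> C * fam_norm F u" if "u \<in> c00" for u
      using val[OF dual(1)[OF f] that] jin[OF that] jn[OF that] by metis
    then show ?thesis by (auto simp: bounded_coefficients_def)
  qed
  have inj: "f = g" if f: "f \<in> vset (dual_space X)" and g: "g \<in> vset (dual_space X)" and eq: "\<Phi> f = \<Phi> g" for f g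
  proof
    fix x
    show "f x = g x"
    proof (cases "x \<in> vset X")
      case True
      obtain C where C: "\<And>x. x \<in> vset X \<Longrightarrow> vnorm ?K (f x) \<le> C * vnorm X x" using dual(2)[OF f] Knorm by auto
      obtain D where D: "\<And>x. x \<in> vset X \<Longrightarrow> vnorm ?K (g x) \<le> D * vnorm X x" using dual(2)[OF g] Knorm by auto
      show ?thesis
      proof (rule bounded_linear_maps_agree[OF NX NK _ denseD dual(1)[OF f] C dual(1)[OF g] D _ True])
        show "j ` c00 \<subseteq> vset X" using jin by blast
        fix u assume "u \<in> j ` c00"
        then show "f u = g u" using val[OF dual(1)[OF f]] val[OF dual(1)[OF g]] eq by auto
      qed
    next
      case False
      then show ?thesis using dual(3)[OF f] dual(3)[OF g] by simp
    qed
  qed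
  have surj: "\<exists>f\<in>vset (dual_space X). \<Phi> f = a" if a: "a \<in> bounded_coefficients F" for a
  proof -
    obtain C where C: "\<And>u. u \<in> c00 \<Longrightarrow> norm (pair_c00 a u) \<le> C * fam_norm F u"
      using a by (auto simp: bounded_coefficients_def)
    have S: "linear_map ?E ?K (pair_c00 a)"
      by (auto simp: linear_map_def c00_space_def scalar_space_def pair_c00_add_right pair_c00_scale_right)
    have bound: "vnorm ?K (pair_c00 a u) \<le> \<bar>C\<bar> * vnorm ?E u" if "u \<in> vset ?E" for u
    proof -
      have u: "u \<in> c00" using that by (simp add: E)
      have "C * fam_norm F u \<le> \<bar>C\<bar> * fam_norm F u"
        using fam_norm_nonneg[OF F fam_bdd_c00[OF F u]] by (intro mult_right_mono) auto
      then show ?thesis using C[OF u] by (simp add: E Knorm)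
    qed
    obtain L where L: "linear_map X ?K L" "\<And>u. u \<in> vset ?E \<Longrightarrow> L (j u) = pair_c00 a u"
      "\<And>x. x \<in> vset X \<Longrightarrow> vnorm ?K (L x) \<le> \<bar>C\<bar> * vnorm X x"
      by (rule extend_bounded_linear_map[OF NE NX BK j dense S bound]) auto
    define f where "f = (\<lambda>x. if x \<in> vset X then L x else 0)"
    have "linear_map X ?K f"
      using L(1) vset_add[OF NX] vset_smul[OF NX] by (simp add: linear_map_def f_def scalar_space_def)
    moreover have "\<forall>x\<in>vset X. norm (f x) \<le> \<bar>C\<bar> * vnorm X x"
      using L(3) by (simp add: f_def Knorm)
    ultimately have "f \<in> vset (dual_space X)" by (auto simp: dual_space_def f_def)
    moreover have "\<Phi> f = a"
    proof
      fix i
      have "\<Phi> f i = pair_c00 a (unit_seq i)"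
        using L(2)[of "unit_seq i"] jin[OF unit_seq_c00] by (simp add: \<Phi>_def f_def E unit_seq_c00)
      then show "\<Phi> f i = a i" by (simp add: pair_c00_unit_seq)
    qed
    ultimately show ?thesis by blast
  qed
  have norm1: "vnorm (dual_space X) f \<le> 1 \<longleftrightarrow> dominated F (\<Phi> f)" if f: "f \<in> vset (dual_space X)" for f
  proof -
    obtain C where C: "\<And>x. x \<in> vset X \<Longrightarrow> norm (f x) \<le> C * vnorm X x" using dual(2)[OF f] by blast
    have "(\<forall>x\<in>vset X. norm (f x) \<le> vnorm X x) \<longleftrightarrow> (\<forall>u\<in>c00. norm (f (j u)) \<le> vnorm X (j u))"
    proof
      assume le: "\<forall>u\<in>c00. norm (f (j u)) \<le> vnorm X (j u)"
      show "\<forall>x\<in>vset X. norm (f x) \<le> vnorm X x"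
      proof
        fix x assume x: "x \<in> vset X"
        show "norm (f x) \<le> vnorm X x"
        proof (rule field_le_epsilon)
          fix e :: real assume e: "0 < e"
          define d where "d = e / (\<bar>C\<bar> + 1)"
          have pos: "0 < \<bar>C\<bar> + 1" by simp
          then have d: "0 < d" "(\<bar>C\<bar> + 1) * d = e" using e by (simp_all add: d_def)
          obtain u where u: "u \<in> c00" "vnorm X (x - j u) < d" using dense[OF x d(1)] E by auto
          note ju = jin[OF u(1)] vset_diff[OF NX x jin[OF u(1)]]
          have "norm (f x) \<le> norm (f (x - j u)) + norm (f (j u))"
            using linear_map_add[OF dual(1)[OF f] ju(2,1)] by (simp add: norm_triangle_ineq)
          also have "norm (f (x - j u)) \<le> \<bar>C\<bar> * vnorm X (x - j u)"
            using C[OF ju(2)] vnorm_nonneg[OF NX ju(2)] by (meson abs_ge_self mult_right_mono order_trans)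
          also have "\<dots> \<le> \<bar>C\<bar> * d" using u by (intro mult_left_mono) auto
          also have "norm (f (j u)) \<le> vnorm X (j u)" using le u by blast
          also have "\<dots> \<le> vnorm X (j u - x) + vnorm X x" by (rule vnorm_le_diff[OF NX ju(1) x])
          also have "vnorm X (j u - x) \<le> d" using u vnorm_minus_commute[OF NX x ju(1)] by simp
          finally have "norm (f x) \<le> \<bar>C\<bar> * d + (d + vnorm X x)" by simp
          then show "norm (f x) \<le> vnorm X x + e" using d(2) by (simp add: distrib_right)
        qed
      qed
    qed (use jin in blast)
    then show ?thesis
      unfolding dual_norm_le_one_iff[OF NX f] dominated_iff_pair_c00[OF F]
      using val[OF dual(1)[OF f]] jn by simp
  qed
  show thesis
  proof
    show "bij_betw \<Phi> (vset (dual_space X)) (bounded_coefficients F)"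
      unfolding bij_betw_def inj_on_def using inj into surj by blast
    show "\<Phi> (f + g) = \<Phi> f + \<Phi> g" for f g by (simp add: \<Phi>_def fun_eq_iff)
    show "\<Phi> (smul (dual_space X) c f) = (\<lambda>i. c * \<Phi> f i)" for c f by (simp add: \<Phi>_def dual_space_def)
  qed (rule norm1)
qed

text \<open>
  Conjugation with the two coefficient maps turns the isometry of the dual spaces into an isometry of
  coefficient spaces.
\<close>
lemma isometric_duals_pi_homeomorphic:
  fixes X :: "('k::real_or_complex, 'a::ab_group_add) nspace"
    and Y :: "('k, 'b::ab_group_add) nspace"
  assumes F: "regular_family F" and G: "regular_family G"
    and X: "is_combinatorial_space F X" and Y: "is_combinatorial_space G Y"
    and iso: "isometric (dual_space X) (dual_space Y)"
  shows "pi_homeomorphic F G"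
proof -
  let ?X = "dual_space X" and ?Y = "dual_space Y"
  let ?V = "bounded_coefficients F :: (nat \<Rightarrow> 'k) set" and ?W = "bounded_coefficients G :: (nat \<Rightarrow> 'k) set"
  have fam: "is_family F" "is_family G" using F G by (auto simp: regular_family_def)
  obtain \<Phi> where \<Phi>: "bij_betw \<Phi> (vset ?X) ?V" "\<And>f g. \<Phi> (f + g) = \<Phi> f + \<Phi> g"
    "\<And>c f. \<Phi> (smul ?X c f) = (\<lambda>i. c * \<Phi> f i)"
    "\<And>f. f \<in> vset ?X \<Longrightarrow> vnorm ?X f \<le> 1 \<longleftrightarrow> dominated F (\<Phi> f)"
    using dual_space_coefficients[OF fam(1) X] by blast
  obtain \<Psi> where \<Psi>: "bij_betw \<Psi> (vset ?Y) ?W" "\<And>f g. \<Psi> (f + g) = \<Psi> f + \<Psi> g"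
    "\<And>c f. \<Psi> (smul ?Y c f) = (\<lambda>i. c * \<Psi> f i)"
    "\<And>f. f \<in> vset ?Y \<Longrightarrow> vnorm ?Y f \<le> 1 \<longleftrightarrow> dominated G (\<Psi> f)"
    using dual_space_coefficients[OF fam(2) Y] by blast
  obtain S where S: "linear_map ?X ?Y S" "bij_betw S (vset ?X) (vset ?Y)" "norm_preserving ?X ?Y S"
    using iso by (auto simp: isometric_def)
  define D where "D = inv_into (vset ?X) \<Phi>"
  have D: "D a \<in> vset ?X" "\<Phi> (D a) = a" if "a \<in> ?V" for a
    using bij_betw_inv_into[OF \<Phi>(1)] bij_betw_inv_into_right[OF \<Phi>(1) that] that
    unfolding D_def by (auto simp: bij_betw_def)
  have DI: "D (\<Phi> f) = f" if "f \<in> vset ?X" for f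
    unfolding D_def by (rule bij_betw_inv_into_left[OF \<Phi>(1) that])
  define T where "T = (\<lambda>a. \<Psi> (S (D a)))"
  have T_bij: "bij_betw T ?V ?W"
    unfolding T_def using bij_betw_trans[OF bij_betw_inv_into[OF \<Phi>(1)] bij_betw_trans[OF S(2) \<Psi>(1)]]
    by (simp add: D_def comp_def)
  define T' where "T' = inv_into ?V T"
  have "dual_isometry F G ?V ?W T T'"
  proof
    fix a b assume ab: "a \<in> ?V" "b \<in> ?V"
    have "D (a + b) = D a + D b"
      using DI[OF dual_space_add[OF D(1)[OF ab(1)] D(1)[OF ab(2)]]] \<Phi>(2) D(2) ab by simp
    then show "T (a + b) = T a + T b"
      unfolding T_def using linear_map_add[OF S(1)] D(1) ab \<Psi>(2) by simp
  next
    fix a c assume a: "a \<in> ?V"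
    have "D (\<lambda>i. c * a i) = smul ?X c (D a)"
      using DI[OF dual_space_scale[OF D(1)[OF a], of c]] \<Phi>(3) D(2)[OF a] by simp
    then show "T (\<lambda>i. c * a i) = (\<lambda>i. c * T a i)"
      unfolding T_def using linear_map_smul[OF S(1)] D(1) a \<Psi>(3) by simp
  next
    fix a assume a: "a \<in> ?V"
    have "S (D a) \<in> vset ?Y" using linear_map_in[OF S(1) D(1)[OF a]] .
    then show "dominated G (T a) \<longleftrightarrow> dominated F a"
      using \<Psi>(4)[of "S (D a)"] \<Phi>(4)[OF D(1)[OF a]] D[OF a] S(3)
      by (simp add: T_def norm_preserving_def)
  next
    show "T a \<in> ?W" if "a \<in> ?V" for a using T_bij that by (auto simp: bij_betw_def)
    show "T' a \<in> ?V" if "a \<in> ?W" for a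
      using bij_betw_inv_into[OF T_bij] that unfolding T'_def by (auto simp: bij_betw_def)
    show "T' (T a) = a" if "a \<in> ?V" for a
      unfolding T'_def by (rule bij_betw_inv_into_left[OF T_bij that])
    show "T (T' a) = a" if "a \<in> ?W" for a
      unfolding T'_def by (rule bij_betw_inv_into_right[OF T_bij that])
  qed (use F G fam in \<open>auto intro: bounded_coefficients_add bounded_coefficients_scale dominated_bounded_coefficients\<close>)
  then show ?thesis by (rule dual_isometry.pi_homeomorphic)
qed

theorem corollary14:
  fixes F G :: "nat set set"
    and X :: "('k::real_or_complex, 'a::ab_group_add) nspace"
    and Y :: "('k, 'b::ab_group_add) nspace"
  assumes "regular_family F" and "regular_family G"
    and "is_combinatorial_space F X" and "is_combinatorial_space G Y"
  shows "(F = G \<longleftrightarrow> pi_homeomorphic F G) \<and>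
         (F = G \<longleftrightarrow> isometric X Y) \<and>
         (F = G \<longleftrightarrow> isometric (dual_space X) (dual_space Y))"
proof -
  have reg: "is_family F" "spreading F" "is_family G" "spreading G"
    using assms(1,2) by (auto simp: regular_family_def)
  have normed: "normed_space X" "normed_space Y"
    using assms(3,4) by (auto simp: is_combinatorial_space_def is_completion_of_def banach_space_def)
  have "isometric X Y" if "F = G"
    using completions_isometric[OF normed_c00_space[OF reg(1)]] assms(3,4) that
    by (simp add: is_combinatorial_space_def)
  moreover have "isometric (dual_space X) (dual_space Y)" if "isometric X Y"
    by (rule isometric_duals[OF normed that])
  moreover have "pi_homeomorphic F G" if "isometric (dual_space X) (dual_space Y)"
    by (rule isometric_duals_pi_homeomorphic[OF assms that])
  moreover have "pi_homeomorphic F G \<longleftrightarrow> F = G"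
    by (rule pi_homeomorphic_iff_eq[OF reg])
  ultimately show ?thesis by blast
qed

end
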